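(* Let $\mathcal{C}$ be a (strict) monoidal category and let $A$ be an object of $\mathcal{C}$. The following data are equivalent: (i) a structure of quasi-commutative monoid on $A$; (ii) a cosimplicial complex of monoids $A^*$ in $\mathcal{C}$ with $A^1=A$, satisfying the covering condition; (iii) a length 3 truncated cosimplicial complex of monoids $A^*$ in $\mathcal{C}$ with $A^1=A$, satisfying the covering condition. Here "equivalent" means that each datum of one kind determines, and is determined by, a datum of each of the other kinds, where the data in (ii) and (iii) are considered up to isomorphisms of (truncated) cosimplicial monoids that are the identity on $A^1=A$.
   Context: Composition of morphisms is written right to left, $I$ denotes an identity morphism, and $1$ is the unit object. A monoid in a strict monoidal category is an object $A$ with morphisms $\mu:A\otimes A\to A$ and $\iota:1\to A$ such that $\mu(\mu\otimes I)=\mu(I\otimes\mu)$ and $\mu(\iota\otimes I)=\mu(I\otimes\iota)=I$. A homomorphism of monoids is a morphism $f:A\to B$ with $\mu(f\otimes f)=f\mu$ and $f\iota=\iota$. $\mathrm{Mon}(\mathcal{C})$ is the category of monoids in $\mathcal{C}$. A Yang-Baxter operator on $A$ is an isomorphism $R:A\otimes A\to A\otimes A$ with $(R\otimes I)(I\otimes R)(R\otimes I)=(I\otimes R)(R\otimes I)(I\otimes R)$. A braided monoid is a monoid $(A,\mu,\iota)$ with a Yang-Baxter operator $R$ on $A$ such that $R(\iota\otimes I)=I\otimes\iota$, $R(I\otimes\iota)=\iota\otimes I$, $R(I\otimes\mu)=(\mu\otimes I)(I\otimes R)(R\otimes I)$, and $R(\mu\otimes I)=(I\otimes\mu)(R\otimes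 I)(I\otimes R)$. It is quasi-commutative if in addition $\mu R=\mu$. A structure of quasi-commutative monoid on an object $A$ is a triple $(\mu,\iota,R)$ with these properties. Write $[n]=\{1,\dots,n\}$ with its usual order. A cosimplicial complex of monoids (cosimplicial monoid) in $\mathcal{C}$ is a functor $[n]\mapsto A^n$, $n\ge 1$, from the category of the finite ordinals $[n]$, $n\geq 1$, and order-preserving maps to $\mathrm{Mon}(\mathcal{C})$; for an order-preserving $f:[m]\to[n]$ the induced homomorphism is denoted $A^f:A^m\to A^n$. A length 3 truncated cosimplicial complex of monoids is such a functor defined on the full subcategory on $[1],[2],[3]$ only. Covering condition: for every $n$ (for every $n\le 3$ in the truncated case) and every finite collection of injective order-preserving maps $f_i:[n_i]\to[n]$, $i=1,\dots,m$ (the collection being listed in any order), with $\mathrm{im}(f_i)\cap \mathrm{im}(f_j)=\emptyset$ for $i\ne j$ and $\bigcup_i \mathrm{im}(f_i)=[n]$, the covering map $$\bigotimes_{i=1}^m A^{n_i}\xrightarrow{\ \otimes_i A^{f_i}\ }(A^n)^{\otimes m}\xrightarrow{\ \mathrm{mult}\ }A^n$$ is an isomorphism in $\mathcal{C}$, where $\mathrm{mult}$ is the iterated multiplication of the monoid $A^n$. *)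

theory Defs
  imports "HOL-Library.FuncSet"
begin

section \<open>Categories, functors, strict monoidal categories\<close>

record ('o, 'a) cat =
  Ob :: "'o set"
  Ar :: "'a set"
  src :: "'a \<Rightarrow> 'o"
  tgt :: "'a \<Rightarrow> 'o"
  idn :: "'o \<Rightarrow> 'a"
  cmp :: "'a \<Rightarrow> 'a \<Rightarrow> 'a"  (infixr "\<cdot>\<index>" 70)

text \<open>Composition is written right to left: \<open>g \<cdot>\<^bsub>C\<^esub> f\<close> is meaningful when \<open>tgt C f = src C g\<close>.\<close>

locale category =
  fixes C :: "('o, 'a, 'x) cat_scheme" (structure)
  assumes src_closed: "f \<in> Ar C \<Longrightarrow> src C f \<in> Ob C"
    and tgt_closed: "f \<in> Ar C \<Longrightarrow> tgt C f \<in> Ob C"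
    and idn_closed: "X \<in> Ob C \<Longrightarrow> idn C X \<in> Ar C"
    and src_idn: "X \<in> Ob C \<Longrightarrow> src C (idn C X) = X"
    and tgt_idn: "X \<in> Ob C \<Longrightarrow> tgt C (idn C X) = X"
    and cmp_closed: "\<lbrakk>f \<in> Ar C; g \<in> Ar C; tgt C f = src C g\<rbrakk> \<Longrightarrow> g \<cdot> f \<in> Ar C"
    and src_cmp: "\<lbrakk>f \<in> Ar C; g \<in> Ar C; tgt C f = src C g\<rbrakk> \<Longrightarrow> src C (g \<cdot> f) = src C f"
    and tgt_cmp: "\<lbrakk>f \<in> Ar C; g \<in> Ar C; tgt C f = src C g\<rbrakk> \<Longrightarrow> tgt C (g \<cdot> f) = tgt C g"
    and cmp_idn_right: "f \<in> Ar C \<Longrightarrow> f \<cdot> idn C (src C f) = f"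
    and cmp_idn_left: "f \<in> Ar C \<Longrightarrow> idn C (tgt C f) \<cdot> f = f"
    and cmp_assoc: "\<lbrakk>f \<in> Ar C; g \<in> Ar C; h \<in> Ar C; tgt C f = src C g; tgt C g = src C h\<rbrakk>
      \<Longrightarrow> (h \<cdot> g) \<cdot> f = h \<cdot> (g \<cdot> f)"

definition hom_set :: "('o, 'a, 'x) cat_scheme \<Rightarrow> 'o \<Rightarrow> 'o \<Rightarrow> 'a set" where
  "hom_set C X Y = {f \<in> Ar C. src C f = X \<and> tgt C f = Y}"

definition inverse_arrows :: "('o, 'a, 'x) cat_scheme \<Rightarrow> 'a \<Rightarrow> 'a \<Rightarrow> bool" where
  "inverse_arrows C f g \<longleftrightarrow> g \<in> hom_set C (tgt C f) (src C f)
     \<and> g \<cdot>\<^bsub>C\<^esub> f = idn C (src C f) \<and> f \<cdot>\<^bsub>C\<^esub> g = idn C (tgt C f)"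

definition is_iso :: "('o, 'a, 'x) cat_scheme \<Rightarrow> 'a \<Rightarrow> bool" where
  "is_iso C f \<longleftrightarrow> f \<in> Ar C \<and> (\<exists>g. inverse_arrows C f g)"

definition inv_arrow :: "('o, 'a, 'x) cat_scheme \<Rightarrow> 'a \<Rightarrow> 'a" where
  "inv_arrow C f = (THE g. inverse_arrows C f g)"

definition full_subcategory :: "('o, 'a) cat \<Rightarrow> 'o set \<Rightarrow> ('o, 'a) cat" where
  "full_subcategory D S = D\<lparr>Ob := Ob D \<inter> S, Ar := {f \<in> Ar D. src D f \<in> S \<and> tgt D f \<in> S}\<rparr>"

record ('o, 'a, 'p, 'b) functor_data =
  fob :: "'o \<Rightarrow> 'p"
  far :: "'a \<Rightarrow> 'b"

definition is_functor :: "('o, 'a) cat \<Rightarrow> ('p, 'b) cat \<Rightarrow> ('o, 'a, 'p, 'b) functor_data \<Rightarrow> bool" where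
  "is_functor D E F \<longleftrightarrow>
     (\<forall>X\<in>Ob D. fob F X \<in> Ob E)
   \<and> (\<forall>f\<in>Ar D. far F f \<in> hom_set E (fob F (src D f)) (fob F (tgt D f)))
   \<and> (\<forall>X\<in>Ob D. far F (idn D X) = idn E (fob F X))
   \<and> (\<forall>f\<in>Ar D. \<forall>g\<in>Ar D. tgt D f = src D g \<longrightarrow> far F (g \<cdot>\<^bsub>D\<^esub> f) = far F g \<cdot>\<^bsub>E\<^esub> far F f)"

definition natural_iso :: "('o, 'a) cat \<Rightarrow> ('p, 'b) cat \<Rightarrow>
    ('o, 'a, 'p, 'b) functor_data \<Rightarrow> ('o, 'a, 'p, 'b) functor_data \<Rightarrow> ('o \<Rightarrow> 'b) \<Rightarrow> bool" where
  "natural_iso D E F G \<alpha> \<longleftrightarrow>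
     (\<forall>X\<in>Ob D. \<alpha> X \<in> hom_set E (fob F X) (fob G X) \<and> is_iso E (\<alpha> X))
   \<and> (\<forall>f\<in>Ar D. \<alpha> (tgt D f) \<cdot>\<^bsub>E\<^esub> far F f = far G f \<cdot>\<^bsub>E\<^esub> \<alpha> (src D f))"

definition restrict_functor :: "('o, 'a) cat \<Rightarrow> ('o, 'a, 'p, 'b) functor_data \<Rightarrow> ('o, 'a, 'p, 'b) functor_data" where
  "restrict_functor D F = \<lparr>fob = restrict (fob F) (Ob D), far = restrict (far F) (Ar D)\<rparr>"

record ('o, 'a) mcat = "('o, 'a) cat" +
  tob :: "'o \<Rightarrow> 'o \<Rightarrow> 'o"  (infixr "\<odot>\<index>" 80)
  tar :: "'a \<Rightarrow> 'a \<Rightarrow> 'a"  (infixr "\<otimes>\<index>" 80)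
  tunit :: 'o

locale strict_monoidal_category = category C
  for C :: "('o, 'a, 'x) mcat_scheme" (structure) +
  assumes tunit_closed: "tunit C \<in> Ob C"
    and tob_closed: "\<lbrakk>X \<in> Ob C; Y \<in> Ob C\<rbrakk> \<Longrightarrow> X \<odot> Y \<in> Ob C"
    and tar_closed: "\<lbrakk>f \<in> Ar C; g \<in> Ar C\<rbrakk> \<Longrightarrow> f \<otimes> g \<in> Ar C"
    and src_tar: "\<lbrakk>f \<in> Ar C; g \<in> Ar C\<rbrakk> \<Longrightarrow> src C (f \<otimes> g) = src C f \<odot> src C g"
    and tgt_tar: "\<lbrakk>f \<in> Ar C; g \<in> Ar C\<rbrakk> \<Longrightarrow> tgt C (f \<otimes> g) = tgt C f \<odot> tgt C g"
    and tar_idn: "\<lbrakk>X \<in> Ob C; Y \<in> Ob C\<rbrakk> \<Longrightarrow> idn C X \<otimes> idn C Y = idn C (X \<odot> Y)"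
    and tar_cmp: "\<lbrakk>f \<in> Ar C; g \<in> Ar C; f' \<in> Ar C; g' \<in> Ar C; tgt C f = src C g; tgt C f' = src C g'\<rbrakk>
      \<Longrightarrow> (g \<cdot> f) \<otimes> (g' \<cdot> f') = (g \<otimes> g') \<cdot> (f \<otimes> f')"
    and tob_assoc: "\<lbrakk>X \<in> Ob C; Y \<in> Ob C; Z \<in> Ob C\<rbrakk> \<Longrightarrow> (X \<odot> Y) \<odot> Z = X \<odot> (Y \<odot> Z)"
    and tar_assoc: "\<lbrakk>f \<in> Ar C; g \<in> Ar C; h \<in> Ar C\<rbrakk> \<Longrightarrow> (f \<otimes> g) \<otimes> h = f \<otimes> (g \<otimes> h)"
    and tob_unit_left: "X \<in> Ob C \<Longrightarrow> tunit C \<odot> X = X"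
    and tob_unit_right: "X \<in> Ob C \<Longrightarrow> X \<odot> tunit C = X"
    and tar_unit_left: "f \<in> Ar C \<Longrightarrow> idn C (tunit C) \<otimes> f = f"
    and tar_unit_right: "f \<in> Ar C \<Longrightarrow> f \<otimes> idn C (tunit C) = f"

section \<open>Monoids and quasi-commutative monoids\<close>

record ('o, 'a) mon =
  mobj :: 'o
  mmul :: 'a
  mone :: 'a

definition is_mon :: "('o, 'a, 'x) mcat_scheme \<Rightarrow> ('o, 'a) mon \<Rightarrow> bool" where
  "is_mon C M \<longleftrightarrow> (let A = mobj M; \<mu> = mmul M; \<iota> = mone M; I = idn C A in
     A \<in> Ob C \<and> \<mu> \<in> hom_set C (A \<odot>\<^bsub>C\<^esub> A) A \<and> \<iota> \<in> hom_set C (tunit C) A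
   \<and> \<mu> \<cdot>\<^bsub>C\<^esub> (\<mu> \<otimes>\<^bsub>C\<^esub> I) = \<mu> \<cdot>\<^bsub>C\<^esub> (I \<otimes>\<^bsub>C\<^esub> \<mu>)
   \<and> \<mu> \<cdot>\<^bsub>C\<^esub> (\<iota> \<otimes>\<^bsub>C\<^esub> I) = I \<and> \<mu> \<cdot>\<^bsub>C\<^esub> (I \<otimes>\<^bsub>C\<^esub> \<iota>) = I)"

definition is_mon_hom :: "('o, 'a, 'x) mcat_scheme \<Rightarrow> ('o, 'a) mon \<Rightarrow> ('o, 'a) mon \<Rightarrow> 'a \<Rightarrow> bool" where
  "is_mon_hom C M N f \<longleftrightarrow> f \<in> hom_set C (mobj M) (mobj N)
   \<and> mmul N \<cdot>\<^bsub>C\<^esub> (f \<otimes>\<^bsub>C\<^esub> f) = f \<cdot>\<^bsub>C\<^esub> mmul M \<and> f \<cdot>\<^bsub>C\<^esub> mone M = mone N"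

text \<open>A morphism of monoids \<open>(M, f, N)\<close> is an underlying morphism \<open>f\<close> together with its
  source and target monoids.\<close>

definition Mon :: "('o, 'a, 'x) mcat_scheme \<Rightarrow>
    (('o, 'a) mon, ('o, 'a) mon \<times> 'a \<times> ('o, 'a) mon) cat" where
  "Mon C = \<lparr>
     Ob = {M. is_mon C M},
     Ar = {(M, f, N). is_mon C M \<and> is_mon C N \<and> is_mon_hom C M N f},
     src = (\<lambda>(M, f, N). M),
     tgt = (\<lambda>(M, f, N). N),
     idn = (\<lambda>M. (M, idn C (mobj M), M)),
     cmp = (\<lambda>(N', g, P) (M, f, N). (M, g \<cdot>\<^bsub>C\<^esub> f, P))\<rparr>"

definition und :: "('o, 'a) mon \<times> 'a \<times> ('o, 'a) mon \<Rightarrow> 'a" where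
  "und = (\<lambda>(M, f, N). f)"

definition yang_baxter :: "('o, 'a, 'x) mcat_scheme \<Rightarrow> 'o \<Rightarrow> 'a \<Rightarrow> bool" where
  "yang_baxter C A R \<longleftrightarrow> (let I = idn C A in
     R \<in> hom_set C (A \<odot>\<^bsub>C\<^esub> A) (A \<odot>\<^bsub>C\<^esub> A) \<and> is_iso C R
   \<and> (R \<otimes>\<^bsub>C\<^esub> I) \<cdot>\<^bsub>C\<^esub> (I \<otimes>\<^bsub>C\<^esub> R) \<cdot>\<^bsub>C\<^esub> (R \<otimes>\<^bsub>C\<^esub> I)
     = (I \<otimes>\<^bsub>C\<^esub> R) \<cdot>\<^bsub>C\<^esub> (R \<otimes>\<^bsub>C\<^esub> I) \<cdot>\<^bsub>C\<^esub> (I \<otimes>\<^bsub>C\<^esub> R))"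

definition is_braided_mon :: "('o, 'a, 'x) mcat_scheme \<Rightarrow> ('o, 'a) mon \<Rightarrow> 'a \<Rightarrow> bool" where
  "is_braided_mon C M R \<longleftrightarrow> (let A = mobj M; \<mu> = mmul M; \<iota> = mone M; I = idn C A in
     is_mon C M \<and> yang_baxter C A R
   \<and> R \<cdot>\<^bsub>C\<^esub> (\<iota> \<otimes>\<^bsub>C\<^esub> I) = I \<otimes>\<^bsub>C\<^esub> \<iota>
   \<and> R \<cdot>\<^bsub>C\<^esub> (I \<otimes>\<^bsub>C\<^esub> \<iota>) = \<iota> \<otimes>\<^bsub>C\<^esub> I
   \<and> R \<cdot>\<^bsub>C\<^esub> (I \<otimes>\<^bsub>C\<^esub> \<mu>) = (\<mu> \<otimes>\<^bsub>C\<^esub> I) \<cdot>\<^bsub>C\<^esub> (I \<otimes>\<^bsub>C\<^esub> R) \<cdot>\<^bsub>C\<^esub> (R \<otimes>\<^bsub>C\<^esub> I)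
   \<and> R \<cdot>\<^bsub>C\<^esub> (\<mu> \<otimes>\<^bsub>C\<^esub> I) = (I \<otimes>\<^bsub>C\<^esub> \<mu>) \<cdot>\<^bsub>C\<^esub> (R \<otimes>\<^bsub>C\<^esub> I) \<cdot>\<^bsub>C\<^esub> (I \<otimes>\<^bsub>C\<^esub> R))"

definition is_quasicomm_mon :: "('o, 'a, 'x) mcat_scheme \<Rightarrow> ('o, 'a) mon \<Rightarrow> 'a \<Rightarrow> bool" where
  "is_quasicomm_mon C M R \<longleftrightarrow> is_braided_mon C M R \<and> mmul M \<cdot>\<^bsub>C\<^esub> R = mmul M"

definition quasicomm_structures :: "('o, 'a, 'x) mcat_scheme \<Rightarrow> 'o \<Rightarrow> ('a \<times> 'a \<times> 'a) set" where
  "quasicomm_structures C A =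
     {(\<mu>, \<iota>, R). is_quasicomm_mon C \<lparr>mobj = A, mmul = \<mu>, mone = \<iota>\<rparr> R}"

section \<open>Cosimplicial monoids\<close>

text \<open>The object \<open>[n]\<close> is the number \<open>n\<close>. An order-preserving map \<open>[m] \<rightarrow> [n]\<close> is a triple
  \<open>(m, u, n)\<close> where \<open>u\<close> is extensional (undefined outside \<open>{1..m}\<close>), so that equality of
  triples is equality of maps.\<close>

definition simplex_cat :: "(nat, nat \<times> (nat \<Rightarrow> nat) \<times> nat) cat" where
  "simplex_cat = \<lparr>
     Ob = {1..},
     Ar = {(m, u, n). 1 \<le> m \<and> 1 \<le> n \<and> u \<in> {1..m} \<rightarrow>\<^sub>E {1..n} \<and> mono_on {1..m} u},
     src = (\<lambda>(m, u, n). m),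
     tgt = (\<lambda>(m, u, n). n),
     idn = (\<lambda>n. (n, restrict (\<lambda>i. i) {1..n}, n)),
     cmp = (\<lambda>(n', v, p) (m, u, n). (m, compose {1..m} v u, p))\<rparr>"

definition simplex_cat3 :: "(nat, nat \<times> (nat \<Rightarrow> nat) \<times> nat) cat" where
  "simplex_cat3 = full_subcategory simplex_cat {1, 2, 3}"

type_synonym ('o, 'a) cosimp =
  "(nat, nat \<times> (nat \<Rightarrow> nat) \<times> nat, ('o, 'a) mon, ('o, 'a) mon \<times> 'a \<times> ('o, 'a) mon) functor_data"

definition im :: "nat \<times> (nat \<Rightarrow> nat) \<times> nat \<Rightarrow> nat set" where
  "im = (\<lambda>(m, u, n). u ` {1..m})"

definition covering_family :: "nat \<Rightarrow> (nat \<times> (nat \<Rightarrow> nat) \<times> nat) list \<Rightarrow> bool" where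
  "covering_family n fs \<longleftrightarrow>
     (\<forall>(k, u, l) \<in> set fs. (k, u, l) \<in> Ar simplex_cat \<and> l = n \<and> inj_on u {1..k})
   \<and> (\<forall>i<length fs. \<forall>j<length fs. i \<noteq> j \<longrightarrow> im (fs ! i) \<inter> im (fs ! j) = {})
   \<and> (\<Union>f\<in>set fs. im f) = {1..n}"

primrec tensor_list :: "('o, 'a, 'x) mcat_scheme \<Rightarrow> 'a list \<Rightarrow> 'a" where
  "tensor_list C [] = idn C (tunit C)"
| "tensor_list C (f # fs) = f \<otimes>\<^bsub>C\<^esub> tensor_list C fs"

primrec iter_mult :: "('o, 'a, 'x) mcat_scheme \<Rightarrow> ('o, 'a) mon \<Rightarrow> nat \<Rightarrow> 'a" where
  "iter_mult C M 0 = mone M"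
| "iter_mult C M (Suc m) = mmul M \<cdot>\<^bsub>C\<^esub> (idn C (mobj M) \<otimes>\<^bsub>C\<^esub> iter_mult C M m)"

definition covering_map :: "('o, 'a, 'x) mcat_scheme \<Rightarrow> ('o, 'a) cosimp \<Rightarrow> nat \<Rightarrow>
    (nat \<times> (nat \<Rightarrow> nat) \<times> nat) list \<Rightarrow> 'a" where
  "covering_map C F n fs =
     iter_mult C (fob F n) (length fs) \<cdot>\<^bsub>C\<^esub> tensor_list C (map (\<lambda>f. und (far F f)) fs)"

text \<open>In the following definitions \<open>D\<close> is \<open>simplex_cat\<close> or \<open>simplex_cat3\<close>.\<close>

definition covering_condition :: "(nat, nat \<times> (nat \<Rightarrow> nat) \<times> nat) cat \<Rightarrow>
    ('o, 'a, 'x) mcat_scheme \<Rightarrow> ('o, 'a) cosimp \<Rightarrow> bool" where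
  "covering_condition D C F \<longleftrightarrow>
     (\<forall>n\<in>Ob D. \<forall>fs. covering_family n fs \<longrightarrow> is_iso C (covering_map C F n fs))"

definition covering_cosimp :: "(nat, nat \<times> (nat \<Rightarrow> nat) \<times> nat) cat \<Rightarrow>
    ('o, 'a, 'x) mcat_scheme \<Rightarrow> 'o \<Rightarrow> ('o, 'a) cosimp set" where
  "covering_cosimp D C A =
     {F. is_functor D (Mon C) F \<and> mobj (fob F 1) = A \<and> covering_condition D C F}"

definition cosimp_iso :: "(nat, nat \<times> (nat \<Rightarrow> nat) \<times> nat) cat \<Rightarrow>
    ('o, 'a, 'x) mcat_scheme \<Rightarrow> 'o \<Rightarrow> (('o, 'a) cosimp \<times> ('o, 'a) cosimp) set" where
  "cosimp_iso D C A = {(F, G). F \<in> covering_cosimp D C A \<and> G \<in> covering_cosimp D C A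
     \<and> (\<exists>\<alpha>. natural_iso D (Mon C) F G \<alpha> \<and> und (\<alpha> 1) = idn C A)}"

section \<open>The correspondences\<close>

text \<open>The quasi-commutative monoid attached to \<open>A\<^sup>*\<close>: the multiplication and unit are those of
  \<open>A\<^sup>1\<close>, and \<open>R = c\<^sub>1\<^sub>2\<^sup>-\<^sup>1 c\<^sub>2\<^sub>1\<close>, where \<open>c\<^sub>1\<^sub>2\<close> and \<open>c\<^sub>2\<^sub>1\<close> are the covering maps
  \<open>A \<otimes> A \<rightarrow> A\<^sup>2\<close> for the two orderings of the two maps \<open>[1] \<rightarrow> [2]\<close>.\<close>

definition pt :: "nat \<Rightarrow> nat \<times> (nat \<Rightarrow> nat) \<times> nat" where
  "pt j = (1, restrict (\<lambda>_. j) {1..1}, 2)"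

definition cosimp_braiding :: "('o, 'a, 'x) mcat_scheme \<Rightarrow> ('o, 'a) cosimp \<Rightarrow> 'a" where
  "cosimp_braiding C F =
     inv_arrow C (covering_map C F 2 [pt 1, pt 2]) \<cdot>\<^bsub>C\<^esub> covering_map C F 2 [pt 2, pt 1]"

definition quasicomm_of :: "('o, 'a, 'x) mcat_scheme \<Rightarrow> ('o, 'a) cosimp \<Rightarrow> 'a \<times> 'a \<times> 'a" where
  "quasicomm_of C F = (mmul (fob F 1), mone (fob F 1), cosimp_braiding C F)"

definition truncate3 :: "('o, 'a) cosimp \<Rightarrow> ('o, 'a) cosimp" where
  "truncate3 F = restrict_functor simplex_cat3 F"

text \<open>The data \<open>X\<close> up to the equivalence \<open>r\<close> and the data \<open>Y\<close> up to the equivalence \<open>s\<close>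
  correspond to each other under \<open>\<phi>\<close>: it takes data in \<open>X\<close> to data in \<open>Y\<close>, and the map which
  it induces on equivalence classes is bijective. The union over a class is a single
  \<open>s\<close>-class exactly when \<open>\<phi>\<close> is compatible with \<open>r\<close> and \<open>s\<close> there.\<close>

definition equivalent_data :: "('x \<Rightarrow> 'y) \<Rightarrow> 'x set \<Rightarrow> ('x \<times> 'x) set \<Rightarrow> 'y set \<Rightarrow> ('y \<times> 'y) set \<Rightarrow> bool" where
  "equivalent_data \<phi> X r Y s \<longleftrightarrow> equiv X r \<and> equiv Y s \<and> \<phi> ` X \<subseteq> Y
     \<and> bij_betw (\<lambda>K. \<Union>x\<in>K. s `` {\<phi> x}) (X // r) (Y // s)"

end

theory Submission
  imports Defs
begin

text \<open>
  Everything is read off from representations: families of operators \<open>l\<^sub>i : A \<otimes> X \<rightarrow> X\<close>, \<open>i < n\<close>,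
  which are unital actions of the monoid \<open>A\<close> and satisfy \<open>l\<^sub>i (I \<otimes> l\<^sub>j) (R \<otimes> I) = l\<^sub>j (I \<otimes> l\<^sub>i)\<close> for
  \<open>i \<le> j\<close>. For quasi-commutative \<open>A\<close> the power \<open>A\<^sup>n\<close> carries such a family, which moves the new
  factor past the first \<open>i\<close> ones by \<open>R\<close> and then multiplies. A sorted word in the operators of any
  representation \<open>X\<close> intertwines the family on a power of \<open>A\<close> with that on \<open>X\<close>; this single fact gives
  the associativity of the product on \<open>A\<^sup>n\<close>, the homomorphisms \<open>A\<^sup>f\<close> and their functoriality, as in
  Cayley's theorem, without any coherence argument for braids. The covering maps are words that differ
  from the sorted one by invertible copies of \<open>R\<close>.

  Conversely, left multiplication by the images of the points \<open>[1] \<rightarrow> [n]\<close> makes \<open>A\<^sup>n\<close> in any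
  cosimplicial monoid with the covering condition a representation, with \<open>R\<close> the comparison of the
  two covering maps in \<open>A\<^sup>2\<close>. Cancelling covering maps in \<open>A\<^sup>1\<close>, \<open>A\<^sup>2\<close> and \<open>A\<^sup>3\<close> yields the axioms of a
  quasi-commutative monoid, and the sorted covering maps form an isomorphism from the tensor powers.
\<close>

section \<open>Strict monoidal categories\<close>

text \<open>The relation is imposed for i \<le> j only, because R need not be an involution:
  reversing a pair with i > j would call for the inverse of R. Hence it is the sorted words that
  intertwine, and nonempty sorted words are exactly the order-preserving maps. Injective maps use
  the relation for i < j; repeated letters, which are the degeneracies, use it for i = j. This is
  why quasi-commutativity, rather than commutativity, is the condition that matches maps preserving
  the order.

  The bound 3 comes from the converse. An equation between morphisms of tensor powers of A is tested
  by letting both sides act on a representation and cancelling an invertible word. The laws relating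
  R to the unit and to the multiplication compare words in two letters and are tested on A^2. The
  Yang-Baxter equation compares words in three letters and is tested on A^3. The equation \<mu> R =
  \<mu> is what remains in A^1 when the two points of A^2 are collapsed.\<close>

context category
begin

lemma hom_setI: "\<lbrakk>f \<in> Ar C; src C f = X; tgt C f = Y\<rbrakk> \<Longrightarrow> f \<in> hom_set C X Y"
  by (simp add: hom_set_def)

lemma hom_setD:
  assumes "f \<in> hom_set C X Y"
  shows "f \<in> Ar C" "src C f = X" "tgt C f = Y" "X \<in> Ob C" "Y \<in> Ob C"
  using assms src_closed tgt_closed by (auto simp: hom_set_def)

lemma cmp_idn_right': "\<lbrakk>f \<in> Ar C; src C f = X\<rbrakk> \<Longrightarrow> f \<cdot> idn C X = f"
  using cmp_idn_right by blast

lemma cmp_idn_left': "\<lbrakk>f \<in> Ar C; tgt C f = X\<rbrakk> \<Longrightarrow> idn C X \<cdot> f = f"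
  using cmp_idn_left by blast

text \<open>Composites are normalised to right-nested form, and the typing conditions are membership
  in \<open>Ar C\<close> and equations for \<open>src\<close> and \<open>tgt\<close>, all provable
  by rewriting. Facts about \<open>hom_set\<close> therefore reach the simplifier through
  \<open>hom_setD\<close>.\<close>

lemmas cat_simps [simp] = idn_closed src_idn tgt_idn cmp_closed src_cmp tgt_cmp
  cmp_idn_right' cmp_idn_left' cmp_assoc

text \<open>A rule with left side \<open>g \<cdot> f\<close> no longer matches in a right-nested
  composite that continues with a tail h; this form rewrites in front of the tail.\<close>

lemma cmp_eq_extend:
  assumes "g \<cdot> f = k" "f \<in> Ar C" "g \<in> Ar C" "h \<in> Ar C" "tgt C f = src C g" "tgt C h = src C f"
  shows "g \<cdot> (f \<cdot> h) = k \<cdot> h"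
  using assms cmp_assoc by metis

lemma inverse_arrows_sym: "f \<in> Ar C \<Longrightarrow> inverse_arrows C f g \<Longrightarrow> inverse_arrows C g f"
  by (auto simp: inverse_arrows_def hom_set_def)

lemma inverse_arrows_unique:
  assumes "f \<in> Ar C" "inverse_arrows C f g" "inverse_arrows C f h"
  shows "g = h"
proof -
  have "g \<cdot> (f \<cdot> h) = (g \<cdot> f) \<cdot> h"
    using assms by (intro cmp_assoc[symmetric]) (auto simp: inverse_arrows_def hom_set_def)
  then show ?thesis
    using assms by (auto simp: inverse_arrows_def hom_set_def)
qed

lemma inverse_arrows_inv_arrow: "is_iso C f \<Longrightarrow> inverse_arrows C f (inv_arrow C f)"
  unfolding is_iso_def inv_arrow_def using inverse_arrows_unique by (metis theI)

lemma inv_arrow_props: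
  assumes "is_iso C f" "f \<in> hom_set C X Y"
  shows "inv_arrow C f \<in> Ar C" "src C (inv_arrow C f) = Y" "tgt C (inv_arrow C f) = X"
    "inv_arrow C f \<cdot> f = idn C X" "f \<cdot> inv_arrow C f = idn C Y"
  using inverse_arrows_inv_arrow[OF assms(1)] assms(2)
  by (auto simp: inverse_arrows_def hom_set_def)

lemma is_isoI:
  assumes "f \<in> hom_set C X Y" "g \<in> hom_set C Y X" "g \<cdot> f = idn C X" "f \<cdot> g = idn C Y"
  shows "is_iso C f"
  using assms by (auto simp: is_iso_def inverse_arrows_def hom_set_def)

lemma is_iso_inv_arrow: "is_iso C f \<Longrightarrow> is_iso C (inv_arrow C f)"
  using inverse_arrows_inv_arrow[of f] inverse_arrows_sym[of f "inv_arrow C f"]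
  by (auto simp: is_iso_def inverse_arrows_def hom_set_def)

lemma is_iso_idn: "X \<in> Ob C \<Longrightarrow> is_iso C (idn C X)"
  by (rule is_isoI[of _ X X "idn C X"]) (auto simp: hom_set_def)

lemma is_iso_cmp:
  assumes f: "is_iso C f" "f \<in> hom_set C X Y" and g: "is_iso C g" "g \<in> hom_set C Y Z"
  shows "is_iso C (g \<cdot> f)"
proof (rule is_isoI[of _ X Z "inv_arrow C f \<cdot> inv_arrow C g"])
  note props = inv_arrow_props[OF f] inv_arrow_props[OF g] hom_setD[OF f(2)] hom_setD[OF g(2)]
  show "g \<cdot> f \<in> hom_set C X Z" "inv_arrow C f \<cdot> inv_arrow C g \<in> hom_set C Z X"
    using props by (auto intro!: hom_setI)
  show "(inv_arrow C f \<cdot> inv_arrow C g) \<cdot> g \<cdot> f = idn C X"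
    using props cmp_eq_extend[OF inv_arrow_props(4)[OF g]] by simp
  show "(g \<cdot> f) \<cdot> inv_arrow C f \<cdot> inv_arrow C g = idn C Z"
    using props cmp_eq_extend[OF inv_arrow_props(5)[OF f]] by simp
qed

lemma is_iso_cancel:
  assumes "is_iso C f" "f \<cdot> g = f \<cdot> h" "g \<in> Ar C" "h \<in> Ar C" "tgt C g = src C f" "tgt C h = src C f"
  shows "g = h"
proof -
  have f: "f \<in> hom_set C (src C f) (tgt C f)"
    using assms(1) by (auto simp: is_iso_def hom_set_def)
  note props = inv_arrow_props[OF assms(1) f] hom_setD[OF f]
  have "(inv_arrow C f \<cdot> f) \<cdot> g = (inv_arrow C f \<cdot> f) \<cdot> h"
    using assms props by (metis cmp_assoc)
  then show ?thesis
    using assms props by simp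
qed

end

context strict_monoidal_category
begin

section \<open>Whiskering and the interchange law\<close>

abbreviation whisker_left (infixr "\<rhd>" 80) where "X \<rhd> f \<equiv> idn C X \<otimes> f"
abbreviation whisker_right (infixl "\<lhd>" 85) where "f \<lhd> X \<equiv> f \<otimes> idn C X"

lemma whisker_left_cmp:
  "\<lbrakk>X \<in> Ob C; f \<in> Ar C; g \<in> Ar C; tgt C f = src C g\<rbrakk> \<Longrightarrow> X \<rhd> (g \<cdot> f) = (X \<rhd> g) \<cdot> (X \<rhd> f)"
  using tar_cmp[of "idn C X" "idn C X" f g] by simp

lemma whisker_right_cmp:
  "\<lbrakk>X \<in> Ob C; f \<in> Ar C; g \<in> Ar C; tgt C f = src C g\<rbrakk> \<Longrightarrow> (g \<cdot> f) \<lhd> X = (g \<lhd> X) \<cdot> (f \<lhd> X)"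
  using tar_cmp[of f g "idn C X" "idn C X"] by simp

lemma whisker_left_left:
  "\<lbrakk>X \<in> Ob C; Y \<in> Ob C; f \<in> Ar C\<rbrakk> \<Longrightarrow> X \<rhd> Y \<rhd> f = (X \<odot> Y) \<rhd> f"
  by (metis idn_closed tar_assoc tar_idn)

text \<open>Expressions become right-nested composites of whiskered morphisms. The interchange law
  has no preferred direction, so it stays out and is applied explicitly wherever two morphisms slide
  past each other.\<close>

lemmas mon_simps [simp] = tunit_closed tob_closed tar_closed src_tar tgt_tar tar_idn tob_assoc
  tar_assoc tob_unit_left tob_unit_right tar_unit_left tar_unit_right
  whisker_left_cmp whisker_right_cmp whisker_left_left

lemma interchange:
  "\<lbrakk>f \<in> hom_set C X X'; g \<in> hom_set C Y Y'\<rbrakk>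
    \<Longrightarrow> (f \<lhd> Y') \<cdot> (X \<rhd> g) = f \<otimes> g"
  using tar_cmp[of "idn C X" f g "idn C Y'"] hom_setD[of f X X'] hom_setD[of g Y Y'] by simp

lemma interchange':
  "\<lbrakk>f \<in> hom_set C X X'; g \<in> hom_set C Y Y'\<rbrakk>
    \<Longrightarrow> (X' \<rhd> g) \<cdot> (f \<lhd> Y) = f \<otimes> g"
  using tar_cmp[of f "idn C X'" "idn C Y" g] hom_setD[of f X X'] hom_setD[of g Y Y'] by simp

text \<open>The two-sided form covers both one-sided cases, since strictness lets X or Y be the unit
  object.\<close>

lemma is_iso_whisker:
  assumes "is_iso C f" "X \<in> Ob C" "Y \<in> Ob C"
  shows "is_iso C (X \<rhd> f \<lhd> Y)"
proof -
  have f: "f \<in> hom_set C (src C f) (tgt C f)"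
    using assms(1) by (auto simp: is_iso_def hom_set_def)
  note props = inv_arrow_props[OF assms(1) f] hom_setD[OF f]
  have "X \<rhd> (inv_arrow C f \<cdot> f) \<lhd> Y = idn C (X \<odot> src C f \<odot> Y)"
    "X \<rhd> (f \<cdot> inv_arrow C f) \<lhd> Y = idn C (X \<odot> tgt C f \<odot> Y)"
    using assms props(4-) by (simp_all del: whisker_left_cmp whisker_right_cmp)
  then show ?thesis
    using assms props(1-3,6-)
    by (intro is_isoI[of _ "X \<odot> src C f \<odot> Y" "X \<odot> tgt C f \<odot> Y" "X \<rhd> inv_arrow C f \<lhd> Y"] hom_setI)
      simp_all
qed

end

section \<open>Representations of quasi-commutative monoids\<close>

text \<open>Only the types of \<mu>, \<iota> and R are assumed. The definitions must also be
  available for the data extracted from a cosimplicial monoid, whose axioms are proved by means of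
  them.\<close>

locale multiplication_data = strict_monoidal_category C
  for C :: "('o, 'a, 'x) mcat_scheme" (structure) +
  fixes A :: 'o and \<mu> \<iota> R :: 'a
  assumes A_closed [simp]: "A \<in> Ob C"
    and \<mu>_hom: "\<mu> \<in> hom_set C (A \<odot> A) A"
    and \<iota>_hom: "\<iota> \<in> hom_set C (tunit C) A"
    and R_hom: "R \<in> hom_set C (A \<odot> A) (A \<odot> A)"
begin

lemmas data_simps [simp] = hom_setD(1-3)[OF \<mu>_hom] hom_setD(1-3)[OF \<iota>_hom] hom_setD(1-3)[OF R_hom]

primrec tpow :: "nat \<Rightarrow> 'o" where
  "tpow 0 = tunit C"
| "tpow (Suc n) = A \<odot> tpow n"

lemma tpow_closed [simp]: "tpow n \<in> Ob C"
  by (induction n) auto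

lemma tpow_add: "tpow (m + n) = tpow m \<odot> tpow n"
  by (induction m) auto

text \<open>Operator \<open>l i\<close> belongs to the point i + 1 of [n]. By the action law, the
  last clause at i = j reads \<open>l i \<cdot> ((\<mu> \<cdot> R) \<lhd> X) = l i \<cdot> (\<mu>
  \<lhd> X)\<close>, the trace of quasi-commutativity on a representation.\<close>

definition rep :: "nat \<Rightarrow> 'o \<Rightarrow> (nat \<Rightarrow> 'a) \<Rightarrow> bool" where
  "rep n X l \<longleftrightarrow> X \<in> Ob C
    \<and> (\<forall>i<n. l i \<in> hom_set C (A \<odot> X) X \<and> l i \<cdot> (\<iota> \<lhd> X) = idn C X
        \<and> l i \<cdot> (\<mu> \<lhd> X) = l i \<cdot> (A \<rhd> l i))
    \<and> (\<forall>j<n. \<forall>i\<le>j. l i \<cdot> (A \<rhd> l j) \<cdot> (R \<lhd> X) = l j \<cdot> (A \<rhd> l i))"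

lemma repD:
  assumes "rep n X l" "i < n"
  shows "X \<in> Ob C" "l i \<in> hom_set C (A \<odot> X) X" "l i \<in> Ar C" "src C (l i) = A \<odot> X" "tgt C (l i) = X"
    "l i \<cdot> (\<iota> \<lhd> X) = idn C X" "l i \<cdot> (\<mu> \<lhd> X) = l i \<cdot> (A \<rhd> l i)"
  using assms hom_setD[of "l i" "A \<odot> X" X] by (auto simp: rep_def)

lemma rep_braid:
  assumes "rep n X l" "j < n" "i \<le> j"
  shows "l i \<cdot> (A \<rhd> l j) \<cdot> (R \<lhd> X) = l j \<cdot> (A \<rhd> l i)"
  using assms by (auto simp: rep_def)

section \<open>Words in a family of operators\<close>

primrec act :: "'o \<Rightarrow> (nat \<Rightarrow> 'a) \<Rightarrow> nat list \<Rightarrow> 'a" where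
  "act X l [] = idn C X"
| "act X l (i # w) = l i \<cdot> (A \<rhd> act X l w)"

text \<open>The typing half of \<open>rep\<close>: words can be formed and compared before any law
  is known, in particular for the points of a cosimplicial monoid.\<close>

definition operators :: "nat \<Rightarrow> 'o \<Rightarrow> (nat \<Rightarrow> 'a) \<Rightarrow> bool" where
  "operators n X l \<longleftrightarrow> X \<in> Ob C \<and> (\<forall>i<n. l i \<in> hom_set C (A \<odot> X) X)"

lemma operatorsD:
  assumes "operators n X l"
  shows "X \<in> Ob C" "i < n \<Longrightarrow> l i \<in> Ar C" "i < n \<Longrightarrow> src C (l i) = A \<odot> X" "i < n \<Longrightarrow> tgt C (l i) = X"
  using assms hom_setD[of "l i" "A \<odot> X" X] by (auto simp: operators_def)

lemma rep_operators: "rep n X l \<Longrightarrow> operators n X l"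
  by (auto simp: rep_def operators_def)

lemma act_hom:
  assumes "operators n X l" "set w \<subseteq> {..<n}"
  shows "act X l w \<in> Ar C" "src C (act X l w) = tpow (length w) \<odot> X" "tgt C (act X l w) = X"
  using assms(2) by (induction w) (auto simp: operatorsD[OF assms(1)])

lemma act_append:
  assumes "operators n X l" "set u \<subseteq> {..<n}" "set v \<subseteq> {..<n}"
  shows "act X l (u @ v) = act X l u \<cdot> (tpow (length u) \<rhd> act X l v)"
  using assms(2)
  by (induction u) (simp_all add: act_hom[OF assms(1)] operatorsD[OF assms(1)] assms(3))

lemma act_whisker:
  assumes "operators n X l" "set w \<subseteq> {..<n}" "Y \<in> Ob C"
  shows "act (X \<odot> Y) (\<lambda>i. l i \<lhd> Y) w = act X l w \<lhd> Y"
  using assms(2)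
  by (induction w) (simp_all add: act_hom[OF assms(1)] operatorsD[OF assms(1)] assms(3))

text \<open>The morphism h moves past one letter at a time. The relabelling \<phi> is the place
  where order-preserving maps will enter.\<close>

lemma act_intertwine:
  assumes X: "operators m X l" and Y: "operators n Y k" and h: "h \<in> hom_set C X Y"
    and w: "set w \<subseteq> {..<m}" "\<phi> ` set w \<subseteq> {..<n}"
    and comm: "\<And>i. i \<in> set w \<Longrightarrow> h \<cdot> l i = k (\<phi> i) \<cdot> (A \<rhd> h)"
  shows "h \<cdot> act X l w = act Y k (map \<phi> w) \<cdot> (tpow (length w) \<rhd> h)"
  using w comm
proof (induction w)
  case Nil
  then show ?case
    using hom_setD[OF h] by simp
next
  case (Cons i w)
  note simps = act_hom[OF X] act_hom[OF Y] operatorsD[OF X] operatorsD[OF Y] hom_setD[OF h]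
  have IH: "h \<cdot> act X l w = act Y k (map \<phi> w) \<cdot> (tpow (length w) \<rhd> h)"
    using Cons by simp
  have sets: "set w \<subseteq> {..<m}" "set (map \<phi> w) \<subseteq> {..<n}" "i < m" "\<phi> i < n"
    using Cons.prems by auto
  have "h \<cdot> act X l (i # w) = (h \<cdot> l i) \<cdot> (A \<rhd> act X l w)"
    using sets by (simp add: simps)
  also have "\<dots> = k (\<phi> i) \<cdot> (A \<rhd> (h \<cdot> act X l w))"
    using sets Cons.prems(3)[of i] by (simp add: simps)
  also have "\<dots> = act Y k (map \<phi> (i # w)) \<cdot> (tpow (length (i # w)) \<rhd> h)"
    unfolding IH using sets by (simp add: simps)
  finally show ?case .
qed

section \<open>The operators on tensor powers of A\<close>

definition extend :: "'o \<Rightarrow> (nat \<Rightarrow> 'a) \<Rightarrow> nat \<Rightarrow> 'a" where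
  "extend X l = case_nat (\<mu> \<lhd> X) (\<lambda>k. (A \<rhd> l k) \<cdot> (R \<lhd> X))"

lemma extend_simps [simp]:
  "extend X l 0 = \<mu> \<lhd> X" "extend X l (Suc k) = (A \<rhd> l k) \<cdot> (R \<lhd> X)"
  by (simp_all add: extend_def)

text \<open>Starting from the unit object with no operators, each \<open>extend\<close> adds a
  factor in front and an operator number 0, and the old operators are renumbered by
  \<open>Suc\<close>. The value at 0 is a placeholder, as no index lies below 0.\<close>

primrec shuffle :: "nat \<Rightarrow> nat \<Rightarrow> 'a" where
  "shuffle 0 = (\<lambda>k. idn C (tunit C))"
| "shuffle (Suc n) = extend (tpow n) (shuffle n)"

lemma extend_operators: "operators n X l \<Longrightarrow> operators (Suc n) (A \<odot> X) (extend X l)"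
  unfolding operators_def
  by (auto simp: less_Suc_eq_0_disj hom_setD intro!: hom_setI)

lemma shuffle_operators: "operators n (tpow n) (shuffle n)"
proof (induction n)
  case 0
  then show ?case by (simp add: operators_def)
next
  case (Suc n)
  then show ?case using extend_operators by simp
qed

lemmas shuffle_hom [simp] = operatorsD(2-4)[OF shuffle_operators]

text \<open>The intertwining property of sorted words. In the induction with first letter j,
  position 0 is the action law of \<open>l j\<close>; position i + 1 uses the hypothesis under one
  factor A and then the exchange relation for j \<le> \<open>w ! i\<close>, which sortedness
  supplies. Letters may repeat, so equal indices occur too.\<close>

lemma act_shuffle:
  assumes X: "rep n X l"
  shows "\<lbrakk>sorted w; set w \<subseteq> {..<n}; k < length w\<rbrakk>
    \<Longrightarrow> act X l w \<cdot> (shuffle (length w) k \<lhd> X) = l (w ! k) \<cdot> (A \<rhd> act X l w)"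
proof (induction w arbitrary: k)
  case Nil
  then show ?case by simp
next
  case (Cons j w)
  note ops = rep_operators[OF X]
  note simps = act_hom[OF ops] operatorsD[OF ops]
  let ?a = "act X l w" and ?P = "tpow (length w)"
  have j: "j < n" and w: "sorted w" "set w \<subseteq> {..<n}" and le: "\<And>i. i \<in> set w \<Longrightarrow> j \<le> i"
    using Cons.prems by auto
  have a: "?a \<in> hom_set C (?P \<odot> X) X"
    using w by (auto intro!: hom_setI simp: simps)
  note ty = simps(1-3)[OF w(2)] j
  show ?case
  proof (cases k)
    case 0
    have "act X l (j # w) \<cdot> (shuffle (length (j # w)) k \<lhd> X) = l j \<cdot> (A \<rhd> ?a) \<cdot> (\<mu> \<lhd> (?P \<odot> X))"
      using 0 ty by (simp add: simps)
    also have "\<dots> = l j \<cdot> (\<mu> \<lhd> X) \<cdot> ((A \<odot> A) \<rhd> ?a)"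
      using interchange[OF \<mu>_hom a] interchange'[OF \<mu>_hom a] by simp
    also have "\<dots> = (l j \<cdot> (\<mu> \<lhd> X)) \<cdot> ((A \<odot> A) \<rhd> ?a)"
      using ty by (simp add: simps)
    also have "\<dots> = l j \<cdot> (A \<rhd> act X l (j # w))"
      unfolding repD(7)[OF X j] using ty by (simp add: simps)
    finally show ?thesis using 0 by simp
  next
    case (Suc i)
    let ?i = "w ! i"
    have i: "i < length w" "?i < n" "j \<le> ?i"
      using Cons.prems Suc le nth_mem[of i w] w by fastforce+
    have IH: "?a \<cdot> (shuffle (length w) i \<lhd> X) = l ?i \<cdot> (A \<rhd> ?a)"
      using Cons.IH w i by simp
    have "act X l (j # w) \<cdot> (shuffle (length (j # w)) k \<lhd> X)
        = l j \<cdot> (A \<rhd> (?a \<cdot> (shuffle (length w) i \<lhd> X))) \<cdot> (R \<lhd> (?P \<odot> X))"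
      using Suc ty i by (simp add: simps)
    also have "\<dots> = l j \<cdot> (A \<rhd> l ?i) \<cdot> ((A \<odot> A) \<rhd> ?a) \<cdot> (R \<lhd> (?P \<odot> X))"
      unfolding IH using ty i by (simp add: simps)
    also have "\<dots> = l j \<cdot> (A \<rhd> l ?i) \<cdot> (R \<lhd> X) \<cdot> ((A \<odot> A) \<rhd> ?a)"
      using interchange[OF R_hom a] interchange'[OF R_hom a] by simp
    also have "\<dots> = (l j \<cdot> (A \<rhd> l ?i) \<cdot> (R \<lhd> X)) \<cdot> ((A \<odot> A) \<rhd> ?a)"
      using ty i by (simp add: simps)
    also have "\<dots> = l ?i \<cdot> (A \<rhd> act X l (j # w))"
      unfolding rep_braid[OF X i(2,3)] using ty i by (simp add: simps)
    finally show ?thesis using Suc by simp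
  qed
qed

text \<open>The n-fold tensor power of \<iota>, written as a composite.\<close>

primrec tone :: "nat \<Rightarrow> 'a" where
  "tone 0 = idn C (tunit C)"
| "tone (Suc n) = (\<iota> \<lhd> tpow n) \<cdot> tone n"

lemma tone_hom [simp]: "tone n \<in> Ar C" "src C (tone n) = tunit C" "tgt C (tone n) = tpow n"
  by (induction n) auto

lemma act_tone:
  assumes X: "rep n X l"
  shows "set w \<subseteq> {..<n} \<Longrightarrow> act X l w \<cdot> (tone (length w) \<lhd> X) = idn C X"
proof (induction w)
  case Nil
  then show ?case using repD(1) X by (simp add: rep_def)
next
  case (Cons j w)
  note ops = rep_operators[OF X]
  note simps = act_hom[OF ops] operatorsD[OF ops]
  let ?a = "act X l w" and ?P = "tpow (length w)"
  have j: "j < n" and w: "set w \<subseteq> {..<n}"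
    using Cons.prems by auto
  have a: "?a \<in> hom_set C (?P \<odot> X) X"
    using w by (auto intro!: hom_setI simp: simps)
  have "act X l (j # w) \<cdot> (tone (length (j # w)) \<lhd> X)
      = l j \<cdot> ((A \<rhd> ?a) \<cdot> (\<iota> \<lhd> (?P \<odot> X))) \<cdot> (tone (length w) \<lhd> X)"
    using w j by (simp add: simps)
  also have "(A \<rhd> ?a) \<cdot> (\<iota> \<lhd> (?P \<odot> X)) = (\<iota> \<lhd> X) \<cdot> ?a"
    using interchange[OF \<iota>_hom a] interchange'[OF \<iota>_hom a] w by (simp add: simps)
  also have "l j \<cdot> ((\<iota> \<lhd> X) \<cdot> ?a) \<cdot> (tone (length w) \<lhd> X)
      = (l j \<cdot> (\<iota> \<lhd> X)) \<cdot> ?a \<cdot> (tone (length w) \<lhd> X)"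
    using w j by (simp add: simps)
  also have "\<dots> = idn C X"
    unfolding Cons.IH[OF w] repD(6)[OF X j] by (simp add: simps)
  finally show ?case .
qed

text \<open>By \<open>act_shuffle\<close>, the morphism \<open>act X l w\<close> intertwines the
  whiskered operators of the tensor power with those of X, relabelling k to \<open>w ! k\<close>;
  \<open>act_intertwine\<close> extends this from letters to words. When X is the tensor power
  itself and both words are \<open>[0..<n]\<close>, the statement is associativity.\<close>

lemma act_act:
  assumes X: "rep n X l" and w: "sorted w" "set w \<subseteq> {..<n}" and v: "set v \<subseteq> {..<length w}"
  shows "act X l w \<cdot> (act (tpow (length w)) (shuffle (length w)) v \<lhd> X)
    = act X l (map ((!) w) v) \<cdot> (tpow (length v) \<rhd> act X l w)"
proof -
  let ?m = "length w"
  note ops = rep_operators[OF X]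
  have Xob [simp]: "X \<in> Ob C" by (rule operatorsD(1)[OF ops])
  have ops': "operators ?m (tpow ?m \<odot> X) (\<lambda>k. shuffle ?m k \<lhd> X)"
    by (auto simp: operators_def intro!: hom_setI)
  have h: "act X l w \<in> hom_set C (tpow ?m \<odot> X) X"
    using w by (auto intro!: hom_setI simp: act_hom[OF ops])
  have "act X l w \<cdot> act (tpow ?m \<odot> X) (\<lambda>k. shuffle ?m k \<lhd> X) v
      = act X l (map ((!) w) v) \<cdot> (tpow (length v) \<rhd> act X l w)"
    using w v nth_mem[of _ w] by (intro act_intertwine[OF ops' ops h] act_shuffle[OF X]) blast+
  then show ?thesis
    using act_whisker[OF shuffle_operators v Xob] by simp
qed

text \<open>Evaluating a word at an element e of X gives a morphism out of a tensor power of A. If X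
  is a monoid with unit e and the operators are left multiplications by points, the value is the
  product of the points along the word, which is the shape of a covering map.\<close>

definition ev :: "'o \<Rightarrow> (nat \<Rightarrow> 'a) \<Rightarrow> 'a \<Rightarrow> nat list \<Rightarrow> 'a" where
  "ev X l e w = act X l w \<cdot> (tpow (length w) \<rhd> e)"

lemma ev_hom:
  assumes "operators n X l" "set w \<subseteq> {..<n}" "e \<in> hom_set C (tunit C) X"
  shows "ev X l e w \<in> Ar C" "src C (ev X l e w) = tpow (length w)" "tgt C (ev X l e w) = X"
  unfolding ev_def using hom_setD[OF assms(3)] by (simp_all add: act_hom[OF assms(1,2)])

lemma ev_hom':
  assumes "operators n X l" "set w \<subseteq> {..<n}" "e \<in> hom_set C (tunit C) X"
  shows "ev X l e w \<in> hom_set C (tpow (length w)) X"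
  using ev_hom[OF assms] by (simp add: hom_setI)

lemma ev_intertwine:
  assumes X: "operators m X l" and Y: "operators n Y k" and h: "h \<in> hom_set C X Y"
    and e: "e \<in> hom_set C (tunit C) X"
    and w: "set w \<subseteq> {..<m}" "\<phi> ` set w \<subseteq> {..<n}"
    and comm: "\<And>i. i \<in> set w \<Longrightarrow> h \<cdot> l i = k (\<phi> i) \<cdot> (A \<rhd> h)"
  shows "h \<cdot> ev X l e w = ev Y k (h \<cdot> e) (map \<phi> w)"
proof -
  have w': "set (map \<phi> w) \<subseteq> {..<n}" using w by simp
  note simps = act_hom[OF X w(1)] act_hom[OF Y w'] hom_setD[OF h] hom_setD[OF e]
  have "h \<cdot> ev X l e w = (h \<cdot> act X l w) \<cdot> (tpow (length w) \<rhd> e)"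
    by (simp add: ev_def simps)
  also have "h \<cdot> act X l w = act Y k (map \<phi> w) \<cdot> (tpow (length w) \<rhd> h)"
    by (rule act_intertwine[OF X Y h w comm])
  also have "\<dots> \<cdot> (tpow (length w) \<rhd> e) = ev Y k (h \<cdot> e) (map \<phi> w)"
    by (simp add: ev_def simps)
  finally show ?thesis .
qed

lemma ev_append:
  assumes X: "operators n X l" and uv: "set u \<subseteq> {..<n}" "set v \<subseteq> {..<n}"
    and e: "e \<in> hom_set C (tunit C) X"
  shows "ev X l e (u @ v) = act X l u \<cdot> (tpow (length u) \<rhd> ev X l e v)"
  using act_hom[OF X] uv hom_setD[OF e] by (simp add: ev_def act_append[OF X uv] tpow_add)

text \<open>Together with \<open>ev_tone\<close> this makes the value of a sorted word a morphism of
  representations that preserves the chosen element, so it can serve as the morphism h in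
  \<open>ev_intertwine\<close>.\<close>

lemma ev_shuffle:
  assumes X: "rep n X l" and w: "sorted w" "set w \<subseteq> {..<n}" and k: "k < length w"
    and e: "e \<in> hom_set C (tunit C) X"
  shows "ev X l e w \<cdot> shuffle (length w) k = l (w ! k) \<cdot> (A \<rhd> ev X l e w)"
proof -
  let ?P = "tpow (length w)"
  note ops = rep_operators[OF X]
  have wk: "w ! k < n" using w(2) nth_mem[OF k] by blast
  note simps = act_hom[OF ops w(2)] operatorsD[OF ops] hom_setD[OF e]
  have s: "shuffle (length w) k \<in> hom_set C (A \<odot> ?P) ?P"
    using k by (simp add: hom_setI)
  have "ev X l e w \<cdot> shuffle (length w) k
      = act X l w \<cdot> (?P \<rhd> e) \<cdot> (shuffle (length w) k \<lhd> tunit C)"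
    using k by (simp add: ev_def simps)
  also have "\<dots> = act X l w \<cdot> (shuffle (length w) k \<lhd> X) \<cdot> ((A \<odot> ?P) \<rhd> e)"
    unfolding interchange[OF s e] interchange'[OF s e] ..
  also have "\<dots> = (act X l w \<cdot> (shuffle (length w) k \<lhd> X)) \<cdot> ((A \<odot> ?P) \<rhd> e)"
    using k by (simp add: simps)
  also have "\<dots> = l (w ! k) \<cdot> (A \<rhd> ev X l e w)"
    unfolding act_shuffle[OF X w k] using wk by (simp add: ev_def simps)
  finally show ?thesis .
qed

lemma ev_tone:
  assumes X: "rep n X l" and w: "set w \<subseteq> {..<n}" and e: "e \<in> hom_set C (tunit C) X"
  shows "ev X l e w \<cdot> tone (length w) = e"
proof -
  let ?P = "tpow (length w)"
  note ops = rep_operators[OF X]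
  note simps = act_hom[OF ops w] operatorsD[OF ops] hom_setD[OF e]
  have s: "tone (length w) \<in> hom_set C (tunit C) ?P"
    by (simp add: hom_setI)
  have "ev X l e w \<cdot> tone (length w) = act X l w \<cdot> (?P \<rhd> e) \<cdot> (tone (length w) \<lhd> tunit C)"
    by (simp add: ev_def simps)
  also have "\<dots> = act X l w \<cdot> (tone (length w) \<lhd> X) \<cdot> (tunit C \<rhd> e)"
    unfolding interchange[OF s e] interchange'[OF s e] ..
  also have "\<dots> = (act X l w \<cdot> (tone (length w) \<lhd> X)) \<cdot> e"
    by (simp add: simps)
  also have "\<dots> = e"
    unfolding act_tone[OF X w] by (simp add: simps)
  finally show ?thesis .
qed

text \<open>One step of insertion sort: for y < x the exchange relation trades the letters x, y for
  y, x at the price of one whiskered R. Only the invertibility of Q is recorded, so no braid has to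
  be chosen for a permutation.\<close>

lemma act_insort:
  assumes X: "rep n X l" and R: "is_iso C R" and x: "x < n" and w: "set w \<subseteq> {..<n}"
  shows "\<exists>Q \<in> hom_set C (tpow (Suc (length w))) (tpow (Suc (length w))). is_iso C Q
    \<and> act X l (x # w) = act X l (insort x w) \<cdot> (Q \<lhd> X)"
  using w
proof (induction w)
  case Nil
  then show ?case
    using x by (intro bexI[of _ "idn C A"]) (auto simp: operatorsD[OF rep_operators[OF X]] is_iso_idn hom_setI)
next
  case (Cons y w)
  note ops = rep_operators[OF X]
  note simps = act_hom[OF ops] operatorsD[OF ops]
  let ?P = "tpow (length w)"
  have y: "y < n" and w: "set w \<subseteq> {..<n}" using Cons.prems by auto
  have ins: "set (insort x w) \<subseteq> {..<n}" using x w by (auto simp: set_insort_key)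
  show ?case
  proof (cases "x \<le> y")
    case True
    then show ?thesis
      using x y w by (intro bexI[of _ "idn C (A \<odot> A \<odot> ?P)"]) (auto simp: simps is_iso_idn hom_setI)
  next
    case False
    have a: "act X l w \<in> hom_set C (?P \<odot> X) X"
      using w by (auto intro!: hom_setI simp: simps)
    from Cons.IH[OF w] obtain Q where Q: "Q \<in> hom_set C (A \<odot> ?P) (A \<odot> ?P)" "is_iso C Q"
      and eq: "act X l (x # w) = act X l (insort x w) \<cdot> (Q \<lhd> X)"
      unfolding tpow.simps by blast
    note Qs = hom_setD[OF Q(1)]
    let ?Q = "(A \<rhd> Q) \<cdot> (R \<lhd> ?P)"
    have "act X l (x # y # w) = (l x \<cdot> (A \<rhd> l y)) \<cdot> ((A \<odot> A) \<rhd> act X l w)"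
      using x y w by (simp add: simps)
    also have "\<dots> = l y \<cdot> (A \<rhd> l x) \<cdot> ((R \<lhd> X) \<cdot> ((A \<odot> A) \<rhd> act X l w))"
      unfolding rep_braid[OF X x less_imp_le[OF False[unfolded not_le]], symmetric]
      using x y w by (simp add: simps)
    also have "\<dots> = l y \<cdot> (A \<rhd> l x) \<cdot> (((A \<odot> A) \<rhd> act X l w) \<cdot> (R \<lhd> (?P \<odot> X)))"
      unfolding interchange[OF R_hom a] interchange'[OF R_hom a] ..
    also have "\<dots> = l y \<cdot> (A \<rhd> act X l (x # w)) \<cdot> (R \<lhd> (?P \<odot> X))"
      using x y w by (simp add: simps)
    also have "\<dots> = act X l (insort x (y # w)) \<cdot> (?Q \<lhd> X)"
      unfolding eq using False x y ins Qs by (simp add: simps)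
    finally have "act X l (x # y # w) = act X l (insort x (y # w)) \<cdot> (?Q \<lhd> X)" .
    moreover have "?Q \<in> hom_set C (A \<odot> A \<odot> ?P) (A \<odot> A \<odot> ?P)"
      using Qs by (simp add: hom_setI)
    moreover have "is_iso C ?Q"
      using is_iso_whisker[OF Q(2), of A "tunit C"] is_iso_whisker[OF R, of "tunit C" ?P] Qs
      by (intro is_iso_cmp[of "R \<lhd> ?P" "A \<odot> A \<odot> ?P" "A \<odot> A \<odot> ?P" _ "A \<odot> A \<odot> ?P"]) (simp_all add: hom_setI)
    ultimately show ?thesis
      unfolding length_Cons tpow.simps by blast
  qed
qed

lemma act_sort:
  assumes X: "rep n X l" and R: "is_iso C R" and w: "set w \<subseteq> {..<n}"
  shows "\<exists>Q \<in> hom_set C (tpow (length w)) (tpow (length w)). is_iso C Q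
    \<and> act X l w = act X l (sort w) \<cdot> (Q \<lhd> X)"
  using w
proof (induction w)
  case Nil
  then show ?case
    by (intro bexI[of _ "idn C (tunit C)"])
      (auto simp: operatorsD[OF rep_operators[OF X]] is_iso_idn hom_setI)
next
  case (Cons x w)
  note ops = rep_operators[OF X]
  note simps = act_hom[OF ops] operatorsD[OF ops]
  let ?P = "tpow (length w)"
  have x: "x < n" and w: "set w \<subseteq> {..<n}" using Cons.prems by auto
  have ins: "set (insort x (sort w)) \<subseteq> {..<n}" "set (sort w) \<subseteq> {..<n}"
    using x w by (auto simp: set_insort_key)
  from Cons.IH[OF w] obtain Q where Q: "Q \<in> hom_set C ?P ?P" "is_iso C Q"
    and eq: "act X l w = act X l (sort w) \<cdot> (Q \<lhd> X)" by blast
  from act_insort[OF X R x ins(2)] obtain Q' where Q': "Q' \<in> hom_set C (A \<odot> ?P) (A \<odot> ?P)" "is_iso C Q'"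
    and eq': "act X l (x # sort w) = act X l (insort x (sort w)) \<cdot> (Q' \<lhd> X)"
    unfolding tpow.simps length_sort by blast
  note Qs = hom_setD[OF Q(1)] hom_setD[OF Q'(1)]
  have "act X l (x # w) = act X l (x # sort w) \<cdot> (A \<rhd> Q \<lhd> X)"
    using x w ins Qs by (simp add: simps eq)
  also have "\<dots> = act X l (sort (x # w)) \<cdot> ((Q' \<cdot> (A \<rhd> Q)) \<lhd> X)"
    unfolding eq' using x w ins Qs by (simp add: simps)
  finally have "act X l (x # w) = act X l (sort (x # w)) \<cdot> ((Q' \<cdot> (A \<rhd> Q)) \<lhd> X)" .
  moreover have "Q' \<cdot> (A \<rhd> Q) \<in> hom_set C (A \<odot> ?P) (A \<odot> ?P)"
    using Qs by (simp add: hom_setI)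
  moreover have "is_iso C (Q' \<cdot> (A \<rhd> Q))"
    using is_iso_whisker[OF Q(2), of A "tunit C"] Qs Q'
    by (intro is_iso_cmp[of "A \<rhd> Q" "A \<odot> ?P" "A \<odot> ?P" _ "A \<odot> ?P"]) (simp_all add: hom_setI)
  ultimately show ?case
    unfolding length_Cons tpow.simps by blast
qed

lemma ev_sort:
  assumes X: "rep n X l" and R: "is_iso C R" and w: "set w \<subseteq> {..<n}"
    and e: "e \<in> hom_set C (tunit C) X"
  shows "\<exists>Q \<in> hom_set C (tpow (length w)) (tpow (length w)). is_iso C Q
    \<and> ev X l e w = ev X l e (sort w) \<cdot> Q"
proof -
  let ?P = "tpow (length w)"
  note ops = rep_operators[OF X]
  have sw: "set (sort w) \<subseteq> {..<n}" using w by simp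
  from act_sort[OF X R w] obtain Q where Q: "Q \<in> hom_set C ?P ?P" "is_iso C Q"
    and eq: "act X l w = act X l (sort w) \<cdot> (Q \<lhd> X)" by blast
  note simps = act_hom[OF ops sw] operatorsD[OF ops] hom_setD[OF e] hom_setD[OF Q(1)]
  have "ev X l e w = act X l (sort w) \<cdot> ((Q \<lhd> X) \<cdot> (?P \<rhd> e))"
    unfolding ev_def eq by (simp add: simps)
  also have "\<dots> = act X l (sort w) \<cdot> ((?P \<rhd> e) \<cdot> (Q \<lhd> tunit C))"
    unfolding interchange[OF Q(1) e] interchange'[OF Q(1) e] ..
  also have "\<dots> = ev X l e (sort w) \<cdot> Q"
    by (simp add: ev_def simps)
  finally show ?thesis using Q by blast
qed

text \<open>For a sorted word this will be the map that the corresponding order-preserving map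
  induces on tensor powers; for other words it describes covering maps.\<close>

abbreviation pure :: "nat \<Rightarrow> nat list \<Rightarrow> 'a" where
  "pure n \<equiv> ev (tpow n) (shuffle n) (tone n)"

lemma tone_hom': "tone n \<in> hom_set C (tunit C) (tpow n)"
  by (simp add: hom_setI)

lemma pure_hom:
  assumes "set w \<subseteq> {..<n}"
  shows "pure n w \<in> Ar C" "src C (pure n w) = tpow (length w)" "tgt C (pure n w) = tpow n"
  using ev_hom[OF shuffle_operators assms tone_hom'] by auto

text \<open>The factors of the left copy act one after the other on the right copy. For n = 2 this
  is the familiar product (\<mu> \<otimes> \<mu>)(I \<otimes> R \<otimes> I).\<close>

definition tmul :: "nat \<Rightarrow> 'a" where
  "tmul n = act (tpow n) (shuffle n) [0..<n]"

lemma tmul_hom [simp]: "tmul n \<in> Ar C" "src C (tmul n) = tpow n \<odot> tpow n" "tgt C (tmul n) = tpow n"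
  using act_hom[OF shuffle_operators, of "[0..<n]" n] by (simp_all add: tmul_def subset_eq)

definition power_mon :: "nat \<Rightarrow> ('o, 'a) mon" where
  "power_mon n = \<lparr>mobj = tpow n, mmul = tmul n, mone = tone n\<rparr>"

end

section \<open>Tensor powers of a quasi-commutative monoid as representations\<close>

locale quasicomm_structure = multiplication_data C A \<mu> \<iota> R
  for C :: "('o, 'a, 'x) mcat_scheme" (structure) and A :: 'o and \<mu> \<iota> R :: 'a +
  assumes quasicomm: "is_quasicomm_mon C \<lparr>mobj = A, mmul = \<mu>, mone = \<iota>\<rparr> R"
begin

lemma quasicomm_axioms:
  "\<mu> \<cdot> (\<mu> \<lhd> A) = \<mu> \<cdot> (A \<rhd> \<mu>)"
  "\<mu> \<cdot> (\<iota> \<lhd> A) = idn C A"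
  "\<mu> \<cdot> (A \<rhd> \<iota>) = idn C A"
  "is_iso C R"
  "(R \<lhd> A) \<cdot> (A \<rhd> R) \<cdot> (R \<lhd> A) = (A \<rhd> R) \<cdot> (R \<lhd> A) \<cdot> (A \<rhd> R)"
  "R \<cdot> (\<iota> \<lhd> A) = A \<rhd> \<iota>"
  "R \<cdot> (A \<rhd> \<iota>) = \<iota> \<lhd> A"
  "R \<cdot> (A \<rhd> \<mu>) = (\<mu> \<lhd> A) \<cdot> (A \<rhd> R) \<cdot> (R \<lhd> A)"
  "R \<cdot> (\<mu> \<lhd> A) = (A \<rhd> \<mu>) \<cdot> (R \<lhd> A) \<cdot> (A \<rhd> R)"
  "\<mu> \<cdot> R = \<mu>"
  using quasicomm
  unfolding is_quasicomm_mon_def is_braided_mon_def is_mon_def yang_baxter_def Let_def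
  by (simp_all del: whisker_left_cmp whisker_right_cmp)

lemma whisker_axiom:
  assumes "f = g" "X \<in> Ob C"
  shows "f \<lhd> X = g \<lhd> X"
  using assms by simp

text \<open>Each axiom has its place. Operator 0 is the regular action on the first factor. For
  operator k + 1 the unit law rests on R(\<iota> \<otimes> I) = I \<otimes> \<iota> and the action
  law on the formula for R(\<mu> \<otimes> I). The exchange relation rests on the formula for R(I
  \<otimes> \<mu>) when the smaller index is 0, on the Yang-Baxter equation when it is positive, and
  on \<mu> R = \<mu> when the indices agree.\<close>

lemma rep_extend:
  assumes X: "rep n X l"
  shows "rep (Suc n) (A \<odot> X) (extend X l)"
proof -
  have Xob [simp]: "X \<in> Ob C"
    using X by (simp add: rep_def)
  note ops = rep_operators[OF X]
  note simps = operatorsD[OF ops]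
  let ?e = "extend X l"
  have ty: "?e i \<in> hom_set C (A \<odot> A \<odot> X) (A \<odot> X)" if "i < Suc n" for i
    using extend_operators[OF ops] that by (simp add: operators_def)
  have unit: "?e i \<cdot> (\<iota> \<lhd> (A \<odot> X)) = idn C (A \<odot> X)" if "i < Suc n" for i
  proof (cases i)
    case 0
    then show ?thesis
      using whisker_axiom[OF quasicomm_axioms(2) Xob] by simp
  next
    case (Suc k)
    then have k: "k < n" using that by simp
    have "?e i \<cdot> (\<iota> \<lhd> (A \<odot> X)) = (A \<rhd> l k) \<cdot> (R \<cdot> (\<iota> \<lhd> A)) \<lhd> X"
      using Suc k by (simp add: simps)
    also have "\<dots> = A \<rhd> (l k \<cdot> (\<iota> \<lhd> X))"
      unfolding quasicomm_axioms using k by (simp add: simps)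
    finally show ?thesis
      unfolding repD(6)[OF X k] by simp
  qed
  have assoc: "?e i \<cdot> (\<mu> \<lhd> (A \<odot> X)) = ?e i \<cdot> (A \<rhd> ?e i)" if "i < Suc n" for i
  proof (cases i)
    case 0
    then show ?thesis
      using whisker_axiom[OF quasicomm_axioms(1) Xob] by simp
  next
    case (Suc k)
    then have k: "k < n" using that by simp
    have lk: "l k \<in> hom_set C (A \<odot> X) X"
      by (rule repD(2)[OF X k])
    have "?e i \<cdot> (\<mu> \<lhd> (A \<odot> X)) = (A \<rhd> l k) \<cdot> (R \<cdot> (\<mu> \<lhd> A)) \<lhd> X"
      using Suc k by (simp add: simps)
    also have "\<dots> = A \<rhd> (l k \<cdot> (\<mu> \<lhd> X)) \<cdot> (R \<lhd> (A \<odot> X)) \<cdot> (A \<rhd> R \<lhd> X)"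
      unfolding quasicomm_axioms using k by (simp add: simps)
    also have "\<dots> = (A \<rhd> l k) \<cdot> (((A \<odot> A) \<rhd> l k) \<cdot> (R \<lhd> (A \<odot> X))) \<cdot> (A \<rhd> R \<lhd> X)"
      unfolding repD(7)[OF X k] using k by (simp add: simps)
    also have "\<dots> = (A \<rhd> l k) \<cdot> ((R \<lhd> X) \<cdot> ((A \<odot> A) \<rhd> l k)) \<cdot> (A \<rhd> R \<lhd> X)"
      unfolding interchange[OF R_hom lk] interchange'[OF R_hom lk] ..
    also have "\<dots> = ?e i \<cdot> (A \<rhd> ?e i)"
      using Suc k by (simp add: simps)
    finally show ?thesis .
  qed
  have braid: "?e i \<cdot> (A \<rhd> ?e j) \<cdot> (R \<lhd> (A \<odot> X)) = ?e j \<cdot> (A \<rhd> ?e i)"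
    if "j < Suc n" "i < j" for i j
  proof -
    obtain b where b: "j = Suc b" "b < n"
      using \<open>i < j\<close> \<open>j < Suc n\<close> by (cases j) auto
    have lb: "l b \<in> hom_set C (A \<odot> X) X"
      by (rule repD(2)[OF X b(2)])
    show ?thesis
    proof (cases i)
      case 0
      have "?e i \<cdot> (A \<rhd> ?e j) \<cdot> (R \<lhd> (A \<odot> X))
          = ((\<mu> \<lhd> X) \<cdot> ((A \<odot> A) \<rhd> l b)) \<cdot> (A \<rhd> R \<lhd> X) \<cdot> (R \<lhd> (A \<odot> X))"
        using 0 b by (simp add: simps)
      also have "\<dots> = ((A \<rhd> l b) \<cdot> (\<mu> \<lhd> (A \<odot> X))) \<cdot> (A \<rhd> R \<lhd> X) \<cdot> (R \<lhd> (A \<odot> X))"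
        unfolding interchange[OF \<mu>_hom lb] interchange'[OF \<mu>_hom lb] ..
      also have "\<dots> = (A \<rhd> l b) \<cdot> ((\<mu> \<lhd> A) \<cdot> (A \<rhd> R) \<cdot> (R \<lhd> A)) \<lhd> X"
        using 0 b by (simp add: simps)
      also have "\<dots> = ?e j \<cdot> (A \<rhd> ?e i)"
        unfolding quasicomm_axioms(8)[symmetric] using 0 b by (simp add: simps)
      finally show ?thesis .
    next
      case (Suc a)
      then have a: "i = Suc a" "a < n" "a \<le> b"
        using \<open>i < j\<close> b by auto
      have la: "l a \<in> hom_set C (A \<odot> X) X"
        by (rule repD(2)[OF X a(2)])
      have "?e i \<cdot> (A \<rhd> ?e j) \<cdot> (R \<lhd> (A \<odot> X))
          = (A \<rhd> l a) \<cdot> ((R \<lhd> X) \<cdot> ((A \<odot> A) \<rhd> l b)) \<cdot> (A \<rhd> R \<lhd> X) \<cdot> (R \<lhd> (A \<odot> X))"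
        using a b by (simp add: simps)
      also have "\<dots> = (A \<rhd> l a) \<cdot> (((A \<odot> A) \<rhd> l b) \<cdot> (R \<lhd> (A \<odot> X))) \<cdot> (A \<rhd> R \<lhd> X) \<cdot> (R \<lhd> (A \<odot> X))"
        unfolding interchange[OF R_hom lb] interchange'[OF R_hom lb] ..
      also have "\<dots> = (A \<rhd> (l a \<cdot> (A \<rhd> l b))) \<cdot> ((R \<lhd> A) \<cdot> (A \<rhd> R) \<cdot> (R \<lhd> A)) \<lhd> X"
        using a b by (simp add: simps)
      also have "\<dots> = (A \<rhd> (l a \<cdot> (A \<rhd> l b) \<cdot> (R \<lhd> X))) \<cdot> (R \<lhd> (A \<odot> X)) \<cdot> (A \<rhd> R \<lhd> X)"
        unfolding quasicomm_axioms(5) using a b by (simp add: simps)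
      also have "\<dots> = (A \<rhd> l b) \<cdot> (((A \<odot> A) \<rhd> l a) \<cdot> (R \<lhd> (A \<odot> X))) \<cdot> (A \<rhd> R \<lhd> X)"
        unfolding rep_braid[OF X b(2) a(3)] using a b by (simp add: simps)
      also have "\<dots> = (A \<rhd> l b) \<cdot> ((R \<lhd> X) \<cdot> ((A \<odot> A) \<rhd> l a)) \<cdot> (A \<rhd> R \<lhd> X)"
        unfolding interchange[OF R_hom la] interchange'[OF R_hom la] ..
      also have "\<dots> = ?e j \<cdot> (A \<rhd> ?e i)"
        using a b by (simp add: simps)
      finally show ?thesis .
    qed
  qed
  \<comment> \<open>The action law turns two equal operators into one preceded by \<mu>, so \<mu> R
    = \<mu> settles all indices at once.\<close>
  have diag: "?e i \<cdot> (A \<rhd> ?e i) \<cdot> (R \<lhd> (A \<odot> X)) = ?e i \<cdot> (A \<rhd> ?e i)" if "i < Suc n" for i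
  proof -
    note e = hom_setD(1-3)[OF ty[OF that]]
    have "?e i \<cdot> (A \<rhd> ?e i) \<cdot> (R \<lhd> (A \<odot> X)) = (?e i \<cdot> (A \<rhd> ?e i)) \<cdot> (R \<lhd> (A \<odot> X))"
      using e by simp
    also have "\<dots> = ?e i \<cdot> ((\<mu> \<cdot> R) \<lhd> (A \<odot> X))"
      unfolding assoc[OF that, symmetric] using e by simp
    also have "\<dots> = ?e i \<cdot> (A \<rhd> ?e i)"
      unfolding quasicomm_axioms(10) by (rule assoc[OF that])
    finally show ?thesis .
  qed
  show ?thesis
    unfolding rep_def using ty unit assoc braid diag by (auto simp: le_less)
qed

lemma rep_shuffle: "rep n (tpow n) (shuffle n)"
proof (induction n)
  case 0
  then show ?case by (simp add: rep_def)
next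
  case (Suc n)
  then show ?case using rep_extend by simp
qed

text \<open>A word without the letter 0 leaves a unit in the first factor: R(I \<otimes> \<iota>) =
  \<iota> \<otimes> I says that inserting this unit commutes with the operators.\<close>

lemma pure_Suc:
  assumes w: "set w \<subseteq> {..<n}"
  shows "pure (Suc n) (map Suc w) = (\<iota> \<lhd> tpow n) \<cdot> pure n w"
proof -
  have h: "\<iota> \<lhd> tpow n \<in> hom_set C (tpow n) (tpow (Suc n))"
    by (simp add: hom_setI)
  have "(\<iota> \<lhd> tpow n) \<cdot> shuffle n i = shuffle (Suc n) (Suc i) \<cdot> (A \<rhd> \<iota> \<lhd> tpow n)" if "i < n" for i
  proof -
    have s: "shuffle n i \<in> hom_set C (A \<odot> tpow n) (tpow n)"
      using that by (simp add: hom_setI)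
    have "shuffle (Suc n) (Suc i) \<cdot> (A \<rhd> \<iota> \<lhd> tpow n)
        = (A \<rhd> shuffle n i) \<cdot> ((R \<cdot> (A \<rhd> \<iota>)) \<lhd> tpow n)"
      using that by simp
    also have "\<dots> = (\<iota> \<lhd> tpow n) \<cdot> shuffle n i"
      unfolding quasicomm_axioms(7) using that interchange[OF \<iota>_hom s] interchange'[OF \<iota>_hom s]
      by simp
    finally show ?thesis by simp
  qed
  then show ?thesis
    using w ev_intertwine[OF shuffle_operators shuffle_operators h tone_hom', of w Suc]
    by (simp add: subset_eq)
qed

text \<open>This computation serves three times: as the right unit law of
  \<open>power_mon n\<close>, as the identity law of the functor and as the value of the sorted
  covering map. The axiom \<mu>(I \<otimes> \<iota>) = I enters here.\<close>

lemma pure_upt: "pure n [0..<n] = idn C (tpow n)"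
proof (induction n)
  case 0
  then show ?case by (simp add: ev_def)
next
  case (Suc n)
  have sets: "set (map Suc [0..<n]) \<subseteq> {..<Suc n}" by auto
  have "pure (Suc n) [0..<Suc n] = shuffle (Suc n) 0 \<cdot> (A \<rhd> pure (Suc n) (map Suc [0..<n]))"
    unfolding upt_conv_Cons[OF zero_less_Suc] map_Suc_upt
    using ev_append[OF shuffle_operators _ sets tone_hom', of "[0]"] by (simp add: map_Suc_upt)
  also have "\<dots> = (\<mu> \<cdot> (A \<rhd> \<iota>)) \<lhd> tpow n"
    using pure_Suc[of "[0..<n]" n] Suc.IH by (simp add: subset_eq)
  also have "\<dots> = idn C (tpow (Suc n))"
    unfolding quasicomm_axioms(3) by simp
  finally show ?case .
qed

lemma is_mon_power_mon: "is_mon C (power_mon n)"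
proof -
  have "tmul n \<cdot> (tmul n \<lhd> tpow n) = tmul n \<cdot> (tpow n \<rhd> tmul n)"
    using act_act[OF rep_shuffle, of "[0..<n]" n "[0..<n]"] map_nth[of "[0..<n]"]
    by (simp add: tmul_def subset_eq)
  moreover have "tmul n \<cdot> (tone n \<lhd> tpow n) = idn C (tpow n)"
    using act_tone[OF rep_shuffle, of "[0..<n]" n] by (simp add: tmul_def subset_eq)
  moreover have "tmul n \<cdot> (tpow n \<rhd> tone n) = idn C (tpow n)"
    using pure_upt[of n] by (simp add: tmul_def ev_def)
  ultimately show ?thesis
    by (auto simp: is_mon_def power_mon_def hom_setI)
qed

text \<open>The source of functoriality: the value of a sorted word commutes with the operators and
  preserves the unit, so it carries v to v relabelled through w.\<close>

lemma pure_intertwine: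
  assumes w: "sorted w" "set w \<subseteq> {..<n}" and v: "set v \<subseteq> {..<length w}"
  shows "pure n w \<cdot> pure (length w) v = pure n (map ((!) w) v)"
proof -
  have h: "pure n w \<in> hom_set C (tpow (length w)) (tpow n)"
    using pure_hom[OF w(2)] by (simp add: hom_setI)
  have "pure n w \<cdot> pure (length w) v = ev (tpow n) (shuffle n) (pure n w \<cdot> tone (length w)) (map ((!) w) v)"
    using w v nth_mem[of _ w]
    by (intro ev_intertwine[OF shuffle_operators shuffle_operators h tone_hom']
        ev_shuffle[OF rep_shuffle _ _ _ tone_hom']) blast+
  then show ?thesis
    unfolding ev_tone[OF rep_shuffle w(2) tone_hom'] .
qed

end

section \<open>Monoids with points\<close>

context strict_monoidal_category
begin

lemma is_monD:
  assumes "is_mon C M"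
  shows "mobj M \<in> Ob C" "mmul M \<in> Ar C" "src C (mmul M) = mobj M \<odot> mobj M" "tgt C (mmul M) = mobj M"
    "mone M \<in> Ar C" "src C (mone M) = tunit C" "tgt C (mone M) = mobj M"
    "mmul M \<cdot> (mmul M \<lhd> mobj M) = mmul M \<cdot> (mobj M \<rhd> mmul M)"
    "mmul M \<cdot> (mone M \<lhd> mobj M) = idn C (mobj M)" "mmul M \<cdot> (mobj M \<rhd> mone M) = idn C (mobj M)"
  using assms by (auto simp: is_mon_def Let_def hom_set_def)

lemma is_monD':
  assumes "is_mon C M"
  shows "mmul M \<in> hom_set C (mobj M \<odot> mobj M) (mobj M)" "mone M \<in> hom_set C (tunit C) (mobj M)"
  using assms by (auto simp: is_mon_def Let_def)

lemma is_mon_homD: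
  assumes "is_mon_hom C M N f"
  shows "f \<in> Ar C" "src C f = mobj M" "tgt C f = mobj N" "f \<in> hom_set C (mobj M) (mobj N)"
    "mmul N \<cdot> (f \<otimes> f) = f \<cdot> mmul M" "f \<cdot> mone M = mone N"
  using assms by (auto simp: is_mon_hom_def hom_set_def)

lemma tensor_decompose:
  assumes "f \<in> Ar C" "g \<in> Ar C"
  shows "f \<otimes> g = (f \<lhd> tgt C g) \<cdot> (src C f \<rhd> g)"
  using interchange[of f "src C f" "tgt C f" g "src C g" "tgt C g"] assms by (simp add: hom_set_def)

lemma tensor_decompose':
  assumes "f \<in> Ar C" "g \<in> Ar C"
  shows "f \<otimes> g = (tgt C f \<rhd> g) \<cdot> (f \<lhd> src C g)"
  using interchange'[of f "src C f" "tgt C f" g "src C g" "tgt C g"] assms by (simp add: hom_set_def)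

lemma iter_mult_hom:
  assumes M: "is_mon C M"
  shows "\<lbrakk>\<And>f. f \<in> set fs \<Longrightarrow> f \<in> Ar C \<and> tgt C f = mobj M\<rbrakk>
    \<Longrightarrow> iter_mult C M (length fs) \<in> Ar C \<and> tensor_list C fs \<in> Ar C
      \<and> src C (iter_mult C M (length fs)) = tgt C (tensor_list C fs)
      \<and> tgt C (iter_mult C M (length fs)) = mobj M"
  by (induction fs) (simp_all add: is_monD[OF M])

end

section \<open>Multiplication described by operators\<close>

context multiplication_data
begin

text \<open>Multiplying by the value of a word is acting by the word. The notion is shared by tensor
  powers with their shuffle operators and by any monoid with left multiplications by points.\<close>

definition compatible :: "nat \<Rightarrow> ('o, 'a) mon \<Rightarrow> (nat \<Rightarrow> 'a) \<Rightarrow> bool" where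
  "compatible n M l \<longleftrightarrow> is_mon C M \<and> operators n (mobj M) l
    \<and> (\<forall>w. set w \<subseteq> {..<n} \<longrightarrow> mmul M \<cdot> (ev (mobj M) l (mone M) w \<lhd> mobj M) = act (mobj M) l w)"

lemma compatibleD:
  assumes "compatible n M l"
  shows "is_mon C M" "operators n (mobj M) l"
    "set w \<subseteq> {..<n} \<Longrightarrow> mmul M \<cdot> (ev (mobj M) l (mone M) w \<lhd> mobj M) = act (mobj M) l w"
  using assms by (auto simp: compatible_def)

lemma compatible_ev_append:
  assumes M: "compatible n M l" and uv: "set u \<subseteq> {..<n}" "set v \<subseteq> {..<n}"
  shows "mmul M \<cdot> (ev (mobj M) l (mone M) u \<otimes> ev (mobj M) l (mone M) v)
    = ev (mobj M) l (mone M) (u @ v)"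
proof -
  note mon = compatibleD(1)[OF M] and ops = compatibleD(2)[OF M]
  note e = is_monD'(2)[OF mon]
  note simps = is_monD(1-7)[OF mon] ev_hom[OF ops _ e]
  have "mmul M \<cdot> (ev (mobj M) l (mone M) u \<otimes> ev (mobj M) l (mone M) v)
      = (mmul M \<cdot> (ev (mobj M) l (mone M) u \<lhd> mobj M)) \<cdot> (tpow (length u) \<rhd> ev (mobj M) l (mone M) v)"
    using uv by (subst tensor_decompose) (simp_all add: simps)
  then show ?thesis
    unfolding compatibleD(3)[OF M uv(1)] ev_append[OF ops uv e] .
qed

text \<open>The left side has the form of a covering map, so this identifies covering maps with
  values of concatenated words.\<close>

lemma compatible_ev_concat:
  assumes M: "compatible n M l"
  shows "\<lbrakk>\<And>w. w \<in> set ws \<Longrightarrow> set w \<subseteq> {..<n}\<rbrakk>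
    \<Longrightarrow> iter_mult C M (length ws) \<cdot> tensor_list C (map (ev (mobj M) l (mone M)) ws)
      = ev (mobj M) l (mone M) (concat ws)"
proof (induction ws)
  case Nil
  then show ?case
    using is_monD(1-7)[OF compatibleD(1)[OF M]] by (simp add: ev_def)
next
  case (Cons w ws)
  note mon = compatibleD(1)[OF M] and ops = compatibleD(2)[OF M]
  let ?ev = "ev (mobj M) l (mone M)"
  let ?iter = "iter_mult C M (length ws)" and ?t = "tensor_list C (map ?ev ws)"
  note ev = ev_hom[OF ops _ is_monD'(2)[OF mon]]
  have w: "set w \<subseteq> {..<n}" and ws: "set (concat ws) \<subseteq> {..<n}" using Cons.prems by auto
  have "f \<in> Ar C \<and> tgt C f = mobj M" if "f \<in> set (map ?ev ws)" for f
    using that Cons.prems ev by auto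
  then have ty: "?iter \<in> Ar C" "?t \<in> Ar C" "src C ?iter = tgt C ?t" "tgt C ?iter = mobj M"
    using iter_mult_hom[OF mon, of "map ?ev ws"] by auto
  have "iter_mult C M (length (w # ws)) \<cdot> tensor_list C (map ?ev (w # ws))
      = mmul M \<cdot> ((mobj M \<rhd> ?iter) \<cdot> (?ev w \<otimes> ?t))"
    using w ty by (simp add: ev is_monD(1-7)[OF mon])
  also have "(mobj M \<rhd> ?iter) \<cdot> (?ev w \<otimes> ?t) = ?ev w \<otimes> (?iter \<cdot> ?t)"
    using tar_cmp[of "?ev w" "idn C (mobj M)" ?t ?iter] w ty by (simp add: ev is_monD(1-7)[OF mon])
  also have "?iter \<cdot> ?t = ?ev (concat ws)"
    using Cons by simp
  also have "mmul M \<cdot> (?ev w \<otimes> \<dots>) = ?ev (concat (w # ws))"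
    using compatible_ev_append[OF M w ws] by simp
  finally show ?case .
qed

text \<open>In a compatible monoid the exchange relation can be checked on values, between morphisms
  out of A \<otimes> A; multiplying both sides by X restores the operators.\<close>

lemma compatible_rep:
  assumes M: "compatible n M l"
    and unit: "\<And>i. i < n \<Longrightarrow> l i \<cdot> (\<iota> \<lhd> mobj M) = idn C (mobj M)"
    and assoc: "\<And>i. i < n \<Longrightarrow> l i \<cdot> (\<mu> \<lhd> mobj M) = l i \<cdot> (A \<rhd> l i)"
    and braid: "\<And>i j. \<lbrakk>i \<le> j; j < n\<rbrakk>
      \<Longrightarrow> ev (mobj M) l (mone M) [i, j] \<cdot> R = ev (mobj M) l (mone M) [j, i]"
  shows "rep n (mobj M) l"
proof -
  note mon = compatibleD(1)[OF M] and ops = compatibleD(2)[OF M]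
  let ?X = "mobj M"
  let ?ev = "ev ?X l (mone M)"
  note ev = ev_hom[OF ops _ is_monD'(2)[OF mon]]
  have "l i \<cdot> (A \<rhd> l j) \<cdot> (R \<lhd> ?X) = l j \<cdot> (A \<rhd> l i)" if ij: "i \<le> j" "j < n" for i j
  proof -
    have w: "set [i, j] \<subseteq> {..<n}" "set [j, i] \<subseteq> {..<n}" using ij by auto
    have "l i \<cdot> (A \<rhd> l j) \<cdot> (R \<lhd> ?X) = act ?X l [i, j] \<cdot> (R \<lhd> ?X)"
      using ij operatorsD[OF ops] by simp
    also have "\<dots> = mmul M \<cdot> ((?ev [i, j] \<cdot> R) \<lhd> ?X)"
      unfolding compatibleD(3)[OF M w(1), symmetric]
      using ev[OF w(1)] is_monD(1-7)[OF mon] by simp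
    also have "\<dots> = act ?X l [j, i]"
      unfolding braid[OF ij] by (rule compatibleD(3)[OF M w(2)])
    finally show ?thesis
      using ij operatorsD[OF ops] by simp
  qed
  then show ?thesis
    using unit assoc ops by (auto simp: rep_def operators_def)
qed

definition left_mult :: "('o, 'a) mon \<Rightarrow> (nat \<Rightarrow> 'a) \<Rightarrow> nat \<Rightarrow> 'a" where
  "left_mult M p i = mmul M \<cdot> (p i \<lhd> mobj M)"

definition base :: "('o, 'a) mon" where
  "base = \<lparr>mobj = A, mmul = \<mu>, mone = \<iota>\<rparr>"

lemma base_simps [simp]: "mobj base = A" "mmul base = \<mu>" "mone base = \<iota>"
  by (simp_all add: base_def)

lemma left_mult_operators:
  assumes M: "is_mon C M" and p: "\<And>i. i < n \<Longrightarrow> is_mon_hom C base M (p i)"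
  shows "operators n (mobj M) (left_mult M p)"
  unfolding operators_def left_mult_def
  using is_monD(1-7)[OF M] is_mon_homD(1-3)[OF p] by (auto intro!: hom_setI)

text \<open>By associativity a word acting on a product acts on its left factor; the claim is the
  case where that factor is the unit.\<close>

lemma left_mult_compatible:
  assumes M: "is_mon C M" and p: "\<And>i. i < n \<Longrightarrow> is_mon_hom C base M (p i)"
  shows "compatible n M (left_mult M p)"
proof -
  let ?X = "mobj M" and ?l = "left_mult M p"
  note ops = left_mult_operators[OF M p]
  note X = is_monD(1-7)[OF M]
  note simps = X is_mon_homD(1-3)[OF p, simplified] operatorsD[OF ops]
  have ops': "operators n (?X \<odot> ?X) (\<lambda>i. ?l i \<lhd> ?X)"
    using operatorsD[OF ops] by (auto simp: operators_def intro!: hom_setI)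
  have comm: "mmul M \<cdot> (?l i \<lhd> ?X) = ?l i \<cdot> (A \<rhd> mmul M)" if i: "i < n" for i
  proof -
    have "mmul M \<cdot> (?l i \<lhd> ?X) = (mmul M \<cdot> (mmul M \<lhd> ?X)) \<cdot> (p i \<lhd> (?X \<odot> ?X))"
      using i by (simp add: left_mult_def simps)
    also have "\<dots> = mmul M \<cdot> ((?X \<rhd> mmul M) \<cdot> (p i \<lhd> (?X \<odot> ?X)))"
      unfolding is_monD(8)[OF M] using i by (simp add: simps)
    also have "(?X \<rhd> mmul M) \<cdot> (p i \<lhd> (?X \<odot> ?X)) = (p i \<lhd> ?X) \<cdot> (A \<rhd> mmul M)"
      using tensor_decompose[of "p i" "mmul M"] tensor_decompose'[of "p i" "mmul M"] i
      by (simp add: simps)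
    finally show ?thesis
      using i by (simp add: left_mult_def simps)
  qed
  have "mmul M \<cdot> (ev ?X ?l (mone M) w \<lhd> ?X) = act ?X ?l w" if w: "set w \<subseteq> {..<n}" for w
  proof -
    note a = act_hom[OF ops w]
    have "mmul M \<cdot> act (?X \<odot> ?X) (\<lambda>i. ?l i \<lhd> ?X) w
        = act ?X ?l (map (\<lambda>i. i) w) \<cdot> (tpow (length w) \<rhd> mmul M)"
      using w comm by (intro act_intertwine[OF ops' ops is_monD'(1)[OF M]]) auto
    then have *: "mmul M \<cdot> (act ?X ?l w \<lhd> ?X) = act ?X ?l w \<cdot> (tpow (length w) \<rhd> mmul M)"
      using act_whisker[OF ops w X(1)] by simp
    have "mmul M \<cdot> (ev ?X ?l (mone M) w \<lhd> ?X)
        = (mmul M \<cdot> (act ?X ?l w \<lhd> ?X)) \<cdot> (tpow (length w) \<rhd> mone M \<lhd> ?X)"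
      using a by (simp add: ev_def X)
    also have "\<dots> = act ?X ?l w \<cdot> (tpow (length w) \<rhd> (mmul M \<cdot> (mone M \<lhd> ?X)))"
      unfolding * using a by (simp add: X)
    also have "\<dots> = act ?X ?l w"
      unfolding is_monD(9)[OF M] using a by (simp add: X)
    finally show ?thesis .
  qed
  then show ?thesis
    using M ops by (simp add: compatible_def)
qed

lemma left_mult_rep:
  assumes M: "is_mon C M" and p: "\<And>i. i < n \<Longrightarrow> is_mon_hom C base M (p i)"
    and braid: "\<And>i j. \<lbrakk>i \<le> j; j < n\<rbrakk> \<Longrightarrow> ev (mobj M) (left_mult M p) (mone M) [i, j] \<cdot> R
      = ev (mobj M) (left_mult M p) (mone M) [j, i]"
  shows "rep n (mobj M) (left_mult M p)"
proof (rule compatible_rep[OF left_mult_compatible[OF M p] _ _ braid])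
  let ?X = "mobj M" and ?l = "left_mult M p"
  note X = is_monD(1-7)[OF M]
  fix i assume i: "i < n"
  note pi = is_mon_homD[OF p[OF i], simplified]
  have "?l i \<cdot> (\<iota> \<lhd> ?X) = mmul M \<cdot> ((p i \<cdot> \<iota>) \<lhd> ?X)"
    using pi(1-3) by (simp add: left_mult_def X)
  then show "?l i \<cdot> (\<iota> \<lhd> ?X) = idn C ?X"
    unfolding pi(6) is_monD(9)[OF M] .
  have "?l i \<cdot> (\<mu> \<lhd> ?X) = mmul M \<cdot> ((p i \<cdot> \<mu>) \<lhd> ?X)"
    using pi(1-3) by (simp add: left_mult_def X)
  also have "\<dots> = (mmul M \<cdot> (mmul M \<lhd> ?X)) \<cdot> (p i \<otimes> (p i \<lhd> ?X))"
    unfolding pi(5)[symmetric] using pi(1-3) X tar_cmp[of "p i \<otimes> p i" "mmul M" "idn C ?X" "idn C ?X"]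
    by simp
  also have "\<dots> = mmul M \<cdot> ((?X \<rhd> mmul M) \<cdot> (p i \<otimes> (p i \<lhd> ?X)))"
    unfolding is_monD(8)[OF M] using pi(1-3) X by simp
  also have "(?X \<rhd> mmul M) \<cdot> (p i \<otimes> (p i \<lhd> ?X)) = p i \<otimes> ?l i"
    using pi(1-3) X tar_cmp[of "p i" "idn C ?X" "p i \<lhd> ?X" "mmul M"] by (simp add: left_mult_def)
  also have "mmul M \<cdot> (p i \<otimes> ?l i) = ?l i \<cdot> (A \<rhd> ?l i)"
    using pi(1-3) X by (subst tensor_decompose) (simp_all add: left_mult_def)
  finally show "?l i \<cdot> (\<mu> \<lhd> ?X) = ?l i \<cdot> (A \<rhd> ?l i)" .
qed auto

lemma ev_left_mult_single:
  assumes M: "is_mon C M" and p: "is_mon_hom C base M (p i)"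
  shows "ev (mobj M) (left_mult M p) (mone M) [i] = p i"
proof -
  note X = is_monD(1-7)[OF M] and pi = is_mon_homD(1-3)[OF p, simplified]
  have "ev (mobj M) (left_mult M p) (mone M) [i] = mmul M \<cdot> ((p i \<lhd> mobj M) \<cdot> (A \<rhd> mone M))"
    using X pi by (simp add: ev_def left_mult_def)
  also have "(p i \<lhd> mobj M) \<cdot> (A \<rhd> mone M) = (mobj M \<rhd> mone M) \<cdot> p i"
    using tensor_decompose[of "p i" "mone M"] tensor_decompose'[of "p i" "mone M"] X pi by simp
  also have "mmul M \<cdot> \<dots> = (mmul M \<cdot> (mobj M \<rhd> mone M)) \<cdot> p i"
    using X pi by simp
  also have "\<dots> = p i"
    unfolding is_monD(10)[OF M] using X pi by simp
  finally show ?thesis .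
qed

lemma ev_left_mult_hom:
  assumes M: "is_mon C M" and p: "\<And>i. i < m \<Longrightarrow> is_mon_hom C base M (p i)"
    and N: "is_mon C N" and q: "\<And>i. i < n \<Longrightarrow> is_mon_hom C base N (q i)"
    and h: "is_mon_hom C M N h"
    and w: "set w \<subseteq> {..<m}" "\<phi> ` set w \<subseteq> {..<n}"
    and hp: "\<And>i. i \<in> set w \<Longrightarrow> h \<cdot> p i = q (\<phi> i)"
  shows "h \<cdot> ev (mobj M) (left_mult M p) (mone M) w
    = ev (mobj N) (left_mult N q) (mone N) (map \<phi> w)"
proof -
  note X = is_monD(1-7)[OF M] and Y = is_monD(1-7)[OF N] and hs = is_mon_homD[OF h]
  have comm: "h \<cdot> left_mult M p i = left_mult N q (\<phi> i) \<cdot> (A \<rhd> h)" if i: "i \<in> set w" for i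
  proof -
    note pi = is_mon_homD(1-3)[OF p, of i, simplified] is_mon_homD(1-3)[OF q, of "\<phi> i", simplified]
    have in_range: "i < m" "\<phi> i < n" using i w by auto
    have "h \<cdot> left_mult M p i = (h \<cdot> mmul M) \<cdot> (p i \<lhd> mobj M)"
      using in_range pi hs(1-3) X by (simp add: left_mult_def)
    also have "\<dots> = mmul N \<cdot> ((h \<otimes> h) \<cdot> (p i \<lhd> mobj M))"
      unfolding hs(5)[symmetric] using in_range pi hs(1-3) X Y by simp
    also have "(h \<otimes> h) \<cdot> (p i \<lhd> mobj M) = q (\<phi> i) \<otimes> h"
      using tar_cmp[of "p i" h "idn C (mobj M)" h] in_range pi hs(1-3) X hp[OF i] by simp
    also have "mmul N \<cdot> \<dots> = left_mult N q (\<phi> i) \<cdot> (A \<rhd> h)"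
      using in_range pi hs(1-3) X Y by (subst tensor_decompose) (simp_all add: left_mult_def)
    finally show ?thesis .
  qed
  have "h \<cdot> ev (mobj M) (left_mult M p) (mone M) w
      = ev (mobj N) (left_mult N q) (h \<cdot> mone M) (map \<phi> w)"
    using comm
    by (intro ev_intertwine[OF left_mult_operators left_mult_operators hs(4) is_monD'(2)[OF M] w] M N p q)
  then show ?thesis
    unfolding hs(6) .
qed

text \<open>Evaluated at e, the hypothesis becomes an equation of composites with the invertible
  \<open>ev X l e w\<close>. Relations between morphisms of tensor powers can thus be verified on a
  representation in which one word has an invertible value.\<close>

lemma ev_cancel:
  assumes X: "operators n X l" and w: "set w \<subseteq> {..<n}" and e: "e \<in> hom_set C (tunit C) X"
    and iso: "is_iso C (ev X l e w)"
    and T: "T \<in> hom_set C Y (tpow (length w))" "T' \<in> hom_set C Y (tpow (length w))"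
    and eq: "act X l w \<cdot> (T \<lhd> X) = act X l w \<cdot> (T' \<lhd> X)"
  shows "T = T'"
proof (rule is_iso_cancel[OF iso])
  note simps = act_hom[OF X w] operatorsD(1)[OF X] hom_setD[OF e]
  have *: "ev X l e w \<cdot> T = act X l w \<cdot> (T \<lhd> X) \<cdot> (Y \<rhd> e)"
    if T: "T \<in> hom_set C Y (tpow (length w))" for T
    using interchange[OF T e] interchange'[OF T e] hom_setD[OF T] by (simp add: ev_def simps)
  have **: "ev X l e w \<cdot> T = (act X l w \<cdot> (T \<lhd> X)) \<cdot> (Y \<rhd> e)"
    if T: "T \<in> hom_set C Y (tpow (length w))" for T
    unfolding *[OF T] using hom_setD[OF T] by (simp add: simps)
  show "ev X l e w \<cdot> T = ev X l e w \<cdot> T'"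
    unfolding **[OF T(1)] **[OF T(2)] eq ..
qed (use hom_setD[OF T(1)] hom_setD[OF T(2)] ev_hom[OF X w e] in auto)

text \<open>Compatibility turns the product of two values c of w into the action of w on the second;
  since c intertwines letter k with \<open>w ! k\<close>, this action on c is c after
  \<open>tmul\<close>. Instances are the maps between tensor powers and the comparison of a tensor
  power with \<open>fob F n\<close>.\<close>

lemma rep_mon_hom:
  assumes M: "compatible n M l" and rep: "rep n (mobj M) l" and w: "sorted w" "set w \<subseteq> {..<n}"
  shows "is_mon_hom C (power_mon (length w)) M (ev (mobj M) l (mone M) w)"
proof -
  note mon = compatibleD(1)[OF M] and ops = compatibleD(2)[OF M]
  let ?X = "mobj M" and ?n = "length w"
  let ?c = "ev ?X l (mone M) w"
  note e = is_monD'(2)[OF mon]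
  note c = ev_hom[OF ops w(2) e]
  note h = ev_hom'[OF ops w(2) e]
  have wk: "w ! k < n" if "k < length w" for k
    using w(2) nth_mem[OF that] by blast
  have "mmul M \<cdot> (?c \<otimes> ?c) = (mmul M \<cdot> (?c \<lhd> ?X)) \<cdot> (tpow ?n \<rhd> ?c)"
    using c is_monD(1-7)[OF mon] by (subst tensor_decompose) simp_all
  also have "\<dots> = act ?X l (map ((!) w) [0..<?n]) \<cdot> (tpow (length [0..<?n]) \<rhd> ?c)"
    unfolding compatibleD(3)[OF M w(2)] map_nth by simp
  also have "\<dots> = ?c \<cdot> tmul ?n"
    unfolding tmul_def using wk ev_shuffle[OF rep w _ e]
    by (intro act_intertwine[OF shuffle_operators ops h, symmetric]) auto
  finally show ?thesis
    using ev_tone[OF rep w(2) e] h by (simp add: is_mon_hom_def power_mon_def)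
qed

end

context quasicomm_structure
begin

lemma shuffle_compatible: "compatible n (power_mon n) (shuffle n)"
proof -
  have "tmul n \<cdot> (pure n w \<lhd> tpow n) = act (tpow n) (shuffle n) w" if w: "set w \<subseteq> {..<n}" for w
  proof -
    have idx: "map ((!) [0..<n]) w = w"
      using w by (intro map_idI) auto
    note a = act_hom[OF shuffle_operators w]
    have "tmul n \<cdot> (pure n w \<lhd> tpow n)
        = (tmul n \<cdot> (act (tpow n) (shuffle n) w \<lhd> tpow n)) \<cdot> (tpow (length w) \<rhd> tone n \<lhd> tpow n)"
      using a by (simp add: ev_def)
    also have "tmul n \<cdot> (act (tpow n) (shuffle n) w \<lhd> tpow n)
        = act (tpow n) (shuffle n) w \<cdot> (tpow (length w) \<rhd> tmul n)"
      using act_act[OF rep_shuffle, of "[0..<n]" n w] w idx by (simp add: tmul_def subset_eq)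
    also have "\<dots> \<cdot> (tpow (length w) \<rhd> tone n \<lhd> tpow n)
        = act (tpow n) (shuffle n) w \<cdot> (tpow (length w) \<rhd> (tmul n \<cdot> (tone n \<lhd> tpow n)))"
      using a by simp
    also have "\<dots> = act (tpow n) (shuffle n) w"
      using act_tone[OF rep_shuffle, of "[0..<n]" n] a by (simp add: tmul_def subset_eq)
    finally show ?thesis .
  qed
  then show ?thesis
    using is_mon_power_mon[of n] shuffle_operators by (simp add: compatible_def power_mon_def)
qed

lemma pure_mon_hom:
  assumes "sorted w" "set w \<subseteq> {..<n}"
  shows "is_mon_hom C (power_mon (length w)) (power_mon n) (pure n w)"
  using rep_mon_hom[OF shuffle_compatible _ assms] rep_shuffle by (simp add: power_mon_def)

end

section \<open>The category of monoids\<close>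

text \<open>E will be the functor of tensor powers: F is compared with G by going back to E along
  \<alpha> and forward along \<beta>.\<close>

lemma natural_iso_span:
  assumes "category C" and E: "is_functor D C E" and \<alpha>: "natural_iso D C E F \<alpha>" and \<beta>: "natural_iso D C E G \<beta>"
    and D: "\<And>f. f \<in> Ar D \<Longrightarrow> src D f \<in> Ob D \<and> tgt D f \<in> Ob D"
    and F: "is_functor D C F" and G: "is_functor D C G"
  shows "natural_iso D C F G (\<lambda>X. \<beta> X \<cdot>\<^bsub>C\<^esub> inv_arrow C (\<alpha> X))"
proof -
  interpret category C by fact
  have ty: "\<alpha> X \<in> hom_set C (fob E X) (fob F X)" "\<beta> X \<in> hom_set C (fob E X) (fob G X)"
    "is_iso C (\<alpha> X)" "is_iso C (\<beta> X)" if "X \<in> Ob D" for X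
    using \<alpha> \<beta> that by (auto simp: natural_iso_def)
  have inv: "inv_arrow C (\<alpha> X) \<in> hom_set C (fob F X) (fob E X)" if X: "X \<in> Ob D" for X
    using inv_arrow_props[OF ty(3,1)[OF X]] by (simp add: hom_setI)
  have comp: "\<beta> X \<cdot>\<^bsub>C\<^esub> inv_arrow C (\<alpha> X) \<in> hom_set C (fob F X) (fob G X)"
    "is_iso C (\<beta> X \<cdot>\<^bsub>C\<^esub> inv_arrow C (\<alpha> X))" if X: "X \<in> Ob D" for X
    using hom_setD[OF ty(2)[OF X]] hom_setD[OF inv[OF X]]
      is_iso_cmp[OF is_iso_inv_arrow[OF ty(3)[OF X]] inv[OF X] ty(4,2)[OF X]]
    by (simp_all add: hom_setI)
  have nat: "(\<beta> (tgt D f) \<cdot>\<^bsub>C\<^esub> inv_arrow C (\<alpha> (tgt D f))) \<cdot>\<^bsub>C\<^esub> far F f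
      = far G f \<cdot>\<^bsub>C\<^esub> (\<beta> (src D f) \<cdot>\<^bsub>C\<^esub> inv_arrow C (\<alpha> (src D f)))" if f: "f \<in> Ar D" for f
  proof -
    let ?s = "src D f" and ?t = "tgt D f"
    have s: "?s \<in> Ob D" and t: "?t \<in> Ob D" using D f by auto
    have far: "far E f \<in> hom_set C (fob E ?s) (fob E ?t)" "far F f \<in> hom_set C (fob F ?s) (fob F ?t)"
      "far G f \<in> hom_set C (fob G ?s) (fob G ?t)"
      using E F G f by (auto simp: is_functor_def)
    have eqs: "\<alpha> ?t \<cdot>\<^bsub>C\<^esub> far E f = far F f \<cdot>\<^bsub>C\<^esub> \<alpha> ?s" "\<beta> ?t \<cdot>\<^bsub>C\<^esub> far E f = far G f \<cdot>\<^bsub>C\<^esub> \<beta> ?s"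
      using \<alpha> \<beta> f by (auto simp: natural_iso_def)
    note tys = hom_setD[OF ty(1)[OF s]] hom_setD[OF ty(2)[OF s]] hom_setD[OF ty(1)[OF t]]
      hom_setD[OF ty(2)[OF t]] hom_setD[OF inv[OF s]] hom_setD[OF inv[OF t]]
      hom_setD[OF far(1)] hom_setD[OF far(2)] hom_setD[OF far(3)]
    note inv_s = inv_arrow_props(4,5)[OF ty(3,1)[OF s]] and inv_t = inv_arrow_props(4,5)[OF ty(3,1)[OF t]]
    have "(\<beta> ?t \<cdot>\<^bsub>C\<^esub> inv_arrow C (\<alpha> ?t)) \<cdot>\<^bsub>C\<^esub> far F f
        = \<beta> ?t \<cdot>\<^bsub>C\<^esub> inv_arrow C (\<alpha> ?t) \<cdot>\<^bsub>C\<^esub> far F f \<cdot>\<^bsub>C\<^esub> (\<alpha> ?s \<cdot>\<^bsub>C\<^esub> inv_arrow C (\<alpha> ?s))"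
      unfolding inv_s using tys by simp
    also have "\<dots> = \<beta> ?t \<cdot>\<^bsub>C\<^esub> inv_arrow C (\<alpha> ?t) \<cdot>\<^bsub>C\<^esub> (far F f \<cdot>\<^bsub>C\<^esub> \<alpha> ?s) \<cdot>\<^bsub>C\<^esub> inv_arrow C (\<alpha> ?s)"
      using tys by simp
    also have "\<dots> = \<beta> ?t \<cdot>\<^bsub>C\<^esub> (inv_arrow C (\<alpha> ?t) \<cdot>\<^bsub>C\<^esub> \<alpha> ?t) \<cdot>\<^bsub>C\<^esub> far E f \<cdot>\<^bsub>C\<^esub> inv_arrow C (\<alpha> ?s)"
      unfolding eqs(1)[symmetric] using tys by simp
    also have "\<dots> = (\<beta> ?t \<cdot>\<^bsub>C\<^esub> far E f) \<cdot>\<^bsub>C\<^esub> inv_arrow C (\<alpha> ?s)"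
      unfolding inv_t using tys by simp
    also have "\<dots> = far G f \<cdot>\<^bsub>C\<^esub> (\<beta> ?s \<cdot>\<^bsub>C\<^esub> inv_arrow C (\<alpha> ?s))"
      unfolding eqs(2) using tys by simp
    finally show ?thesis .
  qed
  show ?thesis
    unfolding natural_iso_def using comp nat by blast
qed

context strict_monoidal_category
begin

lemma mon_hom_idn: "is_mon C M \<Longrightarrow> is_mon_hom C M M (idn C (mobj M))"
  using is_monD(1-7)[of M] by (simp add: is_mon_hom_def hom_setI)

lemma mon_hom_cmp:
  assumes L: "is_mon C L" and M: "is_mon C M" and N: "is_mon C N"
    and f: "is_mon_hom C L M f" and g: "is_mon_hom C M N g"
  shows "is_mon_hom C L N (g \<cdot> f)"
proof -
  note simps = is_monD(1-7)[OF L] is_monD(1-7)[OF M] is_monD(1-7)[OF N]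
    is_mon_homD(1-3)[OF f] is_mon_homD(1-3)[OF g]
  have "mmul N \<cdot> ((g \<cdot> f) \<otimes> (g \<cdot> f)) = (mmul N \<cdot> (g \<otimes> g)) \<cdot> (f \<otimes> f)"
    using simps tar_cmp[of f g f g] by simp
  also have "\<dots> = g \<cdot> (mmul M \<cdot> (f \<otimes> f))"
    unfolding is_mon_homD(5)[OF g] using simps by simp
  also have "\<dots> = (g \<cdot> f) \<cdot> mmul L"
    unfolding is_mon_homD(5)[OF f] using simps by simp
  finally have "mmul N \<cdot> ((g \<cdot> f) \<otimes> (g \<cdot> f)) = (g \<cdot> f) \<cdot> mmul L" .
  moreover have "(g \<cdot> f) \<cdot> mone L = mone N"
    using simps is_mon_homD(6)[OF f] is_mon_homD(6)[OF g] by simp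
  ultimately show ?thesis
    unfolding is_mon_hom_def using simps by (simp add: hom_setI)
qed

lemma mon_hom_inverse:
  assumes M: "is_mon C M" and N: "is_mon C N" and f: "is_mon_hom C M N f" and iso: "is_iso C f"
  shows "is_mon_hom C N M (inv_arrow C f)"
proof -
  let ?g = "inv_arrow C f"
  note g = inv_arrow_props[OF iso is_mon_homD(4)[OF f]]
  note simps = is_monD(1-7)[OF M] is_monD(1-7)[OF N] is_mon_homD(1-3)[OF f] g(1-3)
  have "mmul M \<cdot> (?g \<otimes> ?g) = (?g \<cdot> f) \<cdot> mmul M \<cdot> (?g \<otimes> ?g)"
    unfolding g(4) using simps by simp
  also have "\<dots> = ?g \<cdot> (f \<cdot> mmul M) \<cdot> (?g \<otimes> ?g)"
    using simps by simp
  also have "\<dots> = ?g \<cdot> mmul N \<cdot> ((f \<cdot> ?g) \<otimes> (f \<cdot> ?g))"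
    unfolding is_mon_homD(5)[OF f, symmetric] using simps tar_cmp[of ?g f ?g f] by simp
  also have "\<dots> = ?g \<cdot> mmul N"
    unfolding g(5) using simps by simp
  finally have mul: "mmul M \<cdot> (?g \<otimes> ?g) = ?g \<cdot> mmul N" .
  have "?g \<cdot> mone N = (?g \<cdot> f) \<cdot> mone M"
    unfolding is_mon_homD(6)[OF f, symmetric] using simps by simp
  also have "\<dots> = mone M"
    unfolding g(4) using simps by simp
  finally show ?thesis
    unfolding is_mon_hom_def using simps mul by (simp add: hom_setI)
qed

lemma Mon_simps:
  "Ob (Mon C) = {M. is_mon C M}"
  "(M, f, N) \<in> Ar (Mon C) \<longleftrightarrow> is_mon C M \<and> is_mon C N \<and> is_mon_hom C M N f"
  "src (Mon C) (M, f, N) = M" "tgt (Mon C) (M, f, N) = N" "idn (Mon C) M = (M, idn C (mobj M), M)"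
  "(N', g, P) \<cdot>\<^bsub>Mon C\<^esub> (M, f, N) = (M, g \<cdot> f, P)"
  by (simp_all add: Mon_def)

lemma und_Mon_cmp: "und (b \<cdot>\<^bsub>Mon C\<^esub> a) = und b \<cdot> und a"
  by (cases a; cases b) (simp add: Mon_simps und_def)

lemma category_Mon: "category (Mon C)"
  by (unfold_locales)
    (auto simp: Mon_simps mon_hom_idn is_mon_homD(1-3) dest: mon_hom_cmp split: prod.splits)

lemma hom_set_Mon:
  "a \<in> hom_set (Mon C) M N \<longleftrightarrow>
    is_mon C M \<and> is_mon C N \<and> is_mon_hom C M N (und a) \<and> a = (M, und a, N)"
  by (cases a) (auto simp: hom_set_def Mon_simps und_def)

text \<open>The covering condition speaks of isomorphisms in C, \<open>natural_iso\<close> of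
  isomorphisms of monoids. The two meet because the inverse in C of a homomorphism is again a
  homomorphism.\<close>

lemma is_iso_Mon:
  assumes M: "is_mon C M" and N: "is_mon C N" and f: "is_mon_hom C M N f" and iso: "is_iso C f"
  shows "is_iso (Mon C) (M, f, N)"
proof -
  interpret Mon: category "Mon C" by (rule category_Mon)
  show ?thesis
    using inv_arrow_props[OF iso is_mon_homD(4)[OF f]] mon_hom_inverse[OF assms] M N f
    by (intro Mon.is_isoI[of _ M N "(N, inv_arrow C f, M)"]) (auto simp: hom_set_Mon Mon_simps und_def)
qed

end

section \<open>Order-preserving maps as sorted words\<close>

text \<open>An order-preserving map \<open>[m] \<rightarrow> [n]\<close> is encoded by the word of its values, shifted to start from 0.\<close>

definition word :: "nat \<times> (nat \<Rightarrow> nat) \<times> nat \<Rightarrow> nat list" where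
  "word = (\<lambda>(m, u, n). map (\<lambda>i. u (Suc i) - 1) [0..<m])"

definition arrow_of :: "nat \<Rightarrow> nat list \<Rightarrow> nat \<times> (nat \<Rightarrow> nat) \<times> nat" where
  "arrow_of n w = (length w, restrict (\<lambda>i. Suc (w ! (i - 1))) {1..length w}, n)"

lemma simplex_simps:
  "Ob simplex_cat = {1..}"
  "(m, u, n) \<in> Ar simplex_cat \<longleftrightarrow> 1 \<le> m \<and> 1 \<le> n \<and> u \<in> {1..m} \<rightarrow>\<^sub>E {1..n} \<and> mono_on {1..m} u"
  "src simplex_cat (m, u, n) = m" "tgt simplex_cat (m, u, n) = n"
  "idn simplex_cat n = (n, restrict (\<lambda>i. i) {1..n}, n)"
  "(n', v, p) \<cdot>\<^bsub>simplex_cat\<^esub> (m, u, n) = (m, compose {1..m} v u, p)"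
  by (simp_all add: simplex_cat_def)

lemma length_word [simp]: "length (word f) = src simplex_cat f"
  by (cases f) (simp add: word_def simplex_simps)

lemma word_arrow:
  assumes "f \<in> Ar simplex_cat"
  shows "sorted (word f)" "set (word f) \<subseteq> {..<tgt simplex_cat f}"
    "1 \<le> src simplex_cat f" "1 \<le> tgt simplex_cat f"
proof -
  obtain m u n where f: "f = (m, u, n)" by (cases f)
  have u: "u \<in> {1..m} \<rightarrow>\<^sub>E {1..n}" "mono_on {1..m} u" "1 \<le> m" "1 \<le> n"
    using assms by (auto simp: f simplex_simps)
  show "1 \<le> src simplex_cat f" "1 \<le> tgt simplex_cat f"
    using u by (auto simp: f simplex_simps)
  show "sorted (word f)"
    unfolding sorted_iff_nth_mono_less
  proof (intro allI impI)
    fix i j assume ij: "i < j" "j < length (word f)"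
    then have "u (Suc i) \<le> u (Suc j)"
      by (intro mono_onD[OF u(2)]) (auto simp: f simplex_simps)
    then show "word f ! i \<le> word f ! j"
      using ij by (simp add: f word_def simplex_simps)
  qed
  have "u (Suc i) - 1 < n" if "i < m" for i
    using PiE_mem[OF u(1), of "Suc i"] that by auto
  then show "set (word f) \<subseteq> {..<tgt simplex_cat f}"
    by (auto simp: f word_def simplex_simps)
qed

lemma arrow_of_arrow:
  assumes "sorted w" "set w \<subseteq> {..<n}" "w \<noteq> []"
  shows "arrow_of n w \<in> Ar simplex_cat"
proof -
  have "w ! (i - 1) < n" if "i \<in> {1..length w}" for i
    using assms(2) nth_mem[of "i - 1" w] that by fastforce
  moreover have "1 \<le> n"
    using assms(2,3) by (cases w) auto
  moreover have "w ! (i - 1) \<le> w ! (j - 1)" if "i \<in> {1..length w}" "j \<in> {1..length w}" "i \<le> j" for i j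
    using that by (intro sorted_nth_mono[OF assms(1)]) auto
  ultimately show ?thesis
    using assms(3) by (auto 0 3 simp: arrow_of_def simplex_simps Suc_le_eq mono_on_def intro: le_imp_less_Suc)
qed

lemma src_tgt_arrow_of [simp]:
  "src simplex_cat (arrow_of n w) = length w" "tgt simplex_cat (arrow_of n w) = n"
  by (simp_all add: arrow_of_def simplex_simps)

lemma word_arrow_of [simp]: "word (arrow_of n w) = w"
  by (auto simp: word_def arrow_of_def intro!: nth_equalityI)

lemma arrow_of_word:
  assumes "f \<in> Ar simplex_cat"
  shows "arrow_of (tgt simplex_cat f) (word f) = f"
proof -
  obtain m u n where f: "f = (m, u, n)" by (cases f)
  have u: "u \<in> {1..m} \<rightarrow>\<^sub>E {1..n}"
    using assms by (auto simp: f simplex_simps)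
  have "restrict (\<lambda>i. Suc (word f ! (i - 1))) {1..m} = u"
  proof (rule extensionalityI[of _ "{1..m}"])
    show "u \<in> extensional {1..m}"
      using u by (simp add: PiE_def)
    fix i assume i: "i \<in> {1..m}"
    then have "1 \<le> u i" using PiE_mem[OF u i] by simp
    then show "restrict (\<lambda>i. Suc (word f ! (i - 1))) {1..m} i = u i"
      using i by (auto simp: f word_def)
  qed simp
  moreover have "length (word f) = m"
    by (simp add: f simplex_simps)
  ultimately show ?thesis
    unfolding arrow_of_def by (simp add: f simplex_simps)
qed

text \<open>The length of the word gives the source, and extensionality leaves no freedom outside
  \<open>{1..m}\<close>.\<close>

lemma arrow_eqI:
  assumes "f \<in> Ar simplex_cat" "g \<in> Ar simplex_cat"
    "tgt simplex_cat f = tgt simplex_cat g" "word f = word g"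
  shows "f = g"
  using assms arrow_of_word by metis

lemma simplex_cmp_arrow:
  assumes "f \<in> Ar simplex_cat" "g \<in> Ar simplex_cat" "tgt simplex_cat f = src simplex_cat g"
  shows "g \<cdot>\<^bsub>simplex_cat\<^esub> f \<in> Ar simplex_cat"
    "src simplex_cat (g \<cdot>\<^bsub>simplex_cat\<^esub> f) = src simplex_cat f"
    "tgt simplex_cat (g \<cdot>\<^bsub>simplex_cat\<^esub> f) = tgt simplex_cat g"
    "word (g \<cdot>\<^bsub>simplex_cat\<^esub> f) = map ((!) (word g)) (word f)"
proof -
  obtain m u n where f: "f = (m, u, n)" by (cases f)
  obtain v p where g: "g = (n, v, p)" using assms(3) by (cases g) (auto simp: f simplex_simps)
  have u: "u \<in> {1..m} \<rightarrow>\<^sub>E {1..n}" "mono_on {1..m} u" and v: "v \<in> {1..n} \<rightarrow>\<^sub>E {1..p}" "mono_on {1..n} v"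
    and mp: "1 \<le> m" "1 \<le> p"
    using assms by (auto simp: f g simplex_simps)
  have ui: "u i \<in> {1..n}" if "i \<in> {1..m}" for i
    using PiE_mem[OF u(1) that] .
  have vi: "v i \<in> {1..p}" if "i \<in> {1..n}" for i
    using PiE_mem[OF v(1) that] .
  have "compose {1..m} v u \<in> {1..m} \<rightarrow>\<^sub>E {1..p}"
    using ui vi by (auto simp: compose_def)
  moreover have "mono_on {1..m} (compose {1..m} v u)"
  proof (rule mono_onI)
    fix i j assume ij: "i \<in> {1..m}" "j \<in> {1..m}" "i \<le> j"
    then have "u i \<le> u j" by (rule mono_onD[OF u(2)])
    then have "v (u i) \<le> v (u j)" using ui ij by (intro mono_onD[OF v(2)]) auto
    then show "compose {1..m} v u i \<le> compose {1..m} v u j"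
      using ij by (simp add: compose_def)
  qed
  ultimately show "g \<cdot>\<^bsub>simplex_cat\<^esub> f \<in> Ar simplex_cat"
    using mp by (simp add: f g simplex_simps)
  show "src simplex_cat (g \<cdot>\<^bsub>simplex_cat\<^esub> f) = src simplex_cat f"
    "tgt simplex_cat (g \<cdot>\<^bsub>simplex_cat\<^esub> f) = tgt simplex_cat g"
    by (simp_all add: f g simplex_simps)
  \<comment> \<open>Values lie in \<open>{1..n}\<close>, so the truncated subtraction in
    \<open>word\<close> loses nothing and the shifts by 1 cancel.\<close>
  have "Suc (u (Suc i) - 1) = u (Suc i)" "u (Suc i) - 1 < n" if "i < m" for i
    using ui[of "Suc i"] that by auto
  then show "word (g \<cdot>\<^bsub>simplex_cat\<^esub> f) = map ((!) (word g)) (word f)"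
    by (auto simp: f g word_def simplex_simps compose_def)
qed

lemma simplex_idn:
  assumes "1 \<le> n"
  shows "idn simplex_cat n \<in> Ar simplex_cat" "word (idn simplex_cat n) = [0..<n]"
    "src simplex_cat (idn simplex_cat n) = n" "tgt simplex_cat (idn simplex_cat n) = n"
  using assms by (auto simp: simplex_simps word_def mono_on_def intro!: nth_equalityI)

lemma set_word: "set (word f) = (\<lambda>i. i - 1) ` im f"
proof -
  obtain m u n where f: "f = (m, u, n)" by (cases f)
  have "{1..m} = Suc ` {0..<m}" by (simp add: atLeastLessThanSuc_atLeastAtMost)
  then show ?thesis
    by (simp add: f word_def im_def image_image del: image_Suc_atLeastLessThan)
qed

text \<open>Injectivity makes each word free of repetitions, disjointness makes the concatenation
  so, and covering makes it a permutation of \<open>[0..<n]\<close>. The bound on the source keeps a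
  covering family inside the truncated category.\<close>

lemma covering_family_words:
  assumes "covering_family n fs"
  shows "sort (concat (map word fs)) = [0..<n]" "set (concat (map word fs)) \<subseteq> {..<n}"
    "\<And>f. f \<in> set fs \<Longrightarrow> f \<in> Ar simplex_cat \<and> tgt simplex_cat f = n \<and> src simplex_cat f \<le> n"
proof -
  have ar: "f \<in> Ar simplex_cat" "tgt simplex_cat f = n" "inj_on (fst (snd f)) {1..src simplex_cat f}"
    if "f \<in> set fs" for f
    using assms that by (auto simp: covering_family_def simplex_simps)
  have im: "im f \<subseteq> {1..n}" if "f \<in> set fs" for f
    using assms that unfolding covering_family_def by blast
  have dist: "distinct (word f)" if f: "f \<in> set fs" for f
  proof -
    obtain m u where fe: "f = (m, u, n)" using ar(2)[OF f] by (cases f) (simp add: simplex_simps)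
    have u: "u \<in> {1..m} \<rightarrow>\<^sub>E {1..n}" "inj_on u {1..m}"
      using ar[OF f] by (auto simp: fe simplex_simps)
    have "inj_on (\<lambda>i. u (Suc i) - 1) {0..<m}"
    proof (rule inj_onI)
      fix i j assume ij: "i \<in> {0..<m}" "j \<in> {0..<m}" "u (Suc i) - 1 = u (Suc j) - 1"
      then have "u (Suc i) = u (Suc j)"
        using PiE_mem[OF u(1), of "Suc i"] PiE_mem[OF u(1), of "Suc j"] by auto
      then show "i = j" using inj_onD[OF u(2), of "Suc i" "Suc j"] ij by auto
    qed
    then show ?thesis by (simp add: fe word_def distinct_map)
  qed
  have disj: "set (word (fs ! i)) \<inter> set (word (fs ! j)) = {}"
    if ij: "i < length fs" "j < length fs" "i \<noteq> j" for i j
  proof -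
    have "inj_on (\<lambda>i. i - 1) {1..n}" by (auto intro!: inj_onI)
    moreover have "im (fs ! i) \<inter> im (fs ! j) = {}"
      using assms ij by (auto simp: covering_family_def)
    moreover have "im (fs ! i) \<subseteq> {1..n}" "im (fs ! j) \<subseteq> {1..n}"
      using im ij by auto
    ultimately show ?thesis
      unfolding set_word by (metis image_empty inj_on_image_Int)
  qed
  \<comment> \<open>Disjoint words are different only if they are not both empty; here none is, the
    objects being [n] with n \<ge> 1.\<close>
  have ne: "word f \<noteq> []" if "f \<in> set fs" for f
    using word_arrow(3)[OF ar(1)[OF that]] length_word[of f] by force
  have "distinct (map word fs)"
    unfolding distinct_conv_nth
  proof (intro allI impI)
    fix i j assume ij: "i < length (map word fs)" "j < length (map word fs)" "i \<noteq> j"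
    then show "map word fs ! i \<noteq> map word fs ! j"
      using disj[of i j] ne[OF nth_mem, of i] by auto
  qed
  moreover have "set v \<inter> set w = {}"
    if vw: "v \<in> set (map word fs)" "w \<in> set (map word fs)" "v \<noteq> w" for v w
  proof -
    obtain i j where "i < length fs" "v = word (fs ! i)" "j < length fs" "w = word (fs ! j)"
      using vw(1,2) by (auto simp: in_set_conv_nth)
    then show ?thesis using disj[of i j] vw(3) by auto
  qed
  ultimately have d: "distinct (concat (map word fs))"
    using dist by (intro distinct_concat) auto
  have "set (concat (map word fs)) = (\<lambda>i. i - 1) ` (\<Union>f\<in>set fs. im f)"
    by (auto simp: set_word)
  also have "(\<Union>f\<in>set fs. im f) = Suc ` {0..<n}"
    using assms by (simp add: covering_family_def atLeastLessThanSuc_atLeastAtMost)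
  finally have set: "set (concat (map word fs)) = {0..<n}"
    by (simp add: image_image del: image_Suc_atLeastLessThan)
  show "sort (concat (map word fs)) = [0..<n]"
    using d set by (intro sorted_distinct_set_unique) auto
  show "set (concat (map word fs)) \<subseteq> {..<n}"
    using set by auto
  fix f assume f: "f \<in> set fs"
  have "length (word f) = card (set (word f))" using dist[OF f] by (simp add: distinct_card)
  also have "\<dots> \<le> card {..<n}" using word_arrow(2)[OF ar(1)[OF f]] ar(2)[OF f] by (intro card_mono) auto
  finally show "f \<in> Ar simplex_cat \<and> tgt simplex_cat f = n \<and> src simplex_cat f \<le> n"
    using ar[OF f] by simp
qed

lemma pt_arrow_of: "pt 1 = arrow_of 2 [0]" "pt 2 = arrow_of 2 [1]"
  by (auto simp: pt_def arrow_of_def)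

section \<open>The cosimplicial monoid of a quasi-commutative monoid\<close>

context multiplication_data
begin

definition power_cosimp :: "('o, 'a) cosimp" where
  "power_cosimp = \<lparr>fob = power_mon, far = (\<lambda>f. (power_mon (src simplex_cat f),
    pure (tgt simplex_cat f) (word f), power_mon (tgt simplex_cat f)))\<rparr>"

lemma ev_swap:
  assumes X: "rep n X l" and ij: "i \<le> j" "j < n" and e: "e \<in> hom_set C (tunit C) X"
  shows "ev X l e [j, i] = ev X l e [i, j] \<cdot> R"
proof -
  note ops = rep_operators[OF X]
  have i: "i < n" using ij by simp
  note simps = operatorsD[OF ops] hom_setD[OF e]
  have "ev X l e [j, i] = (l i \<cdot> (A \<rhd> l j) \<cdot> (R \<lhd> X)) \<cdot> ((A \<odot> A) \<rhd> e)"
    unfolding rep_braid[OF X ij(2,1)] using ij i by (simp add: ev_def simps)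
  also have "\<dots> = l i \<cdot> (A \<rhd> l j) \<cdot> ((R \<lhd> X) \<cdot> ((A \<odot> A) \<rhd> e))"
    using ij i by (simp add: simps)
  also have "\<dots> = l i \<cdot> (A \<rhd> l j) \<cdot> (((A \<odot> A) \<rhd> e) \<cdot> (R \<lhd> tunit C))"
    unfolding interchange[OF R_hom e] interchange'[OF R_hom e] ..
  also have "\<dots> = ev X l e [i, j] \<cdot> R"
    using ij i by (simp add: ev_def simps)
  finally show ?thesis .
qed

end

context quasicomm_structure
begin

lemma is_functor_power_cosimp: "is_functor simplex_cat (Mon C) power_cosimp"
  unfolding is_functor_def
proof (intro conjI ballI impI)
  fix n assume "n \<in> Ob simplex_cat"
  then have n: "1 \<le> n" by (simp add: simplex_simps)
  show "fob power_cosimp n \<in> Ob (Mon C)"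
    using is_mon_power_mon by (simp add: power_cosimp_def Mon_simps)
  show "far power_cosimp (idn simplex_cat n) = idn (Mon C) (fob power_cosimp n)"
    using simplex_idn[OF n] pure_upt by (simp add: power_cosimp_def Mon_simps power_mon_def)
next
  fix f assume f: "f \<in> Ar simplex_cat"
  show "far power_cosimp f
      \<in> hom_set (Mon C) (fob power_cosimp (src simplex_cat f)) (fob power_cosimp (tgt simplex_cat f))"
    using is_mon_power_mon pure_mon_hom[OF word_arrow(1,2)[OF f]]
    by (simp add: power_cosimp_def hom_set_Mon und_def)
  fix g assume g: "g \<in> Ar simplex_cat" "tgt simplex_cat f = src simplex_cat g"
  have "pure (tgt simplex_cat g) (word g) \<cdot> pure (tgt simplex_cat f) (word f)
      = pure (tgt simplex_cat g) (map ((!) (word g)) (word f))"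
    using pure_intertwine[OF word_arrow(1,2)[OF g(1)], of "word f"] word_arrow(2)[OF f] g(2) by simp
  then show "far power_cosimp (g \<cdot>\<^bsub>simplex_cat\<^esub> f) = far power_cosimp g \<cdot>\<^bsub>Mon C\<^esub> far power_cosimp f"
    using simplex_cmp_arrow[OF f g] by (simp add: power_cosimp_def Mon_simps)
qed

lemma covering_map_power_cosimp:
  assumes fs: "\<And>f. f \<in> set fs \<Longrightarrow> f \<in> Ar simplex_cat \<and> tgt simplex_cat f = n"
  shows "covering_map C power_cosimp n fs = pure n (concat (map word fs))"
proof -
  have maps: "map (\<lambda>f. und (far power_cosimp f)) fs = map (pure n) (map word fs)"
    using fs by (simp add: power_cosimp_def und_def)
  have words: "set w \<subseteq> {..<n}" if w: "w \<in> set (map word fs)" for w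
  proof -
    obtain f where "f \<in> set fs" "w = word f"
      using w by auto
    then show ?thesis using fs[of f] word_arrow(2)[of f] by simp
  qed
  have "iter_mult C (power_mon n) (length (map word fs)) \<cdot> tensor_list C (map (pure n) (map word fs))
      = pure n (concat (map word fs))"
    using compatible_ev_concat[OF shuffle_compatible, of "map word fs", OF words]
    by (simp add: power_mon_def)
  then show ?thesis
    unfolding covering_map_def maps by (simp add: power_cosimp_def)
qed

text \<open>Sorting the word of a covering family yields \<open>[0..<n]\<close>, whose value is the
  identity, so the covering map equals the automorphism Q that sorting produces.\<close>

lemma covering_condition_power_cosimp: "covering_condition simplex_cat C power_cosimp"
  unfolding covering_condition_def
proof (intro ballI allI impI)
  fix n fs assume fs: "covering_family n fs"
  note words = covering_family_words[OF fs]
  from ev_sort[OF rep_shuffle quasicomm_axioms(4) words(2) tone_hom'] obtain Q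
    where Q: "Q \<in> hom_set C (tpow (length (concat (map word fs)))) (tpow (length (concat (map word fs))))"
      "is_iso C Q" and eq: "pure n (concat (map word fs)) = pure n [0..<n] \<cdot> Q"
    unfolding words(1) by blast
  have len: "length (concat (map word fs)) = n"
    using arg_cong[OF words(1), of length] by simp
  have "covering_map C power_cosimp n fs = Q"
    using covering_map_power_cosimp[of fs n] words(3) eq Q(1) hom_setD[OF Q(1)]
    unfolding len by (simp add: pure_upt)
  then show "is_iso C (covering_map C power_cosimp n fs)"
    using Q(2) by simp
qed

lemma power_mon_1: "power_mon 1 = base"
  using hom_setD[OF \<mu>_hom] hom_setD[OF \<iota>_hom] by (simp add: power_mon_def base_def tmul_def)

lemma power_cosimp_covering: "power_cosimp \<in> covering_cosimp simplex_cat C A"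
  using is_functor_power_cosimp covering_condition_power_cosimp power_mon_1
  by (simp add: covering_cosimp_def power_cosimp_def)

text \<open>The points in order form the word 0, 1 with value the identity, in the opposite order 1,
  0 with value R. The structure is recovered exactly, not just up to isomorphism.\<close>

lemma quasicomm_of_power_cosimp: "quasicomm_of C power_cosimp = (\<mu>, \<iota>, R)"
proof -
  have pts: "pt 1 \<in> Ar simplex_cat" "pt 2 \<in> Ar simplex_cat" "tgt simplex_cat (pt 1) = 2"
    "tgt simplex_cat (pt 2) = 2" "word (pt 1) = [0]" "word (pt 2) = [1]"
    unfolding pt_arrow_of by (auto intro!: arrow_of_arrow)
  have ar: "f \<in> Ar simplex_cat \<and> tgt simplex_cat f = 2" if "f \<in> {pt 1, pt 2}" for f
    using that pts by blast
  have upt: "[0..<2] = [0, 1::nat]" by (simp add: upt_rec)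
  have c12: "covering_map C power_cosimp 2 [pt 1, pt 2] = idn C (A \<odot> A)"
  proof -
    have "covering_map C power_cosimp 2 [pt 1, pt 2] = pure 2 (concat (map word [pt 1, pt 2]))"
      by (rule covering_map_power_cosimp) (simp add: ar)
    also have "concat (map word [pt 1, pt 2]) = [0..<2]"
      by (simp add: pts upt del: One_nat_def)
    finally show ?thesis
      unfolding pure_upt by (simp add: numeral_2_eq_2)
  qed
  have "covering_map C power_cosimp 2 [pt 2, pt 1] = pure 2 (concat (map word [pt 2, pt 1]))"
    by (rule covering_map_power_cosimp) (auto simp add: ar)
  also have "concat (map word [pt 2, pt 1]) = [1, 0]"
    by (simp add: pts del: One_nat_def)
  also have "pure 2 [1, 0] = idn C (tpow 2) \<cdot> R"
    using ev_swap[OF rep_shuffle, of 0 1 2 "tone 2"] pure_upt[of 2] tone_hom' by (simp add: upt)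
  finally have c21: "covering_map C power_cosimp 2 [pt 2, pt 1] = R"
    by (simp add: numeral_2_eq_2)
  have "inv_arrow C (idn C (A \<odot> A)) = idn C (A \<odot> A)"
    using inv_arrow_props[OF is_iso_idn, of "A \<odot> A" "A \<odot> A" "A \<odot> A"] by (simp add: hom_setI)
  then have "cosimp_braiding C power_cosimp = R"
    unfolding cosimp_braiding_def c12 c21 by simp
  then show ?thesis
    using power_mon_1 by (simp add: quasicomm_of_def power_cosimp_def)
qed

end

section \<open>Yang-Baxter operators from representations\<close>

context multiplication_data
begin

text \<open>Each law is verified on X behind the word a b and then cancelled. There R turns the word
  a b into b a, and the four laws come, in this order, from the unit laws of b and a and the action
  laws of a and b.\<close>

lemma two_point_axioms:
  assumes X: "rep 2 X l" and e: "e \<in> hom_set C (tunit C) X" and iso: "is_iso C (ev X l e [0, 1])"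
  shows "R \<cdot> (\<iota> \<lhd> A) = A \<rhd> \<iota>"
    "R \<cdot> (A \<rhd> \<iota>) = \<iota> \<lhd> A"
    "R \<cdot> (A \<rhd> \<mu>) = (\<mu> \<lhd> A) \<cdot> (A \<rhd> R) \<cdot> (R \<lhd> A)"
    "R \<cdot> (\<mu> \<lhd> A) = (A \<rhd> \<mu>) \<cdot> (R \<lhd> A) \<cdot> (A \<rhd> R)"
proof -
  define a b where "a = l 0" and "b = l 1"
  have aX: "a \<in> hom_set C (A \<odot> X) X" and a [simp]: "a \<in> Ar C" "src C a = A \<odot> X" "tgt C a = X"
    and a_unit: "a \<cdot> (\<iota> \<lhd> X) = idn C X" and a_assoc: "a \<cdot> (\<mu> \<lhd> X) = a \<cdot> (A \<rhd> a)"
    and Xob [simp]: "X \<in> Ob C"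
    using repD[OF X, of 0] by (auto simp: a_def)
  have bX: "b \<in> hom_set C (A \<odot> X) X" and b [simp]: "b \<in> Ar C" "src C b = A \<odot> X" "tgt C b = X"
    and b_unit: "b \<cdot> (\<iota> \<lhd> X) = idn C X" and b_assoc: "b \<cdot> (\<mu> \<lhd> X) = b \<cdot> (A \<rhd> b)"
    using repD[OF X, of 1] by (auto simp: b_def)
  have swap: "a \<cdot> (A \<rhd> b) \<cdot> (R \<lhd> X) = b \<cdot> (A \<rhd> a)"
    using rep_braid[OF X, of 1 0] by (simp add: a_def b_def)
  have act: "act X l [0, 1] = a \<cdot> (A \<rhd> b)"
    by (simp add: a_def[symmetric] b_def[symmetric, simplified])
  have w: "set [0, 1] \<subseteq> {..<2::nat}" by auto
  note cancel = ev_cancel[OF rep_operators[OF X] w e iso, unfolded act]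
  have lhs: "(a \<cdot> (A \<rhd> b)) \<cdot> ((R \<cdot> T) \<lhd> X) = (b \<cdot> (A \<rhd> a)) \<cdot> (T \<lhd> X)"
    if "T \<in> Ar C" "tgt C T = A \<odot> A" for T
    unfolding swap[symmetric] using that by simp
  show "R \<cdot> (\<iota> \<lhd> A) = A \<rhd> \<iota>"
  proof (rule cancel[where Y = A])
    have "(a \<cdot> (A \<rhd> b)) \<cdot> ((R \<cdot> (\<iota> \<lhd> A)) \<lhd> X) = b \<cdot> ((A \<rhd> a) \<cdot> (\<iota> \<lhd> (A \<odot> X)))"
      by (subst lhs) simp_all
    also have "(A \<rhd> a) \<cdot> (\<iota> \<lhd> (A \<odot> X)) = (\<iota> \<lhd> X) \<cdot> a"
      using interchange[OF \<iota>_hom aX] interchange'[OF \<iota>_hom aX] by simp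
    also have "b \<cdot> \<dots> = (b \<cdot> (\<iota> \<lhd> X)) \<cdot> a"
      by simp
    also have "\<dots> = a \<cdot> (A \<rhd> (b \<cdot> (\<iota> \<lhd> X)))"
      unfolding b_unit by simp
    finally show "(a \<cdot> (A \<rhd> b)) \<cdot> ((R \<cdot> (\<iota> \<lhd> A)) \<lhd> X) = (a \<cdot> (A \<rhd> b)) \<cdot> ((A \<rhd> \<iota>) \<lhd> X)"
      by simp
  qed (auto intro!: hom_setI)
  show "R \<cdot> (A \<rhd> \<iota>) = \<iota> \<lhd> A"
  proof (rule cancel[where Y = A])
    have "(a \<cdot> (A \<rhd> b)) \<cdot> ((R \<cdot> (A \<rhd> \<iota>)) \<lhd> X) = b \<cdot> (A \<rhd> (a \<cdot> (\<iota> \<lhd> X)))"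
      by (subst lhs) simp_all
    also have "\<dots> = (a \<cdot> (\<iota> \<lhd> X)) \<cdot> b"
      unfolding a_unit by simp
    also have "\<dots> = a \<cdot> ((\<iota> \<lhd> X) \<cdot> b)"
      by simp
    also have "(\<iota> \<lhd> X) \<cdot> b = (A \<rhd> b) \<cdot> (\<iota> \<lhd> (A \<odot> X))"
      using interchange[OF \<iota>_hom bX] interchange'[OF \<iota>_hom bX] by simp
    finally show "(a \<cdot> (A \<rhd> b)) \<cdot> ((R \<cdot> (A \<rhd> \<iota>)) \<lhd> X) = (a \<cdot> (A \<rhd> b)) \<cdot> ((\<iota> \<lhd> A) \<lhd> X)"
      by simp
  qed (auto intro!: hom_setI)
  show "R \<cdot> (A \<rhd> \<mu>) = (\<mu> \<lhd> A) \<cdot> (A \<rhd> R) \<cdot> (R \<lhd> A)"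
  proof (rule cancel[where Y = "A \<odot> A \<odot> A"])
    have "(a \<cdot> (A \<rhd> b)) \<cdot> ((R \<cdot> (A \<rhd> \<mu>)) \<lhd> X) = b \<cdot> (A \<rhd> (a \<cdot> (\<mu> \<lhd> X)))"
      by (subst lhs) simp_all
    also have "\<dots> = (b \<cdot> (A \<rhd> a)) \<cdot> ((A \<odot> A) \<rhd> a)"
      unfolding a_assoc by simp
    also have "\<dots> = a \<cdot> (A \<rhd> b) \<cdot> ((R \<lhd> X) \<cdot> ((A \<odot> A) \<rhd> a))"
      unfolding swap[symmetric] by simp
    also have "\<dots> = a \<cdot> (A \<rhd> (b \<cdot> (A \<rhd> a))) \<cdot> (R \<lhd> (A \<odot> X))"
      unfolding interchange[OF R_hom aX] interchange'[OF R_hom aX, symmetric] by simp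
    also have "\<dots> = (a \<cdot> (A \<rhd> a)) \<cdot> ((A \<odot> A) \<rhd> b) \<cdot> (A \<rhd> R \<lhd> X) \<cdot> (R \<lhd> (A \<odot> X))"
      unfolding swap[symmetric] by simp
    also have "\<dots> = a \<cdot> ((\<mu> \<lhd> X) \<cdot> ((A \<odot> A) \<rhd> b)) \<cdot> (A \<rhd> R \<lhd> X) \<cdot> (R \<lhd> (A \<odot> X))"
      unfolding a_assoc[symmetric] by simp
    also have "(\<mu> \<lhd> X) \<cdot> ((A \<odot> A) \<rhd> b) = (A \<rhd> b) \<cdot> (\<mu> \<lhd> (A \<odot> X))"
      unfolding interchange[OF \<mu>_hom bX] interchange'[OF \<mu>_hom bX] ..
    finally show "(a \<cdot> (A \<rhd> b)) \<cdot> ((R \<cdot> (A \<rhd> \<mu>)) \<lhd> X)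
        = (a \<cdot> (A \<rhd> b)) \<cdot> (((\<mu> \<lhd> A) \<cdot> (A \<rhd> R) \<cdot> (R \<lhd> A)) \<lhd> X)"
      by simp
  qed (auto intro!: hom_setI)
  show "R \<cdot> (\<mu> \<lhd> A) = (A \<rhd> \<mu>) \<cdot> (R \<lhd> A) \<cdot> (A \<rhd> R)"
  proof (rule cancel[where Y = "A \<odot> A \<odot> A"])
    have "(a \<cdot> (A \<rhd> b)) \<cdot> ((R \<cdot> (\<mu> \<lhd> A)) \<lhd> X) = b \<cdot> ((A \<rhd> a) \<cdot> (\<mu> \<lhd> (A \<odot> X)))"
      by (subst lhs) simp_all
    also have "(A \<rhd> a) \<cdot> (\<mu> \<lhd> (A \<odot> X)) = (\<mu> \<lhd> X) \<cdot> ((A \<odot> A) \<rhd> a)"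
      unfolding interchange[OF \<mu>_hom aX] interchange'[OF \<mu>_hom aX] ..
    also have "b \<cdot> \<dots> = (b \<cdot> (\<mu> \<lhd> X)) \<cdot> ((A \<odot> A) \<rhd> a)"
      by simp
    also have "\<dots> = b \<cdot> (A \<rhd> (b \<cdot> (A \<rhd> a)))"
      unfolding b_assoc by simp
    also have "\<dots> = b \<cdot> (A \<rhd> (a \<cdot> (A \<rhd> b) \<cdot> (R \<lhd> X)))"
      by (simp only: swap)
    also have "\<dots> = (b \<cdot> (A \<rhd> a)) \<cdot> ((A \<odot> A) \<rhd> b) \<cdot> (A \<rhd> R \<lhd> X)"
      by simp
    also have "\<dots> = a \<cdot> (A \<rhd> b) \<cdot> ((R \<lhd> X) \<cdot> ((A \<odot> A) \<rhd> b)) \<cdot> (A \<rhd> R \<lhd> X)"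
      unfolding swap[symmetric] by simp
    also have "(R \<lhd> X) \<cdot> ((A \<odot> A) \<rhd> b) = ((A \<odot> A) \<rhd> b) \<cdot> (R \<lhd> (A \<odot> X))"
      unfolding interchange[OF R_hom bX] interchange'[OF R_hom bX] ..
    also have "a \<cdot> (A \<rhd> b) \<cdot> (((A \<odot> A) \<rhd> b) \<cdot> (R \<lhd> (A \<odot> X))) \<cdot> (A \<rhd> R \<lhd> X)
        = a \<cdot> (A \<rhd> (b \<cdot> (A \<rhd> b))) \<cdot> (R \<lhd> (A \<odot> X)) \<cdot> (A \<rhd> R \<lhd> X)"
      by simp
    finally show "(a \<cdot> (A \<rhd> b)) \<cdot> ((R \<cdot> (\<mu> \<lhd> A)) \<lhd> X)
        = (a \<cdot> (A \<rhd> b)) \<cdot> (((A \<rhd> \<mu>) \<cdot> (R \<lhd> A) \<cdot> (A \<rhd> R)) \<lhd> X)"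
      unfolding b_assoc[symmetric] by simp
  qed (auto intro!: hom_setI)
qed

text \<open>Exchanges of adjacent letters lead from 0 1 2 to 2 1 0 along two paths, and these are
  the two sides of the equation.\<close>

lemma three_point_yang_baxter:
  assumes X: "rep 3 X l" and e: "e \<in> hom_set C (tunit C) X" and iso: "is_iso C (ev X l e [0, 1, 2])"
  shows "(R \<lhd> A) \<cdot> (A \<rhd> R) \<cdot> (R \<lhd> A) = (A \<rhd> R) \<cdot> (R \<lhd> A) \<cdot> (A \<rhd> R)"
proof -
  note ops = rep_operators[OF X]
  note simps = operatorsD[OF ops]
  define t where "t i j k = l i \<cdot> (A \<rhd> l j) \<cdot> ((A \<odot> A) \<rhd> l k)" for i j k
  have t: "t i j k \<in> Ar C" "src C (t i j k) = A \<odot> A \<odot> A \<odot> X" "tgt C (t i j k) = X"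
    if "i < 3" "j < 3" "k < 3" for i j k
    using that by (simp_all add: t_def simps)
  have left: "t i j k \<cdot> (R \<lhd> (A \<odot> X)) = t j i k" if "i \<le> j" "j < 3" "k < 3" for i j k
  proof -
    have "i < 3" using that by simp
    have lk: "l k \<in> hom_set C (A \<odot> X) X" by (rule repD(2)[OF X that(3)])
    have "t i j k \<cdot> (R \<lhd> (A \<odot> X)) = l i \<cdot> (A \<rhd> l j) \<cdot> (((A \<odot> A) \<rhd> l k) \<cdot> (R \<lhd> (A \<odot> X)))"
      using that \<open>i < 3\<close> by (simp add: t_def simps)
    also have "((A \<odot> A) \<rhd> l k) \<cdot> (R \<lhd> (A \<odot> X)) = (R \<lhd> X) \<cdot> ((A \<odot> A) \<rhd> l k)"
      unfolding interchange[OF R_hom lk] interchange'[OF R_hom lk] ..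
    also have "l i \<cdot> (A \<rhd> l j) \<cdot> \<dots> = (l i \<cdot> (A \<rhd> l j) \<cdot> (R \<lhd> X)) \<cdot> ((A \<odot> A) \<rhd> l k)"
      using that \<open>i < 3\<close> by (simp add: simps)
    also have "\<dots> = t j i k"
      unfolding rep_braid[OF X that(2,1)] using that \<open>i < 3\<close> by (simp add: t_def simps)
    finally show ?thesis .
  qed
  have right: "t i j k \<cdot> (A \<rhd> R \<lhd> X) = t i k j" if "j \<le> k" "k < 3" "i < 3" for i j k
  proof -
    have "j < 3" using that by simp
    have "t i j k \<cdot> (A \<rhd> R \<lhd> X) = l i \<cdot> (A \<rhd> (l j \<cdot> (A \<rhd> l k) \<cdot> (R \<lhd> X)))"
      using that \<open>j < 3\<close> by (simp add: t_def simps)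
    also have "\<dots> = t i k j"
      unfolding rep_braid[OF X that(2,1)] using that \<open>j < 3\<close> by (simp add: t_def simps)
    finally show ?thesis .
  qed
  have act: "act X l [0, 1, 2] = t 0 1 2"
    by (simp add: t_def simps)
  have w: "set [0, 1, 2] \<subseteq> {..<3::nat}" by auto
  have Xob: "X \<in> Ob C" by (rule simps(1))
  show ?thesis
  proof (rule ev_cancel[OF ops w e iso, where Y = "A \<odot> A \<odot> A"])
    have "act X l [0, 1, 2] \<cdot> (((R \<lhd> A) \<cdot> (A \<rhd> R) \<cdot> (R \<lhd> A)) \<lhd> X)
        = ((t 0 1 2 \<cdot> (R \<lhd> (A \<odot> X))) \<cdot> (A \<rhd> R \<lhd> X)) \<cdot> (R \<lhd> (A \<odot> X))"
      unfolding act using t[of 0 1 2] Xob by simp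
    \<comment> \<open>The path is 012, 102, 120, 210. The premises of \<open>right\<close> mention
      j, k, i in this order, which is the order of its instantiations.\<close>
    also have "\<dots> = t 2 1 0"
      using left[of 0 1 2] right[of 0 2 1] left[of 1 2 0] by simp
    also have "\<dots> = ((t 0 1 2 \<cdot> (A \<rhd> R \<lhd> X)) \<cdot> (R \<lhd> (A \<odot> X))) \<cdot> (A \<rhd> R \<lhd> X)"
      using right[of 1 2 0] left[of 0 2 1] right[of 0 1 2] by simp
    also have "\<dots> = act X l [0, 1, 2] \<cdot> (((A \<rhd> R) \<cdot> (R \<lhd> A) \<cdot> (A \<rhd> R)) \<lhd> X)"
      unfolding act using t[of 0 1 2] Xob by simp
    finally show "act X l [0, 1, 2] \<cdot> (((R \<lhd> A) \<cdot> (A \<rhd> R) \<cdot> (R \<lhd> A)) \<lhd> X)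
        = act X l [0, 1, 2] \<cdot> (((A \<rhd> R) \<cdot> (R \<lhd> A) \<cdot> (A \<rhd> R)) \<lhd> X)" .
  qed (auto intro!: hom_setI)
qed

end

section \<open>The quasi-commutative monoid of a cosimplicial monoid\<close>

lemma lessThan_2_3: "{..<2} = {0, 1::nat}" "{..<3} = {0, 1, 2::nat}"
  by auto

text \<open>\<open>S = {1..}\<close> gives the full complex and \<open>S = {1, 2, 3}\<close> the
  truncated one, so the reconstruction is carried out once for both.\<close>

locale covering_cosimplicial = strict_monoidal_category C
  for C :: "('o, 'a, 'x) mcat_scheme" (structure) +
  fixes A :: 'o and S :: "nat set" and F :: "('o, 'a) cosimp"
  assumes S: "{1, 2, 3} \<subseteq> S"
    and F: "F \<in> covering_cosimp (full_subcategory simplex_cat S) C A"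
begin

abbreviation D where "D \<equiv> full_subcategory simplex_cat S"

lemma D_simps:
  "Ob D = {n. 1 \<le> n \<and> n \<in> S}"
  "f \<in> Ar D \<longleftrightarrow> f \<in> Ar simplex_cat \<and> src simplex_cat f \<in> S \<and> tgt simplex_cat f \<in> S"
  "src D = src simplex_cat" "tgt D = tgt simplex_cat" "idn D = idn simplex_cat" "cmp D = cmp simplex_cat"
  by (auto simp: full_subcategory_def simplex_simps)

lemma F_props: "is_functor D (Mon C) F" "mobj (fob F 1) = A" "covering_condition D C F"
  using F by (auto simp: covering_cosimp_def)

lemma fob_mon: "\<lbrakk>1 \<le> n; n \<in> S\<rbrakk> \<Longrightarrow> is_mon C (fob F n)"
  using F_props(1) by (auto simp: is_functor_def D_simps Mon_simps)

lemma A_ob: "A \<in> Ob C"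
  using is_monD(1)[OF fob_mon, of 1] F_props(2) S by auto

lemma far_mon_hom:
  assumes "f \<in> Ar D"
  shows "is_mon_hom C (fob F (src simplex_cat f)) (fob F (tgt simplex_cat f)) (und (far F f))"
    "far F f = (fob F (src simplex_cat f), und (far F f), fob F (tgt simplex_cat f))"
  using F_props(1) assms unfolding is_functor_def hom_set_Mon by (auto simp: D_simps)

lemma und_far_cmp:
  assumes "f \<in> Ar D" "g \<in> Ar D" "tgt simplex_cat f = src simplex_cat g"
  shows "und (far F (g \<cdot>\<^bsub>simplex_cat\<^esub> f)) = und (far F g) \<cdot> und (far F f)"
proof -
  have "far F (g \<cdot>\<^bsub>simplex_cat\<^esub> f) = far F g \<cdot>\<^bsub>Mon C\<^esub> far F f"
    using F_props(1) assms unfolding is_functor_def by (auto simp: D_simps)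
  then show ?thesis
    by (simp add: und_Mon_cmp)
qed

lemma und_far_idn:
  assumes "1 \<le> n" "n \<in> S"
  shows "und (far F (idn simplex_cat n)) = idn C (mobj (fob F n))"
proof -
  have "far F (idn D n) = idn (Mon C) (fob F n)"
    using F_props(1) assms unfolding is_functor_def by (auto simp: D_simps)
  then show ?thesis
    by (simp add: D_simps Mon_simps und_def)
qed

section \<open>Points of a cosimplicial monoid and the type of R\<close>

definition point :: "nat \<Rightarrow> nat \<Rightarrow> 'a" where
  "point n i = und (far F (arrow_of n [i]))"

lemma point_arrow:
  assumes "n \<in> S" "i < n"
  shows "arrow_of n [i] \<in> Ar D"
  using assms S by (auto simp: D_simps intro!: arrow_of_arrow)

lemma covering_map_pt_hom:
  assumes "i < 2" "j < 2"
  shows "covering_map C F 2 [arrow_of 2 [i], arrow_of 2 [j]] \<in> hom_set C (A \<odot> A) (mobj (fob F 2))"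
proof -
  have S2: "2 \<in> S" using S by simp
  note M = fob_mon[OF _ S2]
  have p: "und (far F (arrow_of 2 [k])) \<in> hom_set C A (mobj (fob F 2))" if "k < 2" for k
    using is_mon_homD(4)[OF far_mon_hom(1)[OF point_arrow[OF S2 that]]] F_props(2) by simp
  show ?thesis
    using hom_setD[OF p[OF assms(1)]] hom_setD[OF p[OF assms(2)]] is_monD(1-7)[OF M]
    by (simp add: covering_map_def hom_setI)
qed

lemma arrow_points_covering:
  assumes w: "distinct w" "set w = {..<n}"
  shows "covering_family n (map (\<lambda>i. arrow_of n [i]) w)"
proof -
  have im: "im (arrow_of n [i]) = {Suc i}" for i
    by (auto simp: im_def arrow_of_def)
  have ar: "arrow_of n [i] \<in> Ar simplex_cat" if "i < n" for i
    using that by (intro arrow_of_arrow) auto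
  have un: "(\<Union>i<n. {Suc i}) = {1..n}"
    by (auto simp: gr0_conv_Suc Suc_le_eq)
  show ?thesis
    unfolding covering_family_def
  proof (intro conjI)
    show "\<forall>(k, u, l)\<in>set (map (\<lambda>i. arrow_of n [i]) w). (k, u, l) \<in> Ar simplex_cat \<and> l = n \<and> inj_on u {1..k}"
      using w ar by (auto simp: arrow_of_def)
  qed (use w un in \<open>auto simp: im nth_eq_iff_index_eq\<close>)
qed

lemma covering_map_iso:
  assumes "1 \<le> n" "n \<in> S" "distinct w" "set w = {..<n}"
  shows "is_iso C (covering_map C F n (map (\<lambda>i. arrow_of n [i]) w))"
  using F_props(3) arrow_points_covering assms by (auto simp: covering_condition_def D_simps)

text \<open>The machinery of words has R among its parameters, so the type of R is first read off
  directly from the covering maps.\<close>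

lemma cosimp_braiding_hom: "cosimp_braiding C F \<in> hom_set C (A \<odot> A) (A \<odot> A)"
proof -
  have "2 \<in> S" using S by simp
  then have "is_iso C (covering_map C F 2 [arrow_of 2 [0], arrow_of 2 [1]])"
    using covering_map_iso[of 2 "[0, 1]"] by (simp add: lessThan_2_3)
  then show ?thesis
    unfolding cosimp_braiding_def pt_arrow_of
    using inv_arrow_props[OF _ covering_map_pt_hom[of 0 1]] hom_setD[OF covering_map_pt_hom[of 1 0]]
    by (auto intro!: hom_setI)
qed

sublocale multiplication_data C A "mmul (fob F 1)" "mone (fob F 1)" "cosimp_braiding C F"
  using A_ob cosimp_braiding_hom is_monD'[OF fob_mon, of 1] F_props(2) S by unfold_locales auto

lemma base_eq: "base = fob F 1"
  unfolding base_def using F_props(2) by simp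

lemma point_mon_hom:
  assumes "n \<in> S" "i < n"
  shows "is_mon_hom C base (fob F n) (point n i)"
  using far_mon_hom(1)[OF point_arrow[OF assms]] unfolding point_def base_eq by simp

abbreviation word_prod :: "nat \<Rightarrow> nat list \<Rightarrow> 'a" where
  "word_prod n \<equiv> ev (mobj (fob F n)) (left_mult (fob F n) (point n)) (mone (fob F n))"

lemma point_operators: "\<lbrakk>1 \<le> n; n \<in> S\<rbrakk> \<Longrightarrow> operators n (mobj (fob F n)) (left_mult (fob F n) (point n))"
  using left_mult_operators[OF fob_mon] point_mon_hom by blast

lemma point_compatible: "\<lbrakk>1 \<le> n; n \<in> S\<rbrakk> \<Longrightarrow> compatible n (fob F n) (left_mult (fob F n) (point n))"
  using left_mult_compatible[OF fob_mon] point_mon_hom by blast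

lemma word_prod_hom:
  assumes "1 \<le> n" "n \<in> S" "set w \<subseteq> {..<n}"
  shows "word_prod n w \<in> hom_set C (tpow (length w)) (mobj (fob F n))"
  using ev_hom'[OF point_operators[OF assms(1,2)] assms(3) is_monD'(2)[OF fob_mon[OF assms(1,2)]]] .

lemma covering_map_points:
  assumes n: "1 \<le> n" "n \<in> S" and w: "set w \<subseteq> {..<n}"
  shows "covering_map C F n (map (\<lambda>i. arrow_of n [i]) w) = word_prod n w"
proof -
  have maps: "map (\<lambda>f. und (far F f)) (map (\<lambda>i. arrow_of n [i]) w) = map (word_prod n) (map (\<lambda>i. [i]) w)"
    using w ev_left_mult_single[where p = "point n", OF fob_mon[OF n] point_mon_hom[OF n(2)]]
    by (auto simp: point_def)
  have "iter_mult C (fob F n) (length (map (\<lambda>i. [i]) w)) \<cdot> tensor_list C (map (word_prod n) (map (\<lambda>i. [i]) w))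
      = word_prod n (concat (map (\<lambda>i. [i]) w))"
    using w by (intro compatible_ev_concat[OF point_compatible[OF n]]) auto
  then show ?thesis
    unfolding covering_map_def maps by simp
qed

lemma word_prod_iso:
  assumes "1 \<le> n" "n \<in> S" "distinct w" "set w = {..<n}"
  shows "is_iso C (word_prod n w)"
  using covering_map_iso[OF assms] covering_map_points[OF assms(1,2), of w] assms(4) by simp

text \<open>Functoriality sends point i to the point \<open>word f ! i\<close>, and a monoid
  homomorphism carries products of points to products of their images.\<close>

lemma far_word_prod:
  assumes f: "f \<in> Ar D" and w: "set w \<subseteq> {..<src simplex_cat f}"
  shows "und (far F f) \<cdot> word_prod (src simplex_cat f) w = word_prod (tgt simplex_cat f) (map ((!) (word f)) w)"
proof -
  let ?m = "src simplex_cat f" and ?n = "tgt simplex_cat f"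
  have fD: "f \<in> Ar simplex_cat" "?m \<in> S" "?n \<in> S"
    using f by (auto simp: D_simps)
  note wf = word_arrow[OF fD(1)]
  have nth: "word f ! i < ?n" if "i < ?m" for i
    using wf(2) nth_mem[of i "word f"] that by (auto simp del: nth_mem)
  have comm: "und (far F f) \<cdot> point ?m i = point ?n (word f ! i)" if i: "i < ?m" for i
  proof -
    have ar: "arrow_of ?m [i] \<in> Ar D" "arrow_of ?n [word f ! i] \<in> Ar D"
      using point_arrow fD i nth by auto
    then have ar': "arrow_of ?m [i] \<in> Ar simplex_cat" "arrow_of ?n [word f ! i] \<in> Ar simplex_cat"
      by (auto simp: D_simps)
    have "f \<cdot>\<^bsub>simplex_cat\<^esub> arrow_of ?m [i] = arrow_of ?n [word f ! i]"
      using simplex_cmp_arrow[OF ar'(1) fD(1)] ar' by (intro arrow_eqI) simp_all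
    then show ?thesis
      using und_far_cmp[OF ar(1) f] by (simp add: point_def)
  qed
  show ?thesis
  proof (rule ev_left_mult_hom[OF fob_mon[OF wf(3) fD(2)] _ fob_mon[OF wf(4) fD(3)] _ far_mon_hom(1)[OF f] w])
    show "(!) (word f) ` set w \<subseteq> {..<?n}" using w nth by auto
    show "und (far F f) \<cdot> point ?m i = point ?n (word f ! i)" if "i \<in> set w" for i
      using that w comm by auto
  qed (use point_mon_hom fD in auto)
qed

lemma word_prod_braiding_2: "word_prod 2 [0, 1] \<cdot> cosimp_braiding C F = word_prod 2 [1, 0]"
proof -
  have n: "1 \<le> (2::nat)" "2 \<in> S" using S by auto
  have maps: "covering_map C F 2 [arrow_of 2 [0], arrow_of 2 [1]] = word_prod 2 [0, 1]"
    "covering_map C F 2 [arrow_of 2 [1], arrow_of 2 [0]] = word_prod 2 [1, 0]"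
    using covering_map_points[OF n, of "[0, 1]"] covering_map_points[OF n, of "[1, 0]"] by auto
  have iso: "is_iso C (word_prod 2 [0, 1])"
    using word_prod_iso[OF n, of "[0, 1]"] by (simp add: lessThan_2_3)
  have h: "word_prod 2 [0, 1] \<in> hom_set C (A \<odot> A) (mobj (fob F 2))" "word_prod 2 [1, 0] \<in> hom_set C (A \<odot> A) (mobj (fob F 2))"
    using word_prod_hom[OF n, of "[0, 1]"] word_prod_hom[OF n, of "[1, 0]"] by auto
  note inv = inv_arrow_props[OF iso h(1)]
  have "word_prod 2 [0, 1] \<cdot> cosimp_braiding C F
      = (word_prod 2 [0, 1] \<cdot> inv_arrow C (word_prod 2 [0, 1])) \<cdot> word_prod 2 [1, 0]"
    unfolding cosimp_braiding_def pt_arrow_of maps using inv(1-3) hom_setD[OF h(1)] hom_setD[OF h(2)]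
    by (intro cmp_assoc[symmetric]) simp_all
  then show ?thesis
    unfolding inv(5) using hom_setD[OF h(2)] by simp
qed

text \<open>The relation in A^2 that defines R is transported along the map [2] \<rightarrow> [n]
  with values i + 1 and j + 1. This map preserves the order exactly when i \<le> j; for i = j it
  collapses both points.\<close>

lemma word_prod_braiding:
  assumes n: "n \<in> S" and ij: "i \<le> j" "j < n"
  shows "word_prod n [i, j] \<cdot> cosimp_braiding C F = word_prod n [j, i]"
proof -
  have S2: "1 \<le> (2::nat)" "2 \<in> S" using S by auto
  let ?f = "arrow_of n [i, j]"
  have ar: "?f \<in> Ar D"
    using n ij S by (auto simp: D_simps numeral_2_eq_2 intro!: arrow_of_arrow)
  have src: "src simplex_cat ?f = 2" by simp
  note h = hom_setD[OF word_prod_hom[OF S2, of "[0, 1]"]]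
    and hf = is_mon_homD(1-3)[OF far_mon_hom(1)[OF ar], unfolded src]
  have "word_prod n [i, j] = und (far F ?f) \<cdot> word_prod 2 [0, 1]"
    "word_prod n [j, i] = und (far F ?f) \<cdot> word_prod 2 [1, 0]"
    using far_word_prod[OF ar, of "[0, 1]"] far_word_prod[OF ar, of "[1, 0]"] unfolding src by simp_all
  then show ?thesis
    using h hf word_prod_braiding_2 by simp
qed

lemma point_rep:
  assumes "1 \<le> n" "n \<in> S"
  shows "rep n (mobj (fob F n)) (left_mult (fob F n) (point n))"
  using word_prod_braiding[OF assms(2)] point_mon_hom[OF assms(2)] by (intro left_mult_rep[OF fob_mon[OF assms]])

lemma point_1: "point 1 0 = idn C A"
proof -
  have n: "1 \<in> S" using S by simp
  have ar: "idn simplex_cat 1 \<in> Ar simplex_cat" "arrow_of 1 [0] \<in> Ar simplex_cat"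
    using simplex_idn(1)[of 1] by (auto intro!: arrow_of_arrow)
  have "arrow_of 1 [0] = idn simplex_cat 1"
    using simplex_idn[of 1] ar by (intro arrow_eqI) auto
  then show ?thesis
    unfolding point_def using und_far_idn[OF _ n] F_props(2) by simp
qed

lemma word_prod_1: "word_prod 1 [0] = idn C A"
  using ev_left_mult_single[where p = "point 1" and i = 0, OF fob_mon point_mon_hom] S point_1 by simp

lemma quasicomm: "is_quasicomm_mon C base (cosimp_braiding C F)"
proof -
  let ?R = "cosimp_braiding C F"
  have n: "1 \<le> (1::nat)" "1 \<in> S" "1 \<le> (2::nat)" "2 \<in> S" "1 \<le> (3::nat)" "3 \<in> S"
    using S by auto
  have iso: "is_iso C (word_prod 2 [0, 1])" "is_iso C (word_prod 2 [1, 0])" "is_iso C (word_prod 3 [0, 1, 2])"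
    using word_prod_iso[OF n(3,4), of "[0, 1]"] word_prod_iso[OF n(3,4), of "[1, 0]"]
      word_prod_iso[OF n(5,6), of "[0, 1, 2]"] by (auto simp: lessThan_2_3)
  have h: "word_prod 2 [0, 1] \<in> hom_set C (A \<odot> A) (mobj (fob F 2))" "word_prod 2 [1, 0] \<in> hom_set C (A \<odot> A) (mobj (fob F 2))"
    using word_prod_hom[OF n(3,4), of "[0, 1]"] word_prod_hom[OF n(3,4), of "[1, 0]"] by auto
  have maps: "covering_map C F 2 [arrow_of 2 [0], arrow_of 2 [1]] = word_prod 2 [0, 1]"
    "covering_map C F 2 [arrow_of 2 [1], arrow_of 2 [0]] = word_prod 2 [1, 0]"
    using covering_map_points[OF n(3,4), of "[0, 1]"] covering_map_points[OF n(3,4), of "[1, 0]"] by auto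
  have "inv_arrow C (word_prod 2 [0, 1]) \<in> hom_set C (mobj (fob F 2)) (A \<odot> A)"
    using inv_arrow_props(1-3)[OF iso(1) h(1)] by (simp add: hom_setI)
  then have isoR: "is_iso C ?R"
    unfolding cosimp_braiding_def pt_arrow_of maps
    by (intro is_iso_cmp[OF iso(2) h(2) is_iso_inv_arrow[OF iso(1)]])
  note two = two_point_axioms[OF point_rep[OF n(3,4)] is_monD'(2)[OF fob_mon[OF n(3,4)]] iso(1)]
  note three = three_point_yang_baxter[OF point_rep[OF n(5,6)] is_monD'(2)[OF fob_mon[OF n(5,6)]] iso(3)]
  \<comment> \<open>In A^1 the only point is the identity, so the word 0 0 has value \<mu>, and the
    exchange relation for the map [2] \<rightarrow> [1] becomes \<mu> R = \<mu>.\<close>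
  have "word_prod 1 [0, 0] = mmul (fob F 1) \<cdot> (idn C A \<otimes> idn C A)"
    using compatible_ev_append[OF point_compatible[OF n(1,2)], of "[0]" "[0]"] word_prod_1 by simp
  also have "\<dots> = mmul (fob F 1)"
    using is_monD(1-7)[OF fob_mon[OF n(1,2)]] F_props(2) by simp
  finally have "mmul (fob F 1) \<cdot> ?R = mmul (fob F 1)"
    using word_prod_braiding[OF n(2), of 0 0] by simp
  moreover have "is_mon C base"
    using fob_mon[OF n(1,2)] base_eq by simp
  ultimately show ?thesis
    using two three isoR cosimp_braiding_hom
    unfolding is_quasicomm_mon_def is_braided_mon_def yang_baxter_def Let_def base_simps by blast
qed

sublocale quasicomm_structure C A "mmul (fob F 1)" "mone (fob F 1)" "cosimp_braiding C F"
  using quasicomm unfolding base_def by unfold_locales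

lemma word_prod_mon_hom:
  assumes n: "1 \<le> n" "n \<in> S"
  shows "is_mon_hom C (power_mon n) (fob F n) (word_prod n [0..<n])"
  using rep_mon_hom[OF point_compatible[OF n] point_rep[OF n], of "[0..<n]"] by (simp add: subset_eq)

text \<open>Both sides of naturality are the product of points along \<open>word f\<close>: the
  comparison intertwines the shuffle operators with multiplication by points, and
  \<open>far F f\<close> relabels points.\<close>

lemma natural_iso_power:
  "natural_iso D (Mon C) power_cosimp F (\<lambda>n. (power_mon n, word_prod n [0..<n], fob F n))"
  unfolding natural_iso_def
proof (intro conjI ballI)
  fix n assume "n \<in> Ob D"
  then have n: "1 \<le> n" "n \<in> S" by (auto simp: D_simps)
  show "(power_mon n, word_prod n [0..<n], fob F n) \<in> hom_set (Mon C) (fob power_cosimp n) (fob F n)"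
    unfolding hom_set_Mon power_cosimp_def
    using is_mon_power_mon fob_mon[OF n] word_prod_mon_hom[OF n] by (simp add: und_def)
  have "is_iso C (word_prod n [0..<n])"
    using n by (intro word_prod_iso) auto
  then show "is_iso (Mon C) (power_mon n, word_prod n [0..<n], fob F n)"
    by (rule is_iso_Mon[OF is_mon_power_mon fob_mon[OF n] word_prod_mon_hom[OF n]])
next
  fix f assume f: "f \<in> Ar D"
  let ?m = "src simplex_cat f" and ?n = "tgt simplex_cat f"
  have fD: "f \<in> Ar simplex_cat" "?m \<in> S" "?n \<in> S"
    using f by (auto simp: D_simps)
  note wf = word_arrow[OF fD(1)]
  note n = wf(4) fD(3)
  note e = is_monD'(2)[OF fob_mon[OF n]]
  have w: "set [0..<?n] \<subseteq> {..<?n}" by auto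
  have h: "word_prod ?n [0..<?n] \<in> hom_set C (tpow ?n) (mobj (fob F ?n))"
    using word_prod_hom[OF n w] by simp
  have "word_prod ?n [0..<?n] \<cdot> pure ?n (word f)
      = ev (mobj (fob F ?n)) (left_mult (fob F ?n) (point ?n)) (word_prod ?n [0..<?n] \<cdot> tone ?n) (map (\<lambda>i. i) (word f))"
  proof (rule ev_intertwine[OF shuffle_operators point_operators[OF n] h tone_hom' wf(2)])
    fix i assume "i \<in> set (word f)"
    then show "word_prod ?n [0..<?n] \<cdot> shuffle ?n i
        = left_mult (fob F ?n) (point ?n) i \<cdot> (A \<rhd> word_prod ?n [0..<?n])"
      using ev_shuffle[OF point_rep[OF n] _ w _ e, of i] wf(2) by auto
  qed (use wf(2) in auto)
  also have "\<dots> = word_prod ?n (word f)"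
    using ev_tone[OF point_rep[OF n] w e] by simp
  also have "\<dots> = und (far F f) \<cdot> word_prod ?m [0..<?m]"
    using far_word_prod[OF f, of "[0..<?m]"] map_nth[of "word f"] by (simp add: subset_eq)
  finally show "(power_mon (tgt D f), word_prod (tgt D f) [0..<tgt D f], fob F (tgt D f)) \<cdot>\<^bsub>Mon C\<^esub> far power_cosimp f
      = far F f \<cdot>\<^bsub>Mon C\<^esub> (power_mon (src D f), word_prod (src D f) [0..<src D f], fob F (src D f))"
    unfolding power_cosimp_def by (subst far_mon_hom(2)[OF f]) (simp add: D_simps Mon_simps)
qed

text \<open>The comparison fixes A, as \<open>cosimp_iso\<close> demands of isomorphisms.\<close>

lemma natural_iso_power_1: "(power_mon 1, word_prod 1 [0..<1], fob F 1) = idn (Mon C) (fob F 1)"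
  unfolding power_mon_1 base_eq using word_prod_1 F_props(2) by (simp add: Mon_simps)

end

section \<open>The equivalence\<close>

text \<open>Preserving and reflecting the relations gives a well-defined injection on classes; for
  surjectivity a preimage up to s is enough.\<close>

lemma equivalent_dataI:
  assumes r: "equiv X r" and s: "equiv Y s"
    and maps: "\<And>x. x \<in> X \<Longrightarrow> \<phi> x \<in> Y"
    and iff: "\<And>x x'. \<lbrakk>x \<in> X; x' \<in> X\<rbrakk> \<Longrightarrow> (x, x') \<in> r \<longleftrightarrow> (\<phi> x, \<phi> x') \<in> s"
    and onto: "\<And>y. y \<in> Y \<Longrightarrow> \<exists>x\<in>X. (\<phi> x, y) \<in> s"
  shows "equivalent_data \<phi> X r Y s"
proof -
  let ?\<Phi> = "\<lambda>K. \<Union>x\<in>K. s `` {\<phi> x}"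
  have class_eq: "?\<Phi> (r `` {x}) = s `` {\<phi> x}" if x: "x \<in> X" for x
  proof -
    have "s `` {\<phi> x'} = s `` {\<phi> x}" if "x' \<in> r `` {x}" for x'
    proof -
      have "(x, x') \<in> r" using that by simp
      moreover from this have "x' \<in> X"
        using r by (auto simp: equiv_def refl_on_def)
      ultimately have "(\<phi> x, \<phi> x') \<in> s" using iff x by blast
      then show ?thesis using equiv_class_eq[OF s] by metis
    qed
    moreover have "x \<in> r `` {x}"
      using equiv_class_self[OF r x] .
    ultimately show ?thesis by blast
  qed
  have "bij_betw ?\<Phi> (X // r) (Y // s)"
    unfolding bij_betw_def
  proof
    show "inj_on ?\<Phi> (X // r)"
    proof (rule inj_onI)
      fix K K' assume "K \<in> X // r" "K' \<in> X // r" and eq: "?\<Phi> K = ?\<Phi> K'"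
      then obtain x x' where x: "x \<in> X" "K = r `` {x}" and x': "x' \<in> X" "K' = r `` {x'}"
        by (auto elim!: quotientE)
      have "s `` {\<phi> x} = s `` {\<phi> x'}"
        using eq class_eq x x' by simp
      then have "(\<phi> x, \<phi> x') \<in> s"
        using eq_equiv_class[OF _ s] maps x'(1) by blast
      then show "K = K'"
        using iff x x' equiv_class_eq[OF r] by simp
    qed
    show "?\<Phi> ` (X // r) = Y // s"
    proof (intro set_eqI iffI)
      fix L assume "L \<in> ?\<Phi> ` (X // r)"
      then show "L \<in> Y // s"
        using class_eq maps by (auto elim!: quotientE intro!: quotientI)
    next
      fix L assume "L \<in> Y // s"
      then obtain y where y: "y \<in> Y" "L = s `` {y}" by (auto elim!: quotientE)
      then obtain x where x: "x \<in> X" "(\<phi> x, y) \<in> s" using onto by blast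
      then have "L = ?\<Phi> (r `` {x})"
        using class_eq[OF x(1)] y(2) equiv_class_eq[OF s x(2)] by simp
      then show "L \<in> ?\<Phi> ` (X // r)"
        using quotientI[OF x(1), of r] by blast
    qed
  qed
  then show ?thesis
    unfolding equivalent_data_def using r s maps by auto
qed

section \<open>Isomorphism classes and quasi-commutative structures\<close>

lemma simplex_cat_full: "simplex_cat = full_subcategory simplex_cat {1..}"
  by (auto simp: full_subcategory_def simplex_cat_def)

lemma is_functor_full_subcategory:
  assumes "is_functor simplex_cat E F"
  shows "is_functor (full_subcategory simplex_cat S) E F"
  using assms by (simp add: is_functor_def full_subcategory_def)

context covering_cosimplicial
begin

lemma quasicomm_of_eq: "quasicomm_of C F = (mmul (fob F 1), mone (fob F 1), cosimp_braiding C F)"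
  by (simp add: quasicomm_of_def)

lemma quasicomm_of_in: "quasicomm_of C F \<in> quasicomm_structures C A"
  unfolding quasicomm_structures_def quasicomm_of_eq using quasicomm unfolding base_def by simp

end

text \<open>Tensor powers are built from the quasi-commutative structure alone, so F and G are
  compared with the same functor; the two comparisons, both the identity at 1, combine to an
  isomorphism.\<close>

lemma quasicomm_of_inj:
  assumes "covering_cosimplicial C A S F" "covering_cosimplicial C A S G"
    and eq: "quasicomm_of C F = quasicomm_of C G"
  shows "(F, G) \<in> cosimp_iso (full_subcategory simplex_cat S) C A"
proof -
  interpret F: covering_cosimplicial C A S F by fact
  interpret G: covering_cosimplicial C A S G by fact
  interpret Mon: category "Mon C" by (rule F.category_Mon)
  have comps: "mmul (fob G 1) = mmul (fob F 1)" "mone (fob G 1) = mone (fob F 1)"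
    "cosimp_braiding C G = cosimp_braiding C F"
    using eq by (auto simp: quasicomm_of_def)
  have fob1: "fob G 1 = fob F 1"
    using comps(1,2) F.F_props(2) G.F_props(2) by simp
  have M1: "fob F 1 \<in> Ob (Mon C)"
    using F.fob_mon[of 1] F.S by (auto simp: F.Mon_simps)
  let ?\<alpha> = "\<lambda>n. (F.power_mon n, F.word_prod n [0..<n], fob F n)"
    and ?\<beta> = "\<lambda>n. (F.power_mon n, G.word_prod n [0..<n], fob G n)"
  let ?\<gamma> = "\<lambda>n. ?\<beta> n \<cdot>\<^bsub>Mon C\<^esub> inv_arrow (Mon C) (?\<alpha> n)"
  have P: "is_functor F.D (Mon C) F.power_cosimp"
    by (rule is_functor_full_subcategory[OF F.is_functor_power_cosimp])
  have "src F.D f \<in> Ob F.D \<and> tgt F.D f \<in> Ob F.D" if "f \<in> Ar F.D" for f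
    using that word_arrow(3,4)[of f] by (auto simp: F.D_simps)
  then have nat: "natural_iso F.D (Mon C) F G ?\<gamma>"
    using natural_iso_span[OF F.category_Mon P F.natural_iso_power G.natural_iso_power[unfolded comps]]
      F.F_props(1) G.F_props(1) by blast
  have one: "?\<alpha> 1 = idn (Mon C) (fob F 1)" "?\<beta> 1 = idn (Mon C) (fob F 1)"
    using F.natural_iso_power_1 G.natural_iso_power_1[unfolded comps] unfolding fob1 by blast+
  have "idn (Mon C) (fob F 1) \<in> hom_set (Mon C) (fob F 1) (fob F 1)"
    using M1 by (simp add: Mon.hom_setI)
  then have "inv_arrow (Mon C) (idn (Mon C) (fob F 1)) = idn (Mon C) (fob F 1)"
    using Mon.inv_arrow_props[OF Mon.is_iso_idn[OF M1]] M1 by (metis Mon.cmp_idn_right')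
  then have "?\<gamma> 1 = idn (Mon C) (fob F 1)"
    unfolding one using M1 by simp
  then have "und (?\<gamma> 1) = idn C A"
    using F.F_props(2) by (simp add: F.Mon_simps und_def)
  then show ?thesis
    unfolding cosimp_iso_def using nat F.F G.F by blast
qed

text \<open>The component at 1 is the identity of A and a homomorphism, so the monoids agree. By
  naturality the component at 2 carries points to points, hence their products in both orders;
  cancelling the sorted product for G identifies the braidings.\<close>

lemma quasicomm_of_cong:
  assumes "covering_cosimplicial C A S F" "covering_cosimplicial C A S G"
    and iso: "(F, G) \<in> cosimp_iso (full_subcategory simplex_cat S) C A"
  shows "quasicomm_of C F = quasicomm_of C G"
proof -
  interpret F: covering_cosimplicial C A S F by fact
  interpret G: covering_cosimplicial C A S G by fact
  obtain \<alpha> where nat: "natural_iso F.D (Mon C) F G \<alpha>" and one: "und (\<alpha> 1) = idn C A"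
    using iso by (auto simp: cosimp_iso_def)
  have n: "1 \<le> (1::nat)" "1 \<in> S" "1 \<le> (2::nat)" "2 \<in> S" using F.S by auto
  have hom: "is_mon_hom C (fob F n) (fob G n) (und (\<alpha> n))" "\<alpha> n = (fob F n, und (\<alpha> n), fob G n)"
    "is_iso (Mon C) (\<alpha> n)" if "1 \<le> n" "n \<in> S" for n
  proof -
    have "n \<in> Ob F.D" using that by (simp add: F.D_simps)
    then have "\<alpha> n \<in> hom_set (Mon C) (fob F n) (fob G n)" and iso: "is_iso (Mon C) (\<alpha> n)"
      using nat unfolding natural_iso_def by blast+
    then show "is_mon_hom C (fob F n) (fob G n) (und (\<alpha> n))" "\<alpha> n = (fob F n, und (\<alpha> n), fob G n)"
      unfolding F.hom_set_Mon by blast+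
    show "is_iso (Mon C) (\<alpha> n)" by (rule iso)
  qed
  note mF = F.is_monD(1-7)[OF F.fob_mon[OF n(1,2)]] and mG = F.is_monD(1-7)[OF G.fob_mon[OF n(1,2)]]
  have comps: "mmul (fob G 1) = mmul (fob F 1)" "mone (fob G 1) = mone (fob F 1)"
    using F.is_mon_homD(5,6)[OF hom(1)[OF n(1,2)]] mF mG F.F_props(2) G.F_props(2)
    unfolding one by simp_all
  have base: "G.base = F.base"
    unfolding F.base_def G.base_def comps ..
  let ?h = "und (\<alpha> 2)"
  note h = hom[OF n(3,4)]
  have pts: "?h \<cdot>\<^bsub>C\<^esub> F.point 2 i = G.point 2 i" if i: "i < 2" for i
  proof -
    let ?f = "arrow_of 2 [i]"
    have f: "?f \<in> Ar F.D" by (rule F.point_arrow[OF n(4) i])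
    have "\<alpha> (tgt F.D ?f) \<cdot>\<^bsub>Mon C\<^esub> far F ?f = far G ?f \<cdot>\<^bsub>Mon C\<^esub> \<alpha> (src F.D ?f)"
      using nat f unfolding natural_iso_def by blast
    then have nat_f: "\<alpha> 2 \<cdot>\<^bsub>Mon C\<^esub> far F ?f = far G ?f \<cdot>\<^bsub>Mon C\<^esub> \<alpha> 1"
      by (simp add: F.D_simps)
    have "?h \<cdot>\<^bsub>C\<^esub> F.point 2 i = G.point 2 i \<cdot>\<^bsub>C\<^esub> und (\<alpha> 1)"
      unfolding F.point_def G.point_def F.und_Mon_cmp[symmetric] nat_f ..
    then have "?h \<cdot>\<^bsub>C\<^esub> F.point 2 i = G.point 2 i \<cdot>\<^bsub>C\<^esub> idn C A"
      unfolding one .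
    then show ?thesis
      using F.is_mon_homD(1-3)[OF G.point_mon_hom[OF n(4) i], unfolded G.base_simps] by simp
  qed
  have words: "?h \<cdot>\<^bsub>C\<^esub> F.word_prod 2 w = G.word_prod 2 w" if w: "set w \<subseteq> {..<2}" for w
  proof -
    have "?h \<cdot>\<^bsub>C\<^esub> F.word_prod 2 w = G.word_prod 2 (map (\<lambda>i. i) w)"
    proof (rule F.ev_left_mult_hom[OF F.fob_mon[OF n(3,4)] _ G.fob_mon[OF n(3,4)] _ h(1) w])
      show "is_mon_hom C F.base (fob F 2) (F.point 2 i)" if "i < 2" for i
        by (rule F.point_mon_hom[OF n(4) that])
      show "is_mon_hom C F.base (fob G 2) (G.point 2 i)" if "i < 2" for i
        using G.point_mon_hom[OF n(4) that] unfolding base .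
      show "?h \<cdot>\<^bsub>C\<^esub> F.point 2 i = G.point 2 i" if "i \<in> set w" for i
        using that w pts by blast
    qed (use w in simp)
    then show ?thesis by simp
  qed
  have "G.word_prod 2 [0, 1] \<cdot>\<^bsub>C\<^esub> cosimp_braiding C F
      = (?h \<cdot>\<^bsub>C\<^esub> F.word_prod 2 [0, 1]) \<cdot>\<^bsub>C\<^esub> cosimp_braiding C F"
    using words[of "[0, 1]"] by simp
  also have "\<dots> = ?h \<cdot>\<^bsub>C\<^esub> (F.word_prod 2 [0, 1] \<cdot>\<^bsub>C\<^esub> cosimp_braiding C F)"
    using F.is_mon_homD(1-3)[OF h(1)] F.hom_setD[OF F.cosimp_braiding_hom]
      F.hom_setD[OF F.word_prod_hom[OF n(3,4), of "[0, 1]"]] by (intro F.cmp_assoc) simp_all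
  also have "\<dots> = ?h \<cdot>\<^bsub>C\<^esub> F.word_prod 2 [1, 0]"
    unfolding F.word_prod_braiding_2 ..
  also have "\<dots> = G.word_prod 2 [0, 1] \<cdot>\<^bsub>C\<^esub> cosimp_braiding C G"
    unfolding G.word_prod_braiding_2 by (rule words) auto
  finally have eq: "G.word_prod 2 [0, 1] \<cdot>\<^bsub>C\<^esub> cosimp_braiding C F
      = G.word_prod 2 [0, 1] \<cdot>\<^bsub>C\<^esub> cosimp_braiding C G" .
  have G_iso: "is_iso C (G.word_prod 2 [0, 1])"
    by (rule G.word_prod_iso[OF n(3,4)]) (auto simp: lessThan_2_3)
  have G_src: "src C (G.word_prod 2 [0, 1]) = A \<odot>\<^bsub>C\<^esub> A"
    using F.hom_setD(2)[OF G.word_prod_hom[OF n(3,4), of "[0, 1]"]] by simp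
  have "cosimp_braiding C F = cosimp_braiding C G"
    by (rule F.is_iso_cancel[OF G_iso eq])
      (simp_all only: G_src F.hom_setD[OF F.cosimp_braiding_hom] F.hom_setD[OF G.cosimp_braiding_hom])
  then show ?thesis
    using comps by (simp add: quasicomm_of_def)
qed

text \<open>Isomorphism is the kernel of \<open>quasicomm_of\<close>. This makes it an equivalence
  relation and reduces all three correspondences to statements about the values of that map.\<close>

lemma cosimp_iso_iff:
  assumes C: "strict_monoidal_category C" and S: "{1, 2, 3} \<subseteq> S"
  shows "(F, G) \<in> cosimp_iso (full_subcategory simplex_cat S) C A \<longleftrightarrow>
    F \<in> covering_cosimp (full_subcategory simplex_cat S) C A \<and>
    G \<in> covering_cosimp (full_subcategory simplex_cat S) C A \<and> quasicomm_of C F = quasicomm_of C G"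
proof -
  have loc: "covering_cosimplicial C A S F" if "F \<in> covering_cosimp (full_subcategory simplex_cat S) C A" for F
    using C S that by (simp add: covering_cosimplicial_def covering_cosimplicial_axioms_def)
  have "F \<in> covering_cosimp (full_subcategory simplex_cat S) C A \<and>
      G \<in> covering_cosimp (full_subcategory simplex_cat S) C A"
    if "(F, G) \<in> cosimp_iso (full_subcategory simplex_cat S) C A"
    using that by (simp add: cosimp_iso_def)
  then show ?thesis
    using quasicomm_of_inj[OF loc loc] quasicomm_of_cong[OF loc loc] by blast
qed

lemma simplex_cat3_cmp:
  assumes "f \<in> Ar simplex_cat3" "g \<in> Ar simplex_cat3" "tgt simplex_cat3 f = src simplex_cat3 g"
  shows "g \<cdot>\<^bsub>simplex_cat3\<^esub> f \<in> Ar simplex_cat3"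
  using assms simplex_cmp_arrow[of f g] by (simp add: simplex_cat3_def full_subcategory_def)

text \<open>The structure is read off from [1], [2] and the two points, all of which survive
  truncation.\<close>

lemma quasicomm_of_truncate3: "quasicomm_of C (truncate3 F) = quasicomm_of C F"
proof -
  have "1 \<in> Ob simplex_cat3" "2 \<in> Ob simplex_cat3"
    by (simp_all add: simplex_cat3_def full_subcategory_def simplex_simps)
  moreover have "pt 1 \<in> Ar simplex_cat3" "pt 2 \<in> Ar simplex_cat3"
    unfolding pt_arrow_of simplex_cat3_def full_subcategory_def
    by (auto intro!: arrow_of_arrow)
  ultimately show ?thesis
    by (simp add: quasicomm_of_def cosimp_braiding_def covering_map_def truncate3_def restrict_functor_def
        del: One_nat_def)
qed

lemma truncate3_covering:
  assumes "F \<in> covering_cosimp simplex_cat C A"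
  shows "truncate3 F \<in> covering_cosimp simplex_cat3 C A"
proof -
  have F: "is_functor simplex_cat (Mon C) F" "mobj (fob F 1) = A" "covering_condition simplex_cat C F"
    using assms by (auto simp: covering_cosimp_def)
  have Ob3: "n \<in> Ob simplex_cat3 \<longleftrightarrow> n \<in> {1, 2, 3}" for n
    by (auto simp: simplex_cat3_def full_subcategory_def simplex_simps)
  have ends: "src simplex_cat3 f \<in> Ob simplex_cat3" "tgt simplex_cat3 f \<in> Ob simplex_cat3"
    if "f \<in> Ar simplex_cat3" for f
    using that unfolding Ob3 by (auto simp: simplex_cat3_def full_subcategory_def)
  have idn: "idn simplex_cat3 n \<in> Ar simplex_cat3" if "n \<in> Ob simplex_cat3" for n
    using that simplex_idn[of n] unfolding Ob3 by (auto simp: simplex_cat3_def full_subcategory_def)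
  have F3: "is_functor simplex_cat3 (Mon C) F"
    unfolding simplex_cat3_def by (rule is_functor_full_subcategory[OF F(1)])
  have "is_functor simplex_cat3 (Mon C) (truncate3 F)"
    using F3 ends idn simplex_cat3_cmp
    unfolding is_functor_def truncate3_def restrict_functor_def by simp
  moreover have "covering_condition simplex_cat3 C (truncate3 F)"
    unfolding covering_condition_def
  proof (intro ballI allI impI)
    fix n fs assume n: "n \<in> Ob simplex_cat3" and fs: "covering_family n fs"
    \<comment> \<open>An injective map into [n] has source at most n \<le> 3, so
      \<open>restrict\<close> leaves F unchanged on every arrow of the family.\<close>
    have "f \<in> Ar simplex_cat3" if f: "f \<in> set fs" for f
    proof -
      note arrow = covering_family_words(3)[OF fs f]
      then have "1 \<le> src simplex_cat f" using word_arrow(3) by blast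
      then have "src simplex_cat f \<in> {1, 2, 3}" "tgt simplex_cat f \<in> {1, 2, 3}"
        using arrow n unfolding Ob3 by auto
      then show ?thesis
        using arrow by (simp add: simplex_cat3_def full_subcategory_def)
    qed
    then have "covering_map C (truncate3 F) n fs = covering_map C F n fs"
      using n by (simp add: covering_map_def truncate3_def restrict_functor_def cong: map_cong)
    moreover have "n \<in> Ob simplex_cat"
      using n by (simp add: simplex_cat3_def full_subcategory_def)
    ultimately show "is_iso C (covering_map C (truncate3 F) n fs)"
      using F(3) fs by (simp add: covering_condition_def)
  qed
  moreover have "mobj (fob (truncate3 F) 1) = A"
    using F(2) by (simp add: truncate3_def restrict_functor_def Ob3)
  ultimately show ?thesis
    by (simp add: covering_cosimp_def)
qed

theorem theorem3p2p1:
  fixes C :: "('o, 'a, 'x) mcat_scheme" and A :: 'o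
  assumes "strict_monoidal_category C" and "A \<in> Ob C"
  shows "equivalent_data truncate3
           (covering_cosimp simplex_cat C A) (cosimp_iso simplex_cat C A)
           (covering_cosimp simplex_cat3 C A) (cosimp_iso simplex_cat3 C A)
       \<and> equivalent_data (quasicomm_of C)
           (covering_cosimp simplex_cat3 C A) (cosimp_iso simplex_cat3 C A)
           (quasicomm_structures C A) (Id_on (quasicomm_structures C A))
       \<and> equivalent_data (quasicomm_of C)
           (covering_cosimp simplex_cat C A) (cosimp_iso simplex_cat C A)
           (quasicomm_structures C A) (Id_on (quasicomm_structures C A))"
proof -
  let ?X = "covering_cosimp simplex_cat C A" and ?X3 = "covering_cosimp simplex_cat3 C A"
    and ?Q = "quasicomm_structures C A"
  let ?r = "cosimp_iso simplex_cat C A" and ?r3 = "cosimp_iso simplex_cat3 C A"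
  have iff: "(F, G) \<in> ?r \<longleftrightarrow> F \<in> ?X \<and> G \<in> ?X \<and> quasicomm_of C F = quasicomm_of C G"
    and iff3: "(F, G) \<in> ?r3 \<longleftrightarrow> F \<in> ?X3 \<and> G \<in> ?X3 \<and> quasicomm_of C F = quasicomm_of C G" for F G
    using cosimp_iso_iff[OF assms(1), of "{1..}" F G A] cosimp_iso_iff[OF assms(1), of "{1, 2, 3}" F G A]
    unfolding simplex_cat_full[symmetric] simplex_cat3_def[symmetric] by auto
  have equivs: "equiv ?X ?r" "equiv ?X3 ?r3" "equiv ?Q (Id_on ?Q)"
    by (auto intro!: equivI refl_onI symI transI simp: iff iff3)
  have in_Q3: "quasicomm_of C F \<in> ?Q" if "F \<in> ?X3" for F
  proof -
    interpret covering_cosimplicial C A "{1, 2, 3}" F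
      using assms(1) that
      by (simp add: covering_cosimplicial_def covering_cosimplicial_axioms_def simplex_cat3_def)
    show ?thesis by (rule quasicomm_of_in)
  qed
  have in_Q: "quasicomm_of C F \<in> ?Q" if "F \<in> ?X" for F
    using in_Q3[OF truncate3_covering[OF that]] by (simp add: quasicomm_of_truncate3)
  have onto: "\<exists>F\<in>?X. quasicomm_of C F = q" if qQ: "q \<in> ?Q" for q
  proof -
    obtain \<mu> \<iota> R where q: "q = (\<mu>, \<iota>, R)"
      and qc: "is_quasicomm_mon C \<lparr>mobj = A, mmul = \<mu>, mone = \<iota>\<rparr> R"
      using qQ by (auto simp: quasicomm_structures_def)
    interpret strict_monoidal_category C by (rule assms(1))
    interpret quasicomm_structure C A \<mu> \<iota> R
      using qc assms(2)
      by unfold_locales (auto simp: is_quasicomm_mon_def is_braided_mon_def is_mon_def yang_baxter_def Let_def)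
    show ?thesis
      using power_cosimp_covering quasicomm_of_power_cosimp q by blast
  qed
  have "equivalent_data truncate3 ?X ?r ?X3 ?r3"
  proof (rule equivalent_dataI[OF equivs(1,2)])
    fix G assume G: "G \<in> ?X3"
    \<comment> \<open>A truncated complex is prolonged by passing to its quasi-commutative structure
      and realising that by tensor powers; the result restricts to G up to isomorphism.\<close>
    obtain F where F: "F \<in> ?X" "quasicomm_of C F = quasicomm_of C G"
      using onto[OF in_Q3[OF G]] by blast
    have "(truncate3 F, G) \<in> ?r3"
      unfolding iff3 using truncate3_covering[OF F(1)] G F(2) by (simp add: quasicomm_of_truncate3)
    then show "\<exists>F\<in>?X. (truncate3 F, G) \<in> ?r3"
      using F(1) by (rule bexI)
  qed (auto simp: iff iff3 truncate3_covering quasicomm_of_truncate3)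
  moreover have "equivalent_data (quasicomm_of C) ?X ?r ?Q (Id_on ?Q)"
    by (rule equivalent_dataI[OF equivs(1,3)]) (use in_Q onto in \<open>auto simp: iff Id_on_iff\<close>)
  moreover have "equivalent_data (quasicomm_of C) ?X3 ?r3 ?Q (Id_on ?Q)"
  proof (rule equivalent_dataI[OF equivs(2,3)])
    fix q assume q: "q \<in> ?Q"
    then obtain F where F: "F \<in> ?X" "quasicomm_of C F = q"
      using onto by blast
    then show "\<exists>F\<in>?X3. (quasicomm_of C F, q) \<in> Id_on ?Q"
      using q truncate3_covering[OF F(1)] by (intro bexI[of _ "truncate3 F"]) (auto simp: quasicomm_of_truncate3)
  qed (use in_Q3 in \<open>auto simp: iff3 Id_on_iff\<close>)
  ultimately show ?thesis by blast
qed

end
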